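(* Let $s\ge 0$ and $u,v\in\mathcal S_{\rm poly}$. Assume that $u$ is nonconstant and radial. If $[T^s_u,T^s_v]=0$, then $v$ is also radial.
   Context: $dA$ is the ordinary area measure on $\mathbb C$. For a real number $s\ge 0$ put $G_s(z)=\frac1\pi |z|^{2s}e^{-|z|^2}$. For an entire function $f(z)=\sum_{n\ge 0} a_nz^n$ put $\mathcal R^sf(z)=(1+|z|)^{-s}\sum_{n\ge0}\frac{\Gamma(s+n+1)}{n!}a_nz^n$. The Fock-Sobolev space $F^{2,s}$ is the space of all entire $f$ with $\mathcal R^sf\in L^2(\frac1\pi e^{-|z|^2}dA)$; it is known to coincide with the closure of the holomorphic polynomials in $L^2(G_s\,dA)$, and it is equipped with the inner product of $L^2(G_s\,dA)$. $P^s:L^2(G_s\,dA)\to F^{2,s}$ is the orthogonal projection. $\mathcal S_{\rm poly}$ is the class of all complex measurable functions $u$ on $\mathbb C$ for which there are constants $C>0$ and $m>0$ with $|u(z)|\le C(1+|z|)^m$ for almost every $z\in\mathbb C$. For $u\in\mathcal S_{\rm poly}$, the Toeplitz operator $T^s_u$ is the densely defined operator on $F^{2,s}$ given by $T^s_uf=P^s(uf)$; it is defined on holomorphic polynomials and, more generally, by the same formula on those $f\in F^{2,s}$ with $uf\in L^2(G_s\,dA)$. Products $T^s_uT^s_v$ with $u,v\in\mathcal S_{\rm poly}$ are well defined on all holomorphic polynomials. The commutator is $[T^s_u,T^s_v]=T^s_uT^s_v-T^s_vT^s_u$, and $[T^s_u,T^s_v]=0$ means that it annihilates all holomorphic polynomials.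 Functions are identified when equal $dA$-almost everywhere: a function $u$ is radial if $u(z)$ depends only on $|z|$ (a.e.), and nonconstant means not a.e. equal to a constant. *)

theory Defs
  imports "HOL-Complex_Analysis.Complex_Analysis"
begin

definition square_integrable :: "complex measure \<Rightarrow> (complex \<Rightarrow> complex) set" where
  "square_integrable M = {f \<in> borel_measurable M. integrable M (\<lambda>z. (cmod (f z))\<^sup>2)}"

definition gaussian :: "complex measure" where
  "gaussian = density lebesgue (\<lambda>z. ennreal (1 / pi * exp (- (cmod z)\<^sup>2)))"

text \<open>Since \<open>0 powr 0 = 0\<close>, the density for \<open>s = 0\<close> vanishes at the origin, where the
  usual one is \<open>1 / pi\<close>; the measure is the same.\<close>

definition weighted_gaussian :: "real \<Rightarrow> complex measure" where
  "weighted_gaussian s =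
     density lebesgue (\<lambda>z. ennreal (1 / pi * cmod z powr (2 * s) * exp (- (cmod z)\<^sup>2)))"

definition weighted_inner ::
    "real \<Rightarrow> (complex \<Rightarrow> complex) \<Rightarrow> (complex \<Rightarrow> complex) \<Rightarrow> complex" where
  "weighted_inner s f g = (LINT z|weighted_gaussian s. f z * cnj (g z))"

definition fock_sobolev_R :: "real \<Rightarrow> (complex \<Rightarrow> complex) \<Rightarrow> complex \<Rightarrow> complex" where
  "fock_sobolev_R s f z =
     of_real ((1 + cmod z) powr (- s)) *
     (\<Sum>n. of_real (Gamma (s + real n + 1) / fact n) * fps_nth (fps_expansion f 0) n * z ^ n)"

definition fock_sobolev :: "real \<Rightarrow> (complex \<Rightarrow> complex) set" where
  "fock_sobolev s = {f. f holomorphic_on UNIV \<and> fock_sobolev_R s f \<in> square_integrable gaussian}"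

text \<open>For \<open>f \<in> square_integrable (weighted_gaussian s)\<close> and \<open>s \<ge> 0\<close> the projection is the
  unique entire function below: \<open>fock_sobolev s\<close> is a closed subspace of
  \<open>L\<^sup>2(G\<^sub>s dA)\<close>, and entire functions that agree almost everywhere are equal. For
  other \<open>f\<close> the value has no meaning.\<close>

definition fock_projection :: "real \<Rightarrow> (complex \<Rightarrow> complex) \<Rightarrow> complex \<Rightarrow> complex" where
  "fock_projection s f =
     (THE g. g \<in> fock_sobolev s \<and>
             (\<forall>h\<in>fock_sobolev s. weighted_inner s (\<lambda>z. f z - g z) h = 0))"

definition S_poly :: "(complex \<Rightarrow> complex) set" where
  "S_poly = {u \<in> borel_measurable lebesgue.
     \<exists>C>0. \<exists>m>0. AE z in lebesgue. cmod (u z) \<le> C * (1 + cmod z) powr m}"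

definition toeplitz :: "real \<Rightarrow> (complex \<Rightarrow> complex) \<Rightarrow> (complex \<Rightarrow> complex) \<Rightarrow> complex \<Rightarrow> complex" where
  "toeplitz s u f = fock_projection s (\<lambda>z. u z * f z)"

definition toeplitz_commutator ::
    "real \<Rightarrow> (complex \<Rightarrow> complex) \<Rightarrow> (complex \<Rightarrow> complex) \<Rightarrow> (complex \<Rightarrow> complex) \<Rightarrow> complex \<Rightarrow> complex" where
  "toeplitz_commutator s u v f z = toeplitz s u (toeplitz s v f) z - toeplitz s v (toeplitz s u f) z"

text \<open>No measurability is asked of \<open>\<phi>\<close>: if \<open>u\<close> is measurable, then by Fubini's theorem
  in polar coordinates \<open>\<phi>\<close> is Lebesgue measurable on the positive half-line.\<close>

definition radial :: "(complex \<Rightarrow> complex) \<Rightarrow> bool" where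
  "radial u \<longleftrightarrow> (\<exists>\<phi> :: real \<Rightarrow> complex. AE z in lebesgue. u z = \<phi> (cmod z))"

definition nonconstant :: "(complex \<Rightarrow> complex) \<Rightarrow> bool" where
  "nonconstant u \<longleftrightarrow> \<not> (\<exists>c. AE z in lebesgue. u z = c)"

end

theory Submission
  imports Defs
begin

text \<open>Monomials \<open>z\<^sup>n\<close> are orthogonal in \<open>L\<^sup>2(G\<^sub>s dA)\<close> with squared norms \<open>\<Gamma>(n + s + 1)\<close>, so the Fock-Sobolev
projection reads off the coefficients \<open>\<langle>f, z\<^sup>m\<rangle> / \<Gamma>(m + s + 1)\<close>. Write \<open>M\<^sub>f(y)\<close> for the integral of
\<open>f(z) |z|^(2 y)\<close> against the Gaussian measure \<open>\<pi>\<^sup>-\<^sup>1 exp(-|z|\<^sup>2) dA\<close>. A radial \<open>u\<close> acts diagonally,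
\<open>T\<^sub>u z\<^sup>n = \<omega>(n) z\<^sup>n\<close> with \<open>\<omega>(n) = M\<^sub>u(n + s) / \<Gamma>(n + s + 1)\<close>, and the coefficient of \<open>z\<^sup>m\<close> in
\<open>[T\<^sub>u, T\<^sub>v] z\<^sup>n = 0\<close> is the equation \<open>(\<omega>(m) - \<omega>(n)) \<langle>v z\<^sup>n, z\<^sup>m\<rangle> = 0\<close>
(lemma \<open>toeplitz_commutator_coefficients\<close>).

Fix \<open>k = |m - n| > 0\<close>. Then \<open>\<langle>v z\<^sup>n, z\<^sup>m\<rangle>\<close> is the value of \<open>M\<^sub>V\<close> at \<open>min m n + s\<close>, where \<open>V\<close> is
\<open>v\<close> times \<open>z\<^sup>k\<close> or its conjugate, and for every \<open>n\<close> at least one of \<open>\<omega>(n + k) - \<omega>(n)\<close> and \<open>M\<^sub>V(n + s)\<close>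
is zero. The central step is that one of them is zero for all \<open>n\<close>, and even as a function of a complex
argument (lemma \<open>mellin_dichotomy\<close>). Counting zeros is not enough, since the growth of the factors allows each
of them to vanish on a set of density one half. Instead, each factor is a sequence of even moments
\<open>\<integral> X^(2 n) F\<close>; for the first one, division by \<open>(y + 1)\<cdots>(y + k)\<close> is written as a Beta integral.
Their product is then a sequence of even moments on a product space. There
\<open>X \<le> |z| |\<zeta>| \<le> (|z|\<^sup>2 + |\<zeta>|\<^sup>2) / 2\<close>, so that \<open>exp X\<close> is integrable and the vanishing even moments force
\<open>\<integral> cos(w X) F = 0\<close> for all real \<open>w\<close>. Integrating \<open>1 - cos(w X)\<close> against \<open>w^(-1-p) dw\<close> turns this into the
vanishing of the fractional moments \<open>\<integral> X^p F\<close>, \<open>0 < p < 2\<close> (lemma \<open>moment_product_zero\<close>). So the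
product of two holomorphic functions vanishes on an interval, and one of them is zero.

If \<open>\<omega>(y + k) = \<omega>(y)\<close> for all \<open>y\<close>, put \<open>\<omega>\<^sub>n = \<omega>(n - s) = M\<^sub>u(n) / n!\<close>, a sequence of period \<open>k\<close>. Its generating
function \<open>\<Sum> \<omega>\<^sub>n w\<^sup>n = \<integral> u exp(w |z|\<^sup>2)\<close> stays bounded as \<open>w\<close> tends radially to any point \<open>w\<^sub>0 \<noteq> 1\<close> of
the unit circle, but it is a polynomial divided by \<open>1 - w\<^sup>k\<close>. Hence the polynomial vanishes at all \<open>k\<close>-th
roots of unity except 1, the sequence is constant, and \<open>u\<close> is constant
(lemma \<open>periodic_imp_constant\<close>), which is excluded.

So \<open>M\<^sub>V\<close> is zero for every \<open>k > 0\<close>: all moments \<open>\<integral> v z\<^sup>a (cnj z)\<^sup>b\<close> with \<open>a \<noteq> b\<close> vanish. Then \<open>v\<close> and each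
of its rotations have the same Gaussian moments, hence agree almost everywhere
(lemma \<open>gauss_moments_zero_imp_AE_zero\<close>), and Fubini's theorem makes \<open>v\<close> radial.\<close>

section \<open>The Gaussian measure on the complex plane\<close>

text \<open>The Gaussian measure is taken on Borel sets, so that compositions with rotations and functions on
product spaces stay measurable; symbols that are only Lebesgue measurable are replaced by Borel versions at the very end.
The factor \<open>|z|^(2 s)\<close> of \<open>G\<^sub>s\<close> is always written inside the integrand.\<close>

definition gauss :: "complex measure" where
  "gauss = density lborel (\<lambda>z. ennreal (1 / pi * exp (- (cmod z)\<^sup>2)))"

lemma sets_gauss [simp, measurable_cong]: "sets gauss = sets borel"
  by (simp add: gauss_def)

lemma space_gauss [simp]: "space gauss = UNIV"
  by (simp add: gauss_def)

text \<open>The disc \<open>|z|\<^sup>2 \<le> a\<close> has area \<open>\<pi> a\<close>, so the image of the area measure under \<open>|z|\<^sup>2\<close> is \<open>\<pi>\<close> times Lebesgue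
measure on the half-line. This replaces integration in polar coordinates.\<close>

lemma nn_integral_norm_square:
  fixes h :: "real \<Rightarrow> ennreal"
  assumes [measurable]: "h \<in> borel_measurable borel"
  shows "(\<integral>\<^sup>+z. h ((cmod z)\<^sup>2) \<partial>lborel) = ennreal pi * (\<integral>\<^sup>+t. h t * indicator {0..} t \<partial>lborel)"
proof -
  define D where "D = density lborel (\<lambda>t::real. ennreal pi * indicator {0..} t)"
  have eq: "emeasure (distr lborel borel (\<lambda>z::complex. (cmod z)\<^sup>2)) {..a} = emeasure D {..a}" for a
  proof (cases "a \<ge> 0")
    case True
    have "emeasure (distr lborel borel (\<lambda>z. (cmod z)\<^sup>2)) {..a} = emeasure lborel (cball 0 (sqrt a) :: complex set)"
    proof (subst emeasure_distr)
      show "emeasure lborel ((\<lambda>z::complex. (cmod z)\<^sup>2) -` {..a} \<inter> space lborel) = emeasure lborel (cball 0 (sqrt a) :: complex set)"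
        using True by (intro arg_cong[where f = "emeasure lborel"]) (auto simp: real_le_rsqrt sqrt_ge_absD real_sqrt_le_iff
          dest: real_sqrt_le_mono intro: real_le_rsqrt)
    qed auto
    also have "\<dots> = ennreal (pi * a)"
      using True by (simp add: emeasure_cball unit_ball_vol_2)
    also have "\<dots> = emeasure D {..a}"
    proof -
      have "emeasure D {..a} = (\<integral>\<^sup>+t. ennreal pi * indicator {0..a} t \<partial>lborel)"
        unfolding D_def by (subst emeasure_density) (auto intro!: nn_integral_cong split: split_indicator)
      also have "\<dots> = ennreal (pi * a)"
        using True by (simp add: nn_integral_cmult_indicator ennreal_mult)
      finally show ?thesis by simp
    qed
    finally show ?thesis .
  next
    case False
    have "(\<lambda>z::complex. (cmod z)\<^sup>2) -` {..a} = {}"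
      using False order_trans[OF zero_le_power2] by blast
    moreover have "emeasure D {..a} = 0"
    proof -
      have *: "ennreal pi * indicator {0..} t * indicator {..a} t = 0" for t
        using False by (auto split: split_indicator)
      have "emeasure D {..a} = (\<integral>\<^sup>+t. ennreal pi * indicator {0..} t * indicator {..a} t \<partial>lborel)"
        unfolding D_def by (rule emeasure_density) auto
      then show ?thesis by (simp only: *) simp
    qed
    ultimately show ?thesis by (simp add: emeasure_distr)
  qed
  have "distr lborel borel (\<lambda>z::complex. (cmod z)\<^sup>2) = D"
  proof (rule measure_eqI_generator_eq[where E = "range (\<lambda>a::real. {..a})" and \<Omega> = UNIV
        and A = "\<lambda>i. {..real i}"])
    show "Int_stable (range (\<lambda>a::real. {..a}))"
      by (auto simp: Int_stable_def)
    show "sets (distr lborel borel (\<lambda>z::complex. (cmod z)\<^sup>2)) = sigma_sets UNIV (range (\<lambda>a::real. {..a}))"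
      by (simp add: borel_eq_atMost)
    show "sets D = sigma_sets UNIV (range (\<lambda>a::real. {..a}))"
      by (simp add: borel_eq_atMost D_def)
    show "(\<Union>i. {..real i}) = UNIV"
      by (auto simp: real_arch_simple)
    show "emeasure (distr lborel borel (\<lambda>z::complex. (cmod z)\<^sup>2)) {..real i} \<noteq> \<infinity>" for i
    proof -
      have "emeasure D {..real i} \<le> (\<integral>\<^sup>+t. ennreal pi * indicator {0..real i} t \<partial>lborel)"
        unfolding D_def by (subst emeasure_density) (auto intro!: nn_integral_mono split: split_indicator)
      also have "\<dots> < \<infinity>"
        by (simp add: nn_integral_cmult_indicator ennreal_mult_less_top)
      finally show ?thesis by (simp add: eq)
    qed
  qed (auto simp: eq)
  then have "(\<integral>\<^sup>+t. h t \<partial>distr lborel borel (\<lambda>z::complex. (cmod z)\<^sup>2)) = (\<integral>\<^sup>+t. h t \<partial>D)"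
    by simp
  then show ?thesis
    unfolding D_def by (simp add: nn_integral_distr nn_integral_density nn_integral_cmult mult_ac)
qed

lemma nn_integral_lborel_Complex:
  fixes f :: "complex \<Rightarrow> ennreal"
  assumes [measurable]: "f \<in> borel_measurable borel"
  shows "(\<integral>\<^sup>+z. f z \<partial>lborel) = (\<integral>\<^sup>+x. \<integral>\<^sup>+y. f (Complex x y) \<partial>lborel \<partial>lborel)"
proof -
  have c: "continuous_on UNIV (\<lambda>p::real \<times> real. Complex (fst p) (snd p))"
    unfolding Complex_eq by (intro continuous_intros)
  then have m [measurable]: "(\<lambda>p. Complex (fst p) (snd p)) \<in> borel_measurable (borel :: (real \<times> real) measure)"
    by (rule borel_measurable_continuous_onI)
  have "lborel = distr (lborel :: (real \<times> real) measure) borel (\<lambda>p. Complex (fst p) (snd p))"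
  proof (rule lborel_eqI)
    fix l u :: complex
    assume le: "\<And>b. b \<in> Basis \<Longrightarrow> l \<bullet> b \<le> u \<bullet> b"
    have le': "Re l \<le> Re u" "Im l \<le> Im u"
      using le[of 1] le[of \<i>] by (auto simp: Basis_complex_def)
    have "(\<lambda>p. Complex (fst p) (snd p)) -` box l u = box (Re l, Im l) (Re u, Im u)"
      by (auto simp: box_def Basis_complex_def Basis_prod_def)
    then have "emeasure (distr (lborel :: (real \<times> real) measure) borel (\<lambda>p. Complex (fst p) (snd p))) (box l u)
        = emeasure lborel (box (Re l, Im l) (Re u, Im u))"
      by (simp add: emeasure_distr)
    also have "\<dots> = (\<Prod>b\<in>Basis. (u - l) \<bullet> b)"
      using le' by (subst emeasure_lborel_box)
        (auto simp: Basis_prod_def Basis_complex_def prod.union_disjoint prod.reindex inj_on_def)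
    finally show "emeasure (distr (lborel :: (real \<times> real) measure) borel (\<lambda>p. Complex (fst p) (snd p))) (box l u)
        = (\<Prod>b\<in>Basis. (u - l) \<bullet> b)" .
  qed simp
  then have "(\<integral>\<^sup>+z. f z \<partial>lborel)
      = (\<integral>\<^sup>+z. f z \<partial>distr (lborel :: (real \<times> real) measure) borel (\<lambda>p. Complex (fst p) (snd p)))"
    by simp
  also have "\<dots> = (\<integral>\<^sup>+p. f (Complex (fst p) (snd p)) \<partial>(lborel \<Otimes>\<^sub>M lborel))"
    by (simp add: nn_integral_distr lborel_prod)
  also have "\<dots> = (\<integral>\<^sup>+x. \<integral>\<^sup>+y. f (Complex x y) \<partial>lborel \<partial>lborel)"
  proof -
    have "(\<lambda>p. f (Complex (fst p) (snd p))) \<in> borel_measurable (lborel \<Otimes>\<^sub>M lborel)"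
      unfolding lborel_prod by measurable
    from lborel.nn_integral_fst[OF this] show ?thesis by simp
  qed
  finally show ?thesis .
qed

text \<open>For \<open>c \<noteq> 0\<close> the rotation is a composition of maps that change one real coordinate affinely and fix the
other; the scaling factors \<open>1/c\<close> and \<open>c\<close> cancel.\<close>

lemma nn_integral_lborel_rotate_aux:
  fixes f :: "complex \<Rightarrow> ennreal"
  assumes [measurable]: "f \<in> borel_measurable borel" and "c\<^sup>2 + s\<^sup>2 = 1" "c \<noteq> (0::real)"
  shows "(\<integral>\<^sup>+z. f (Complex c s * z) \<partial>lborel) = (\<integral>\<^sup>+z. f z \<partial>lborel)"
proof -
  have [measurable]: "(\<lambda>p. Complex (g p) (h p)) \<in> borel_measurable M" if "g \<in> borel_measurable M" "h \<in> borel_measurable M"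
    for g h and M :: "'x measure"
    using that by (simp add: borel_measurable_complex_iff)
  have "(\<integral>\<^sup>+z. f (Complex c s * z) \<partial>lborel)
      = (\<integral>\<^sup>+x. \<integral>\<^sup>+y. f (Complex (c * x - s * y) (c * y + s * x)) \<partial>lborel \<partial>lborel)"
    by (subst nn_integral_lborel_Complex) (auto simp: complex_mult)
  also have "\<dots> = (\<integral>\<^sup>+y. \<integral>\<^sup>+x. f (Complex (c * x - s * y) (c * y + s * x)) \<partial>lborel \<partial>lborel)"
    by (rule lborel_pair.Fubini') measurable
  also have "\<dots> = (\<integral>\<^sup>+y. ennreal \<bar>1/c\<bar> * (\<integral>\<^sup>+x. f (Complex x (s / c * x + y / c)) \<partial>lborel) \<partial>lborel)"
  proof (rule nn_integral_cong)
    fix y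
    have e: "c * ((s / c * y) + (1/c) * x) - s * y = x"
      "c * y + s * ((s / c * y) + (1/c) * x) = s / c * x + y / c" for x
    proof -
      show "c * ((s / c * y) + (1/c) * x) - s * y = x" using assms by (simp add: field_simps)
      have "c * y + s * ((s / c * y) + (1/c) * x) = s / c * x + (c\<^sup>2 + s\<^sup>2) * y / c"
        using \<open>c \<noteq> 0\<close> by (simp add: field_simps power2_eq_square)
      then show "c * y + s * ((s / c * y) + (1/c) * x) = s / c * x + y / c" using assms by simp
    qed
    show "(\<integral>\<^sup>+x. f (Complex (c * x - s * y) (c * y + s * x)) \<partial>lborel)
        = ennreal \<bar>1/c\<bar> * (\<integral>\<^sup>+x. f (Complex x (s / c * x + y / c)) \<partial>lborel)"
      using assms by (subst nn_integral_real_affine[where c = "1/c" and t = "s / c * y"]) (simp_all only: e, auto)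
  qed
  also have "\<dots> = ennreal \<bar>1/c\<bar> * (\<integral>\<^sup>+y. \<integral>\<^sup>+x. f (Complex x (s / c * x + y / c)) \<partial>lborel \<partial>lborel)"
    by (rule nn_integral_cmult) measurable
  also have "\<dots> = ennreal \<bar>1/c\<bar> * (\<integral>\<^sup>+x. \<integral>\<^sup>+y. f (Complex x (s / c * x + y / c)) \<partial>lborel \<partial>lborel)"
    by (subst lborel_pair.Fubini') auto
  also have "(\<integral>\<^sup>+x. \<integral>\<^sup>+y. f (Complex x (s / c * x + y / c)) \<partial>lborel \<partial>lborel)
      = (\<integral>\<^sup>+x. ennreal \<bar>c\<bar> * (\<integral>\<^sup>+y. f (Complex x y) \<partial>lborel) \<partial>lborel)"
  proof (rule nn_integral_cong)
    fix x
    have e: "s / c * x + (- s * x + c * y) / c = y" for y using assms by (simp add: field_simps)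
    show "(\<integral>\<^sup>+y. f (Complex x (s / c * x + y / c)) \<partial>lborel) = ennreal \<bar>c\<bar> * (\<integral>\<^sup>+y. f (Complex x y) \<partial>lborel)"
      using assms by (subst nn_integral_real_affine[where c = "c" and t = "- s * x"]) (simp_all only: e, auto)
  qed
  also have "ennreal \<bar>1/c\<bar> * \<dots> = (\<integral>\<^sup>+x. \<integral>\<^sup>+y. f (Complex x y) \<partial>lborel \<partial>lborel)"
  proof (subst nn_integral_cmult)
    have "ennreal \<bar>1/c\<bar> * ennreal \<bar>c\<bar> = 1"
      using assms by (simp add: ennreal_mult[symmetric] abs_mult[symmetric] flip: ennreal_1)
    then show "ennreal \<bar>1/c\<bar> * (ennreal \<bar>c\<bar> * (\<integral>\<^sup>+x. \<integral>\<^sup>+y. f (Complex x y) \<partial>lborel \<partial>lborel)) = (\<integral>\<^sup>+x. \<integral>\<^sup>+y. f (Complex x y) \<partial>lborel \<partial>lborel)"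
      by (simp add: mult.assoc[symmetric])
  qed measurable
  also have "\<dots> = (\<integral>\<^sup>+z. f z \<partial>lborel)"
    by (rule nn_integral_lborel_Complex[symmetric]) measurable
  finally show ?thesis .
qed

text \<open>A rotation by a right angle is the quotient of two rotations to which the previous lemma applies.\<close>

lemma nn_integral_lborel_rotate:
  fixes f :: "complex \<Rightarrow> ennreal"
  assumes [measurable]: "f \<in> borel_measurable borel" and "cmod \<xi> = 1"
  shows "(\<integral>\<^sup>+z. f (\<xi> * z) \<partial>lborel) = (\<integral>\<^sup>+z. f z \<partial>lborel)"
proof -
  have *: "(\<integral>\<^sup>+z. f (\<eta> * z) \<partial>lborel) = (\<integral>\<^sup>+z. f z \<partial>lborel)"
    if "cmod \<eta> = 1" "Re \<eta> \<noteq> 0" and [measurable]: "f \<in> borel_measurable borel" for f :: "complex \<Rightarrow> ennreal" and \<eta>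
    using nn_integral_lborel_rotate_aux[of f "Re \<eta>" "Im \<eta>"] that
    by (simp add: cmod_def)
  have m: "(\<lambda>z. f (\<eta> * z)) \<in> borel_measurable borel" for \<eta> by measurable
  show ?thesis
  proof (cases "Re \<xi> = 0")
    case True
    define \<eta> where "\<eta> = cis (pi/4)"
    have \<eta>: "cmod \<eta> = 1" "Re \<eta> \<noteq> 0" by (auto simp: \<eta>_def cos_45)
    have "Im \<xi> \<noteq> 0"
      using True \<open>cmod \<xi> = 1\<close> by (auto simp: cmod_def)
    then have "Re (\<xi> * \<eta>) \<noteq> 0" "cmod (\<xi> * \<eta>) = 1"
      using True \<open>cmod \<xi> = 1\<close> by (auto simp: \<eta>_def sin_45 norm_mult)
    then have "(\<integral>\<^sup>+z. f ((\<xi> * \<eta>) * z) \<partial>lborel) = (\<integral>\<^sup>+z. f z \<partial>lborel)"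
      by (intro *) auto
    moreover have "(\<integral>\<^sup>+z. f (\<xi> * (\<eta> * z)) \<partial>lborel) = (\<integral>\<^sup>+z. f (\<xi> * z) \<partial>lborel)"
      using *[OF \<eta> m[of \<xi>]] .
    ultimately show ?thesis by (simp add: mult.assoc)
  qed (use * assms in auto)
qed

lemma distr_gauss_rotate:
  assumes "cmod \<xi> = 1"
  shows "distr gauss borel ((*) \<xi>) = gauss"
proof (rule measure_eqI)
  fix B assume "B \<in> sets (distr gauss borel ((*) \<xi>))"
  then have [measurable]: "B \<in> sets borel" by simp
  have [measurable]: "{x. \<xi> * x \<in> B} \<in> sets borel"
    by measurable
  have "emeasure (distr gauss borel ((*) \<xi>)) B
      = (\<integral>\<^sup>+z. ennreal (1 / pi * exp (- (cmod (\<xi> * z))\<^sup>2)) * indicator B (\<xi> * z) \<partial>lborel)"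
    using assms by (subst emeasure_distr) (auto simp: gauss_def emeasure_density norm_mult vimage_def
       intro!: nn_integral_cong split: split_indicator)
  also have "\<dots> = (\<integral>\<^sup>+z. ennreal (1 / pi * exp (- (cmod z)\<^sup>2)) * indicator B z \<partial>lborel)"
    using assms by (intro nn_integral_lborel_rotate[where f = "\<lambda>z. ennreal (1 / pi * exp (- (cmod z)\<^sup>2)) * indicator B z"]) auto
  also have "\<dots> = emeasure gauss B"
    by (simp add: gauss_def emeasure_density)
  finally show "emeasure (distr gauss borel ((*) \<xi>)) B = emeasure gauss B" .
qed simp

lemma integral_gauss_rotate:
  fixes f :: "complex \<Rightarrow> 'a :: {banach, second_countable_topology}"
  assumes "cmod \<xi> = 1" and [measurable]: "f \<in> borel_measurable borel"
  shows "(\<integral>z. f (\<xi> * z) \<partial>gauss) = (\<integral>z. f z \<partial>gauss)"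
proof -
  have "(\<integral>z. f (\<xi> * z) \<partial>gauss) = (\<integral>z. f z \<partial>distr gauss borel ((*) \<xi>))"
    by (subst integral_distr) auto
  then show ?thesis by (simp add: distr_gauss_rotate assms)
qed

lemma AE_gauss_rotate:
  assumes "cmod \<xi> = 1" "AE z in gauss. P z"
  shows "AE z in gauss. P (\<xi> * z)"
proof -
  have "AE z in distr gauss borel ((*) \<xi>). P z"
    using assms(2) by (simp only: distr_gauss_rotate[OF assms(1)])
  then show ?thesis by (rule AE_distrD[rotated]) measurable
qed

lemma AE_gauss_iff: "(AE z in gauss. P z) \<longleftrightarrow> (AE z in lborel. P z)"
  unfolding gauss_def by (subst AE_density) (auto simp: )

lemma AE_lebesgue_iff_gauss: "(AE z in lebesgue. P z) \<longleftrightarrow> (AE z in gauss. P z)"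
  by (simp add: AE_gauss_iff AE_completion_iff)

lemma nn_integral_gauss_radial:
  fixes h :: "real \<Rightarrow> real"
  assumes [measurable]: "h \<in> borel_measurable borel" and "\<And>t. h t \<ge> 0"
  shows "(\<integral>\<^sup>+z. ennreal (h ((cmod z)\<^sup>2)) \<partial>gauss) = (\<integral>\<^sup>+t. ennreal (indicator {0..} t * h t / exp t) \<partial>lborel)"
proof -
  have "(\<integral>\<^sup>+z. ennreal (h ((cmod z)\<^sup>2)) \<partial>gauss)
      = (\<integral>\<^sup>+z. ennreal (1 / pi * exp (- (cmod z)\<^sup>2) * h ((cmod z)\<^sup>2)) \<partial>lborel)"
    unfolding gauss_def using assms(2)
    by (subst nn_integral_density) (auto simp: ennreal_mult'[symmetric])
  also have "\<dots> = ennreal pi * (\<integral>\<^sup>+t. ennreal (1 / pi * exp (- t) * h t) * indicator {0..} t \<partial>lborel)"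
    by (rule nn_integral_norm_square[where h = "\<lambda>t. ennreal (1 / pi * exp (- t) * h t)"]) measurable
  also have "\<dots> = (\<integral>\<^sup>+t. ennreal (indicator {0..} t * h t / exp t) \<partial>lborel)"
    using assms(2) by (subst nn_integral_cmult[symmetric], measurable)
      (auto intro!: nn_integral_cong simp: exp_minus field_simps ennreal_mult[symmetric] split: split_indicator)
  finally show ?thesis .
qed

lemma norm_powr_double: "cmod z powr (2 * a) = ((cmod z)\<^sup>2) powr a"
  by (cases "z = 0") (auto simp: powr_powr simp flip: powr_numeral)

text \<open>Under \<open>t = |z|\<^sup>2\<close> this is Euler's integral for the Gamma function.\<close>

lemma has_bochner_integral_gauss_powr:
  assumes "a > -1"
  shows "has_bochner_integral gauss (\<lambda>z. cmod z powr (2 * a)) (Gamma (a + 1))"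
proof (rule has_bochner_integral_nn_integral)
  show "(\<integral>\<^sup>+z. ennreal (cmod z powr (2 * a)) \<partial>gauss) = ennreal (Gamma (a + 1))"
    using assms Gamma_conv_nn_integral_real[of "a + 1"]
    by (simp add: norm_powr_double nn_integral_gauss_radial[where h = "\<lambda>t. t powr a"])
qed (use assms in \<open>auto intro: less_imp_le Gamma_real_pos\<close>)

lemma integrable_gauss_powr_exp:
  assumes "a > -1" "c < 1"
  shows "integrable gauss (\<lambda>z. cmod z powr (2 * a) * exp (c * (cmod z)\<^sup>2))"
proof (rule integrableI_nonneg)
  define d where "d = 1 - c"
  have "d > 0" using assms by (simp add: d_def)
  have "(\<integral>\<^sup>+z. ennreal (cmod z powr (2 * a) * exp (c * (cmod z)\<^sup>2)) \<partial>gauss)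
      = (\<integral>\<^sup>+t. ennreal (indicator {0..} t * (t powr a * exp (c * t)) / exp t) \<partial>lborel)"
    by (simp add: norm_powr_double nn_integral_gauss_radial[where h = "\<lambda>t. t powr a * exp (c * t)"])
  also have "\<dots> = (\<integral>\<^sup>+t. ennreal (indicator {0..} t * (t powr a / exp (d * t))) \<partial>lborel)"
    by (auto intro!: nn_integral_cong simp: d_def algebra_simps exp_diff split: split_indicator)
  also have "\<dots> = ennreal (1 / d) * (\<integral>\<^sup>+t. ennreal (indicator {0..} (t / d) * ((t / d) powr a / exp t)) \<partial>lborel)"
    using \<open>d > 0\<close> by (subst nn_integral_real_affine[where c = "1/d" and t = 0]) auto
  also have "(\<integral>\<^sup>+t. ennreal (indicator {0..} (t / d) * ((t / d) powr a / exp t)) \<partial>lborel)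
      = (\<integral>\<^sup>+t. ennreal (d powr (-a)) * ennreal (indicator {0..} t * t powr ((a + 1) - 1) / exp t) \<partial>lborel)"
    using \<open>d > 0\<close>
    by (auto intro!: nn_integral_cong simp: powr_divide powr_minus field_simps ennreal_mult[symmetric] split: split_indicator)
  also have "\<dots> = ennreal (d powr (-a)) * ennreal (Gamma (a + 1))"
    using assms by (subst nn_integral_cmult, measurable) (simp add: Gamma_conv_nn_integral_real[of "a + 1"])
  also have "ennreal (1 / d) * \<dots> < \<infinity>"
    by (simp add: ennreal_mult_less_top)
  finally show "(\<integral>\<^sup>+z. ennreal (cmod z powr (2 * a) * exp (c * (cmod z)\<^sup>2)) \<partial>gauss) < \<infinity>" .
qed auto

section \<open>Polynomially bounded functions\<close>

text \<open>The bound holds at every point and its exponent is a natural number, which makes these functions an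
algebra. Every symbol agrees almost everywhere with such a function.\<close>

definition poly_bounded :: "(complex \<Rightarrow> complex) \<Rightarrow> bool" where
  "poly_bounded f \<longleftrightarrow> f \<in> borel_measurable borel \<and> (\<exists>C m. \<forall>z. cmod (f z) \<le> C * (1 + cmod z) ^ m)"

lemma poly_boundedI:
  "f \<in> borel_measurable borel \<Longrightarrow> (\<And>z. cmod (f z) \<le> C * (1 + cmod z) ^ m) \<Longrightarrow> poly_bounded f"
  unfolding poly_bounded_def by blast

lemma poly_boundedD:
  assumes "poly_bounded f"
  shows "\<exists>C m. C \<ge> 0 \<and> (\<forall>z. cmod (f z) \<le> C * (1 + cmod z) ^ m)"
proof -
  obtain C m where *: "\<And>z. cmod (f z) \<le> C * (1 + cmod z) ^ m"
    using assms unfolding poly_bounded_def by blast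
  have "0 \<le> C" using order_trans[OF norm_ge_zero *[of 0]] by simp
  then show ?thesis using * by blast
qed

lemma borel_measurable_cnj [measurable]:
  "f \<in> borel_measurable M \<Longrightarrow> (\<lambda>x. cnj (f x)) \<in> borel_measurable M"
  by (simp add: borel_measurable_complex_iff)

lemma poly_bounded_measurable [measurable_dest]: "poly_bounded f \<Longrightarrow> f \<in> borel_measurable borel"
  by (simp add: poly_bounded_def)

lemma poly_bounded_const [simp, intro]: "poly_bounded (\<lambda>z. c)"
  by (rule poly_boundedI[where C = "cmod c" and m = 0]) auto

lemma poly_bounded_id [simp, intro]: "poly_bounded (\<lambda>z. z)"
  by (rule poly_boundedI[where C = 1 and m = 1]) auto

lemma poly_bounded_mult [simp, intro]:
  assumes "poly_bounded f" "poly_bounded g"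
  shows "poly_bounded (\<lambda>z. f z * g z)"
proof -
  obtain C m where C: "C \<ge> 0" "\<And>z. cmod (f z) \<le> C * (1 + cmod z) ^ m"
    using poly_boundedD[OF assms(1)] by blast
  obtain D n where D: "D \<ge> 0" "\<And>z. cmod (g z) \<le> D * (1 + cmod z) ^ n"
    using poly_boundedD[OF assms(2)] by blast
  note * = C D
  show ?thesis
  proof (rule poly_boundedI)
    show "cmod (f z * g z) \<le> (C * D) * (1 + cmod z) ^ (m + n)" for z
      using mult_mono[OF *(2)[of z] *(4)[of z]] * by (simp add: norm_mult power_add mult_ac)
  qed (use assms in measurable)
qed

lemma poly_bounded_power [simp, intro]: "poly_bounded f \<Longrightarrow> poly_bounded (\<lambda>z. f z ^ n)"
  by (induction n) auto

lemma poly_bounded_add [simp, intro]: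
  assumes "poly_bounded f" "poly_bounded g"
  shows "poly_bounded (\<lambda>z. f z + g z)"
proof -
  obtain C m where C: "C \<ge> 0" "\<And>z. cmod (f z) \<le> C * (1 + cmod z) ^ m"
    using poly_boundedD[OF assms(1)] by blast
  obtain D n where D: "D \<ge> 0" "\<And>z. cmod (g z) \<le> D * (1 + cmod z) ^ n"
    using poly_boundedD[OF assms(2)] by blast
  note * = C D
  show ?thesis
  proof (rule poly_boundedI)
    show "cmod (f z + g z) \<le> (C + D) * (1 + cmod z) ^ (m + n)" for z
    proof -
      have "C * (1 + cmod z) ^ m \<le> C * (1 + cmod z) ^ (m + n)" "D * (1 + cmod z) ^ n \<le> D * (1 + cmod z) ^ (m + n)"
        using * by (auto intro!: mult_left_mono power_increasing)
      then show ?thesis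
        using *(2)[of z] *(4)[of z] norm_triangle_ineq[of "f z" "g z"] by (simp add: algebra_simps)
    qed
  qed (use assms in measurable)
qed

lemma poly_bounded_le:
  assumes "poly_bounded g" "f \<in> borel_measurable borel" "\<And>z. cmod (f z) \<le> cmod (g z)"
  shows "poly_bounded f"
proof -
  obtain C m where *: "C \<ge> 0" "\<And>z. cmod (g z) \<le> C * (1 + cmod z) ^ m"
    using poly_boundedD[OF assms(1)] by blast
  show ?thesis by (rule poly_boundedI[OF assms(2)]) (rule order_trans[OF assms(3) *(2)])
qed

lemma poly_bounded_cnj [simp, intro]: "poly_bounded f \<Longrightarrow> poly_bounded (\<lambda>z. cnj (f z))"
  by (rule poly_bounded_le[of f]) auto

lemma poly_bounded_diff [simp, intro]:
  assumes "poly_bounded f" "poly_bounded g"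
  shows "poly_bounded (\<lambda>z. f z - g z)"
  using poly_bounded_add[OF assms(1) poly_bounded_mult[OF poly_bounded_const[of "-1"] assms(2)]] by simp

lemma poly_bounded_rotate:
  assumes "poly_bounded f" "cmod \<xi> = 1"
  shows "poly_bounded (\<lambda>z. f (\<xi> * z))"
proof -
  obtain C m where *: "C \<ge> 0" "\<And>z. cmod (f z) \<le> C * (1 + cmod z) ^ m"
    using poly_boundedD[OF assms(1)] by blast
  have [measurable]: "f \<in> borel_measurable borel" using assms by measurable
  show ?thesis
    by (rule poly_boundedI[where C = C and m = m]) (use assms *(2)[of "\<xi> * _"] in \<open>auto simp: norm_mult\<close>)
qed

text \<open>A polynomial factor costs only a small change of the exponent \<open>c < 1\<close>, because
\<open>(1 + t)\<^sup>m \<le> exp(m t)\<close> and \<open>m t \<le> m\<^sup>2 / (4 d) + d t\<^sup>2\<close>.\<close>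

lemma integrable_gauss_poly_bounded:
  fixes g :: "complex \<Rightarrow> 'a :: {banach, second_countable_topology}"
  assumes "poly_bounded f" "a > -1" "c < 1" and [measurable]: "g \<in> borel_measurable borel"
    and le: "\<And>z. norm (g z) \<le> cmod (f z) * (cmod z powr (2 * a) * exp (c * (cmod z)\<^sup>2))"
  shows "integrable gauss g"
proof -
  obtain C m where *: "C \<ge> 0" "\<And>z. cmod (f z) \<le> C * (1 + cmod z) ^ m"
    using poly_boundedD[OF assms(1)] by blast
  \<comment> \<open>Half of the room left by \<open>c < 1\<close>.\<close>
  define d where "d = (1 - c) / 2"
  have "d > 0" "c + d < 1" using assms by (auto simp: d_def field_simps)
  define K where "K = C * exp ((real m)\<^sup>2 / (4 * d))"
  have K: "C * (1 + t) ^ m \<le> K * exp (d * t\<^sup>2)" if "t \<ge> 0" for t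
  proof -
    have "(1 + t) ^ m \<le> exp t ^ m"
      using that exp_ge_add_one_self[of t] by (intro power_mono) auto
    also have "\<dots> = exp (real m * t)" by (simp add: exp_of_nat_mult)
    also have "real m * t \<le> (real m)\<^sup>2 / (4 * d) + d * t\<^sup>2"
    proof -
      have "0 \<le> (real m - 2 * d * t)\<^sup>2 / (4 * d)" using \<open>d > 0\<close> by simp
      also have "\<dots> = (real m)\<^sup>2 / (4 * d) + d * t\<^sup>2 - real m * t"
        using \<open>d > 0\<close> by (simp add: power2_eq_square field_simps)
      finally show ?thesis by simp
    qed
    finally have "(1 + t) ^ m \<le> exp ((real m)\<^sup>2 / (4 * d)) * exp (d * t\<^sup>2)" by (simp add: exp_add)
    then show ?thesis using * by (simp add: K_def mult.assoc mult_left_mono)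
  qed
  have "integrable gauss (\<lambda>z. K * (cmod z powr (2 * a) * exp ((c + d) * (cmod z)\<^sup>2)))"
    using assms \<open>c + d < 1\<close> by (intro integrable_mult_right integrable_gauss_powr_exp) auto
  then show ?thesis
  proof (rule Bochner_Integration.integrable_bound)
    show "AE z in gauss. norm (g z) \<le> norm (K * (cmod z powr (2 * a) * exp ((c + d) * (cmod z)\<^sup>2)))"
    proof (rule AE_I2)
      fix z
      have "norm (g z) \<le> cmod (f z) * (cmod z powr (2 * a) * exp (c * (cmod z)\<^sup>2))" by (rule le)
      also have "\<dots> \<le> (K * exp (d * (cmod z)\<^sup>2)) * (cmod z powr (2 * a) * exp (c * (cmod z)\<^sup>2))"
        using *(2)[of z] K[of "cmod z"] by (intro mult_right_mono) auto
      also have "\<dots> = K * (cmod z powr (2 * a) * exp ((c + d) * (cmod z)\<^sup>2))"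
        by (simp add: exp_add algebra_simps)
      finally show "norm (g z) \<le> norm (K * (cmod z powr (2 * a) * exp ((c + d) * (cmod z)\<^sup>2)))"
        by simp
    qed
  qed auto
qed

lemma integrable_gauss_poly_bounded_powr:
  assumes "poly_bounded f" "a > -1"
  shows "integrable gauss (\<lambda>z. f z * of_real (cmod z powr (2 * a)))"
proof -
  have [measurable]: "f \<in> borel_measurable borel" using assms by measurable
  show ?thesis by (rule integrable_gauss_poly_bounded[OF assms, of 0]) (auto simp: norm_mult)
qed

lemma poly_bounded_integrable_gauss:
  assumes "poly_bounded f"
  shows "integrable gauss f"
proof (rule integrable_cong_AE_imp)
  show "integrable gauss (\<lambda>z. f z * of_real (cmod z powr (2 * 0)))"
    using integrable_gauss_poly_bounded_powr[OF assms, of 0] by simp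
  have "AE z in gauss. z \<noteq> 0"
    unfolding AE_gauss_iff by (rule AE_lborel_singleton)
  then show "AE z in gauss. f z * of_real (cmod z powr (2 * 0)) = f z"
    by eventually_elim simp
qed (use assms in measurable)

section \<open>Integrals of exponentials\<close>

text \<open>The exponential is expanded under the integral; the partial sums of its series are dominated by \<open>exp(r |L|)\<close>.\<close>

lemma sums_integral_exp:
  fixes F :: "'a \<Rightarrow> complex" and L :: "'a \<Rightarrow> real"
  assumes [measurable]: "F \<in> borel_measurable M" "L \<in> borel_measurable M"
    and int: "integrable M (\<lambda>x. F x * exp (of_real (r * \<bar>L x\<bar>)))"
    and h: "cmod h \<le> r"
  shows "r > 0 \<Longrightarrow> integrable M (\<lambda>x. F x * of_real (L x) ^ n)"
    and "(\<lambda>n. h ^ n / fact n * (\<integral>x. F x * of_real (L x) ^ n \<partial>M)) sums (\<integral>x. F x * exp (h * of_real (L x)) \<partial>M)"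
    and "integrable M (\<lambda>x. F x * exp (h * of_real (L x)))"
proof -
  have "r \<ge> 0" using h norm_ge_zero[of h] by linarith
  have bnd: "(r * \<bar>L x\<bar>) ^ n / fact n \<le> exp (r * \<bar>L x\<bar>)" for x n
  proof -
    have "(r * \<bar>L x\<bar>) ^ n / fact n = (\<Sum>k\<in>{n}. (r * \<bar>L x\<bar>) ^ k /\<^sub>R fact k)"
      by (simp add: scaleR_conv_of_real field_simps)
    also have "\<dots> \<le> exp (r * \<bar>L x\<bar>)"
      using \<open>r \<ge> 0\<close> unfolding exp_def
      by (intro sum_le_suminf summable_exp_generic) auto
    finally show ?thesis .
  qed
  have nexp: "cmod (exp (of_real (r * \<bar>L x\<bar>))) = exp (r * \<bar>L x\<bar>)" for x
    by (simp add: norm_exp_eq_Re)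
  have power_int: "integrable M (\<lambda>x. of_real (r ^ n / fact n) * (F x * of_real (L x) ^ n))" for n
  proof (rule Bochner_Integration.integrable_bound[OF int])
    show "AE x in M. norm (of_real (r ^ n / fact n) * (F x * of_real (L x) ^ n)) \<le> norm (F x * exp (of_real (r * \<bar>L x\<bar>)))"
    proof (rule AE_I2)
      fix x
      have "norm (of_real (r ^ n / fact n) * (F x * of_real (L x) ^ n)) = cmod (F x) * ((r * \<bar>L x\<bar>) ^ n / fact n)"
        using \<open>r \<ge> 0\<close> by (simp add: norm_mult norm_divide norm_power power_mult_distrib)
      also have "\<dots> \<le> cmod (F x) * exp (r * \<bar>L x\<bar>)"
        by (intro mult_left_mono bnd) auto
      finally show "norm (of_real (r ^ n / fact n) * (F x * of_real (L x) ^ n)) \<le> norm (F x * exp (of_real (r * \<bar>L x\<bar>)))"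
        by (simp add: norm_mult nexp)
    qed
  qed measurable
  show int_power: "integrable M (\<lambda>x. F x * of_real (L x) ^ n)" if "r > 0" for n
  proof -
    have "of_real (fact n / r ^ n) * (of_real (r ^ n / fact n) * (F x * of_real (L x) ^ n)) = F x * of_real (L x) ^ n" for x
      using that by simp
    then show ?thesis
      using integrable_mult_right[OF power_int[of n], of "of_real (fact n / r ^ n)"] by (simp only:)
  qed
  have le: "norm (F x * (\<Sum>k<n. h ^ k / fact k * of_real (L x) ^ k)) \<le> norm (F x * exp (of_real (r * \<bar>L x\<bar>)))" for n x
  proof -
    have "cmod (\<Sum>k<n. h ^ k / fact k * of_real (L x) ^ k) \<le> (\<Sum>k<n. (cmod h * \<bar>L x\<bar>) ^ k / fact k)"
      by (rule order_trans[OF norm_sum]) (simp add: norm_mult norm_divide norm_power power_mult_distrib)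
    also have "\<dots> \<le> (\<Sum>k<n. (r * \<bar>L x\<bar>) ^ k /\<^sub>R fact k)"
      using h by (auto intro!: sum_mono power_mono mult_right_mono simp: scaleR_conv_of_real field_simps)
    also have "\<dots> \<le> exp (r * \<bar>L x\<bar>)"
      using \<open>r \<ge> 0\<close> unfolding exp_def
      by (intro sum_le_suminf summable_exp_generic) auto
    finally show ?thesis by (simp add: norm_mult nexp mult_left_mono)
  qed
  have lim: "(\<lambda>n. F x * (\<Sum>k<n. h ^ k / fact k * of_real (L x) ^ k)) \<longlonglongrightarrow> F x * exp (h * of_real (L x))" for x
    using exp_converges[of "h * of_real (L x)"]
    by (intro tendsto_mult tendsto_const) (simp add: sums_def scaleR_conv_of_real power_mult_distrib field_simps)
  have le_exp: "norm (F x * exp (h * of_real (L x))) \<le> norm (F x * exp (of_real (r * \<bar>L x\<bar>)))" for x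
    by (rule tendsto_upperbound[OF tendsto_norm[OF lim[of x]]]) (use le in auto)
  show "integrable M (\<lambda>x. F x * exp (h * of_real (L x)))"
    by (rule Bochner_Integration.integrable_bound[OF int]) (measurable, rule AE_I2, rule le_exp)
  have "(\<lambda>n. \<integral>x. F x * (\<Sum>k<n. h ^ k / fact k * of_real (L x) ^ k) \<partial>M) \<longlonglongrightarrow> (\<integral>x. F x * exp (h * of_real (L x)) \<partial>M)"
  proof (rule integral_dominated_convergence[where w = "\<lambda>x. norm (F x * exp (of_real (r * \<bar>L x\<bar>)))"])
    show "integrable M (\<lambda>x. norm (F x * exp (of_real (r * \<bar>L x\<bar>))))"
      using int by (rule integrable_norm)
  qed (use lim le in auto)
  moreover have "(\<integral>x. F x * (\<Sum>k<n. h ^ k / fact k * of_real (L x) ^ k) \<partial>M)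
      = (\<Sum>k<n. h ^ k / fact k * (\<integral>x. F x * of_real (L x) ^ k \<partial>M))" for n
  proof -
    have int': "integrable M (\<lambda>x. h ^ k / fact k * (F x * of_real (L x) ^ k))" for k
    proof (cases "r = 0")
      case True
      then have "h = 0" using h by simp
      show ?thesis
      proof (cases "k = 0")
        case True
        then show ?thesis using int \<open>r = 0\<close> by simp
      next
        case False
        then show ?thesis by (simp add: \<open>h = 0\<close> zero_power)
      qed
    next
      case False
      then have "integrable M (\<lambda>x. F x * of_real (L x) ^ k)"
        using int_power[of k] \<open>r \<ge> 0\<close> by simp
      then show ?thesis by (rule integrable_mult_right)
    qed
    have "(\<integral>x. F x * (\<Sum>k<n. h ^ k / fact k * of_real (L x) ^ k) \<partial>M)
      = (\<integral>x. (\<Sum>k<n. h ^ k / fact k * (F x * of_real (L x) ^ k)) \<partial>M)"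
      by (simp add: sum_distrib_left mult_ac)
    also have "\<dots> = (\<Sum>k<n. h ^ k / fact k * (\<integral>x. F x * of_real (L x) ^ k \<partial>M))"
      by (subst Bochner_Integration.integral_sum[OF int']) simp
    finally show ?thesis .
  qed
  ultimately show "(\<lambda>n. h ^ n / fact n * (\<integral>x. F x * of_real (L x) ^ n \<partial>M)) sums (\<integral>x. F x * exp (h * of_real (L x)) \<partial>M)"
    by (simp add: sums_def)
qed

text \<open>Convexity in the exponent: \<open>exp(r |L|) \<le> exp(r L) + exp(-r L)\<close>.\<close>

lemma integrable_exp_between:
  fixes F :: "'a \<Rightarrow> complex" and L :: "'a \<Rightarrow> real"
  assumes [measurable]: "F \<in> borel_measurable M" "L \<in> borel_measurable M"
    and int: "\<And>t. \<alpha> < t \<Longrightarrow> t < \<beta> \<Longrightarrow> integrable M (\<lambda>x. F x * exp (of_real (t * L x)))"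
    and "\<alpha> < Re h0 - r" "Re h0 + r < \<beta>" "r \<ge> 0"
  shows "integrable M (\<lambda>x. F x * exp (h0 * of_real (L x)) * exp (of_real (r * \<bar>L x\<bar>)))"
proof -
  have "integrable M (\<lambda>x. norm (F x * exp (of_real ((Re h0 - r) * L x))) + norm (F x * exp (of_real ((Re h0 + r) * L x))))"
    using assms by (intro Bochner_Integration.integrable_add integrable_norm int) auto
  then show ?thesis
  proof (rule Bochner_Integration.integrable_bound)
    show "AE x in M. norm (F x * exp (h0 * of_real (L x)) * exp (of_real (r * \<bar>L x\<bar>)))
      \<le> norm (norm (F x * exp (of_real ((Re h0 - r) * L x))) + norm (F x * exp (of_real ((Re h0 + r) * L x))))"
    proof (rule AE_I2)
      fix x
      have "exp (Re h0 * L x + r * \<bar>L x\<bar>) \<le> exp ((Re h0 - r) * L x) + exp ((Re h0 + r) * L x)"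
        by (cases "L x \<ge> 0") (auto simp: algebra_simps add_increasing add_increasing2)
      then have "cmod (F x) * exp (Re h0 * L x + r * \<bar>L x\<bar>) \<le> cmod (F x) * (exp ((Re h0 - r) * L x) + exp ((Re h0 + r) * L x))"
        by (intro mult_left_mono) auto
      then show "norm (F x * exp (h0 * of_real (L x)) * exp (of_real (r * \<bar>L x\<bar>)))
        \<le> norm (norm (F x * exp (of_real ((Re h0 - r) * L x))) + norm (F x * exp (of_real ((Re h0 + r) * L x))))"
        by (simp add: norm_mult norm_exp_eq_Re exp_add distrib_left mult.assoc)
    qed
  qed measurable
qed

lemma holomorphic_integral_exp:
  fixes F :: "'a \<Rightarrow> complex" and L :: "'a \<Rightarrow> real"
  assumes [measurable]: "F \<in> borel_measurable M" "L \<in> borel_measurable M"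
    and int: "\<And>t. \<alpha> < t \<Longrightarrow> t < \<beta> \<Longrightarrow> integrable M (\<lambda>x. F x * exp (of_real (t * L x)))"
  shows "(\<lambda>h. \<integral>x. F x * exp (h * of_real (L x)) \<partial>M) holomorphic_on {h. \<alpha> < Re h \<and> Re h < \<beta>}"
    (is "?f holomorphic_on ?S")
proof -
  have "?S = {h. \<alpha> < Re h} \<inter> {h. Re h < \<beta>}" by auto
  then have op: "open ?S"
    by (simp add: open_halfspace_Re_gt open_halfspace_Re_lt open_Int)
  show ?thesis
    unfolding holomorphic_on_open[OF op]
  proof
    fix h0 assume h0: "h0 \<in> ?S"
    define r where "r = min (Re h0 - \<alpha>) (\<beta> - Re h0) / 2"
    have r: "r > 0" "\<alpha> < Re h0 - r" "Re h0 + r < \<beta>"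
      using h0 by (auto simp: r_def min_def field_simps)
    have int': "integrable M (\<lambda>x. F x * exp (h0 * of_real (L x)) * exp (of_real (r * \<bar>L x\<bar>)))"
      using r by (intro integrable_exp_between[OF assms(1,2) int]) auto
    have "(\<lambda>n. (1 / fact n * (\<integral>x. F x * exp (h0 * of_real (L x)) * of_real (L x) ^ n \<partial>M)) * (h - h0) ^ n) sums ?f h"
      if "h \<in> ball h0 r" for h
    proof -
      have "(\<lambda>n. (h - h0) ^ n / fact n * (\<integral>x. F x * exp (h0 * of_real (L x)) * of_real (L x) ^ n \<partial>M))
          sums (\<integral>x. F x * exp (h0 * of_real (L x)) * exp ((h - h0) * of_real (L x)) \<partial>M)"
        using that by (intro sums_integral_exp(2)[OF _ _ int']) (auto simp: dist_norm norm_minus_commute)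
      moreover have "exp (h0 * of_real (L x)) * exp ((h - h0) * of_real (L x)) = exp (h * of_real (L x))" for x
        by (simp add: exp_add[symmetric] algebra_simps)
      ultimately show ?thesis by (simp add: mult.assoc mult_ac)
    qed
    then have "?f holomorphic_on ball h0 r"
      by (rule power_series_holomorphic)
    then show "\<exists>f'. (?f has_field_derivative f') (at h0)"
      using r by (auto simp: holomorphic_on_open)
  qed
qed

text \<open>If all moments of \<open>L\<close> against \<open>F\<close> vanish, the exponential transform vanishes near 0 by its power
series and on the whole strip by the identity theorem. The strip may reach far beyond the disc of
convergence; this is what makes Gaussians of every width accessible below.\<close>

lemma integral_exp_eq_0:
  fixes F :: "'a \<Rightarrow> complex" and L :: "'a \<Rightarrow> real"
  assumes [measurable]: "F \<in> borel_measurable M" "L \<in> borel_measurable M"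
    and int: "\<And>t. \<alpha> < t \<Longrightarrow> t < \<beta> \<Longrightarrow> integrable M (\<lambda>x. F x * exp (of_real (t * L x)))"
    and "\<alpha> < 0" "0 < \<beta>"
    and zero: "\<And>n. (\<integral>x. F x * of_real (L x) ^ n \<partial>M) = 0"
    and h: "\<alpha> < Re h" "Re h < \<beta>"
  shows "(\<integral>x. F x * exp (h * of_real (L x)) \<partial>M) = 0"
proof -
  define r where "r = min (- \<alpha>) \<beta> / 2"
  have r: "r > 0" "\<alpha> < 0 - r" "0 + r < \<beta>"
    using assms by (auto simp: r_def min_def field_simps)
  have int': "integrable M (\<lambda>x. F x * exp (of_real (r * \<bar>L x\<bar>)))"
    using integrable_exp_between[OF assms(1,2) int, where ?h0.0 = 0 and r = r] r by simp
  have small: "(\<integral>x. F x * exp (h * of_real (L x)) \<partial>M) = 0" if "h \<in> ball 0 r" for h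
  proof -
    have "(\<lambda>n. h ^ n / fact n * (\<integral>x. F x * of_real (L x) ^ n \<partial>M))
        sums (\<integral>x. F x * exp (h * of_real (L x)) \<partial>M)"
      using that by (intro sums_integral_exp(2)[OF _ _ int']) auto
    then show ?thesis by (simp add: zero sums_iff)
  qed
  let ?S = "{h. \<alpha> < Re h \<and> Re h < \<beta>}"
  have S: "?S = {h. \<alpha> < Re h} \<inter> {h. Re h < \<beta>}" by auto
  have "\<bar>Re z\<bar> < r" if "cmod z < r" for z using that abs_Re_le_cmod[of z] by linarith
  then have sub: "ball 0 r \<subseteq> ?S" using r by (fastforce simp: abs_less_iff)
  have op: "open ?S" and conn: "connected ?S"
    unfolding S by (intro open_Int open_halfspace_Re_gt open_halfspace_Re_lt
        convex_connected convex_Int convex_halfspace_Re_gt convex_halfspace_Re_lt)+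
  have ne: "ball (0::complex) r \<noteq> {}" and mem: "h \<in> ?S" using r h by auto
  have hol: "(\<lambda>h. \<integral>x. F x * exp (h * of_real (L x)) \<partial>M) holomorphic_on ?S"
    by (rule holomorphic_integral_exp[OF assms(1,2) int])
  show ?thesis
    by (rule analytic_continuation_open[OF open_ball op ne conn sub hol holomorphic_on_const small mem])
qed

section \<open>Determination of a function by its Gaussian moments\<close>

lemma emeasure_gauss_UNIV: "emeasure gauss UNIV = 1"
proof -
  have "emeasure gauss (space gauss) = (\<integral>\<^sup>+z. ennreal ((\<lambda>_::real. 1) ((cmod z)\<^sup>2)) \<partial>gauss)"
    by simp
  also have "\<dots> = (\<integral>\<^sup>+t. ennreal (indicator {0..} t * 1 / exp t) \<partial>lborel)"
    by (rule nn_integral_gauss_radial) auto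
  also have "\<dots> = (\<integral>\<^sup>+t. ennreal (indicator {0..} t * t powr (1 - 1) / exp t) \<partial>lborel)"
  proof (rule nn_integral_cong_AE)
    have "AE t in lborel. t \<noteq> (0::real)" by (rule AE_lborel_singleton)
    then show "AE t in lborel. ennreal (indicator {0..} t * 1 / exp t) = ennreal (indicator {0..} t * t powr (1 - 1) / exp t)"
      by eventually_elim (auto split: split_indicator)
  qed
  also have "\<dots> = 1"
    using Gamma_conv_nn_integral_real[of 1] by simp
  finally show "emeasure gauss UNIV = 1" by simp
qed

interpretation gauss: finite_measure gauss
  by standard (simp add: emeasure_gauss_UNIV)

lemma measure_gauss_UNIV: "measure gauss UNIV = 1"
  by (simp add: measure_def emeasure_gauss_UNIV)

lemma integrable_gauss_poly_bounded_exp: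
  fixes g :: "complex \<Rightarrow> 'a :: {banach, second_countable_topology}"
  assumes f: "poly_bounded f" and "c < 1" and [measurable]: "g \<in> borel_measurable borel"
    and le: "\<And>z. norm (g z) \<le> cmod (f z) * exp (c * (cmod z)\<^sup>2)"
  shows "integrable gauss g"
proof (rule integrable_cong_AE_imp)
  show "integrable gauss (\<lambda>z. if z = 0 then 0 else g z)"
    by (rule integrable_gauss_poly_bounded[OF f _ \<open>c < 1\<close>, of 0]) (use le in auto)
  have "AE z in gauss. z \<noteq> 0"
    unfolding AE_gauss_iff by (rule AE_lborel_singleton)
  then show "AE z in gauss. (if z = 0 then 0 else g z) = g z"
    by eventually_elim simp
qed measurable

lemma exp_norm_square_diff:
  "- (cmod (x - z))\<^sup>2 = - (cmod x)\<^sup>2 + (2 * Re (z * cnj x) - (cmod z)\<^sup>2)"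
  by (simp only: cmod_power2) (simp add: power2_eq_square algebra_simps)

text \<open>Take \<open>L = 2 Re(z (cnj x)) - |z|\<^sup>2\<close>, a polynomial in \<open>z\<close> and its conjugate. Then \<open>exp(c L)\<close> is a constant
multiple of \<open>exp(-c |x - z|\<^sup>2)\<close>, and it is integrable against the Gaussian for all \<open>c > -1\<close>.\<close>

lemma gauss_moments_zero_imp_translate_zero:
  assumes H: "poly_bounded H"
    and zero: "\<And>a b. (\<integral>z. H z * z ^ a * cnj z ^ b \<partial>gauss) = 0"
    and "c > 0"
  shows "integrable gauss (\<lambda>z. H z * of_real (exp (- c * (cmod (x - z))\<^sup>2)))"
    and "(\<integral>z. H z * of_real (exp (- c * (cmod (x - z))\<^sup>2)) \<partial>gauss) = 0"
proof -
  have [measurable]: "H \<in> borel_measurable borel" using H by measurable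
  define L where "L z = 2 * Re (z * cnj x) - (cmod z)\<^sup>2" for z
  have [measurable]: "L \<in> borel_measurable borel"
    unfolding L_def by measurable
  have L: "of_real (L z) = cnj x * z + x * cnj z - z * cnj z" for z
    by (simp add: L_def complex_eq_iff cmod_power2) (simp add: power2_eq_square algebra_simps)
  have pb: "poly_bounded (\<lambda>z. H z * of_real (L z) ^ n * z ^ a * cnj z ^ b)" for n a b
    unfolding L using H by (intro poly_bounded_mult poly_bounded_power poly_bounded_diff poly_bounded_add) auto
  have moments: "(\<integral>z. H z * of_real (L z) ^ n * z ^ a * cnj z ^ b \<partial>gauss) = 0" for n a b
  proof (induction n arbitrary: a b)
    case 0
    then show ?case using zero by simp
  next
    case (Suc n)
    have "(\<integral>z. H z * of_real (L z) ^ Suc n * z ^ a * cnj z ^ b \<partial>gauss)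
      = (\<integral>z. cnj x * (H z * of_real (L z) ^ n * z ^ Suc a * cnj z ^ b)
          + x * (H z * of_real (L z) ^ n * z ^ a * cnj z ^ Suc b)
          - H z * of_real (L z) ^ n * z ^ Suc a * cnj z ^ Suc b \<partial>gauss)"
      by (intro Bochner_Integration.integral_cong refl, simp only: L power_Suc) (simp add: algebra_simps)
    also have "\<dots> = cnj x * 0 + x * 0 - 0"
      by (simp only: Bochner_Integration.integral_diff Bochner_Integration.integral_add integral_mult_right_zero
         Bochner_Integration.integrable_diff Bochner_Integration.integrable_add integrable_mult_right
         poly_bounded_integrable_gauss[OF pb] Suc.IH)
    finally show ?case by simp
  qed
  have int: "integrable gauss (\<lambda>z. H z * exp (of_real (t * L z)))" if "t > -1" for t
  proof -
    \<comment> \<open>Half of the room left by \<open>t > -1\<close>, so that \<open>e - t < 1\<close>.\<close>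
    define e where "e = (t + 1) / 2"
    have e: "e > 0" "e - t < 1" using that by (auto simp: e_def field_simps)
    have le: "t * L z \<le> (t * cmod x)\<^sup>2 / e + (e - t) * (cmod z)\<^sup>2" for z
    proof -
      have "t * (2 * Re (z * cnj x)) \<le> \<bar>t\<bar> * (2 * (cmod z * cmod x))"
      proof -
        have "\<bar>Re (z * cnj x)\<bar> \<le> cmod z * cmod x"
          using abs_Re_le_cmod[of "z * cnj x"] by (simp add: norm_mult)
        then have "\<bar>t\<bar> * (2 * \<bar>Re (z * cnj x)\<bar>) \<le> \<bar>t\<bar> * (2 * (cmod z * cmod x))"
          by (intro mult_left_mono) auto
        moreover have "t * (2 * Re (z * cnj x)) \<le> \<bar>t\<bar> * (2 * \<bar>Re (z * cnj x)\<bar>)"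
          using abs_ge_self[of "t * (2 * Re (z * cnj x))"] by (simp only: abs_mult abs_numeral)
        ultimately show ?thesis by linarith
      qed
      also have "\<dots> \<le> (t * cmod x)\<^sup>2 / e + e * (cmod z)\<^sup>2"
      proof -
        have "0 \<le> (\<bar>t\<bar> * cmod x - e * cmod z)\<^sup>2 / e" using e by simp
        also have "\<dots> = (t * cmod x)\<^sup>2 / e + e * (cmod z)\<^sup>2 - \<bar>t\<bar> * (2 * (cmod z * cmod x))"
          using e by (simp add: power2_diff power_mult_distrib diff_divide_distrib add_divide_distrib)
             (simp add: power2_eq_square)
        finally show ?thesis by simp
      qed
      finally show ?thesis by (simp add: L_def algebra_simps)
    qed
    show ?thesis
    proof (rule integrable_gauss_poly_bounded_exp)
      show "poly_bounded (\<lambda>z. H z * of_real (exp ((t * cmod x)\<^sup>2 / e)))" using H by auto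
      show "norm (H z * exp (of_real (t * L z))) \<le> cmod (H z * of_real (exp ((t * cmod x)\<^sup>2 / e))) * exp ((e - t) * (cmod z)\<^sup>2)" for z
        using le[of z] by (simp add: norm_mult norm_exp_eq_Re mult.assoc exp_add[symmetric] mult_left_mono del: of_real_mult)
    qed (use e in measurable)
  qed
  have eq: "H z * of_real (exp (- c * (cmod (x - z))\<^sup>2)) = of_real (exp (- c * (cmod x)\<^sup>2)) * (H z * exp (of_real c * of_real (L z)))" for z
  proof -
    have "- c * (cmod (x - z))\<^sup>2 = - c * (cmod x)\<^sup>2 + c * L z"
      using exp_norm_square_diff[of x z] unfolding L_def by (metis (no_types, opaque_lifting) mult_minus_left mult_minus_right distrib_left)
    then have "exp (- c * (cmod (x - z))\<^sup>2) = exp (- c * (cmod x)\<^sup>2) * exp (c * L z)"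
      by (simp only: exp_add)
    then show ?thesis by (simp add: exp_of_real[symmetric] mult_ac)
  qed
  show "integrable gauss (\<lambda>z. H z * of_real (exp (- c * (cmod (x - z))\<^sup>2)))"
    unfolding eq using int[of c] \<open>c > 0\<close> by (intro integrable_mult_right) simp
  have "(\<integral>z. H z * exp (of_real c * of_real (L z)) \<partial>gauss) = 0"
  proof (rule integral_exp_eq_0[where \<alpha> = "-1" and \<beta> = "c + 1"])
    show "(\<integral>z. H z * of_real (L z) ^ n \<partial>gauss) = 0" for n
      using moments[of n 0 0] by simp
  qed (use int \<open>c > 0\<close> in auto)
  then show "(\<integral>z. H z * of_real (exp (- c * (cmod (x - z))\<^sup>2)) \<partial>gauss) = 0"
    unfolding eq by simp
qed

lemma nn_integral_lborel_scale_complex: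
  fixes f :: "complex \<Rightarrow> ennreal"
  assumes [measurable]: "f \<in> borel_measurable borel" and "c > 0"
  shows "(\<integral>\<^sup>+x. f x \<partial>lborel) = ennreal (c\<^sup>2) * (\<integral>\<^sup>+y. f (z + c *\<^sub>R y) \<partial>lborel)"
  using \<open>c > 0\<close>
  by (subst lborel_affine[of c z]) (auto simp: nn_integral_density nn_integral_distr nn_integral_cmult power2_eq_square)

lemma integral_lborel_scale_complex:
  fixes f :: "complex \<Rightarrow> complex"
  assumes [measurable]: "f \<in> borel_measurable borel" and "c > 0"
  shows "(\<integral>x. f x \<partial>lborel) = (\<integral>y. (c\<^sup>2) *\<^sub>R f (z + c *\<^sub>R y) \<partial>lborel)"
  using \<open>c > 0\<close>
  by (subst lborel_affine[of c z]) (auto simp: integral_density integral_distr power2_eq_square)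

text \<open>Averages over small Gaussian displacements are convolutions with a narrow Gaussian.\<close>

lemma gauss_average_eq:
  fixes g :: "complex \<Rightarrow> complex"
  assumes [measurable]: "g \<in> borel_measurable borel" and "c > 0"
  shows "(\<integral>y. g (z + c *\<^sub>R y) \<partial>gauss)
    = of_real (1 / (pi * c\<^sup>2)) * (\<integral>x. g x * of_real (exp (- (1 / c\<^sup>2) * (cmod (x - z))\<^sup>2)) \<partial>lborel)"
proof -
  have "(\<integral>x. g x * of_real (exp (- (1 / c\<^sup>2) * (cmod (x - z))\<^sup>2)) \<partial>lborel)
    = (\<integral>y. (c\<^sup>2) *\<^sub>R (g (z + c *\<^sub>R y) * of_real (exp (- (cmod y)\<^sup>2))) \<partial>lborel)"
    using \<open>c > 0\<close> by (subst integral_lborel_scale_complex[where c = c and z = z]) (auto simp: power_mult_distrib)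
  also have "\<dots> = (\<integral>y. of_real (pi * c\<^sup>2) * ((1 / pi * exp (- (cmod y)\<^sup>2)) *\<^sub>R g (z + c *\<^sub>R y)) \<partial>lborel)"
    by (intro Bochner_Integration.integral_cong refl) (simp add: scaleR_conv_of_real)
  also have "\<dots> = of_real (pi * c\<^sup>2) * (\<integral>y. g (z + c *\<^sub>R y) \<partial>gauss)"
    unfolding integral_mult_right_zero gauss_def by (subst integral_density) auto
  finally show ?thesis using \<open>c > 0\<close> by simp
qed

lemma nn_integral_exp_lborel:
  assumes "c > 0"
  shows "(\<integral>\<^sup>+x. ennreal (exp (- (1 / c\<^sup>2) * (cmod (x - z))\<^sup>2)) \<partial>lborel) = ennreal (pi * c\<^sup>2)"
proof -
  have "(\<integral>\<^sup>+x. ennreal (exp (- (1 / c\<^sup>2) * (cmod (x - z))\<^sup>2)) \<partial>lborel)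
      = ennreal (c\<^sup>2) * (\<integral>\<^sup>+y. ennreal pi * ennreal (1 / pi * exp (- (cmod y)\<^sup>2)) \<partial>lborel)"
    using assms by (subst nn_integral_lborel_scale_complex[where c = c and z = z])
      (auto simp: power_mult_distrib ennreal_mult[symmetric])
  also have "(\<integral>\<^sup>+y. ennreal pi * ennreal (1 / pi * exp (- (cmod y)\<^sup>2)) \<partial>lborel) = ennreal pi * emeasure gauss UNIV"
    by (subst nn_integral_cmult) (auto simp: gauss_def emeasure_density)
  finally show ?thesis
    by (simp add: emeasure_gauss_UNIV ennreal_mult[symmetric] mult.commute)
qed

text \<open>Convolutions of \<open>g\<close> with narrow Gaussians are orthogonal to \<open>H\<close> by Fubini's theorem and the previous
lemmas, and they converge to \<open>g\<close> boundedly.\<close>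

lemma gauss_moments_zero_imp_continuous_zero:
  assumes H: "poly_bounded H"
    and zero: "\<And>a b. (\<integral>z. H z * z ^ a * cnj z ^ b \<partial>gauss) = 0"
    and g: "continuous_on UNIV g" "\<And>z. cmod (g z) \<le> 1"
  shows "(\<integral>z. H z * g z \<partial>gauss) = 0"
proof -
  have [measurable]: "H \<in> borel_measurable borel" using H by measurable
  have [measurable]: "g \<in> borel_measurable borel" using g by (intro borel_measurable_continuous_onI)
  interpret pair_sigma_finite gauss lborel ..
  have smooth: "(\<integral>z. H z * (\<integral>y. g (z + c *\<^sub>R y) \<partial>gauss) \<partial>gauss) = 0" if "c > 0" for c
  proof -
    define K where "K = (\<lambda>(z, x). H z * (g x * of_real (exp (- (1 / c\<^sup>2) * (cmod (x - z))\<^sup>2))))"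
    have [measurable]: "K \<in> borel_measurable (gauss \<Otimes>\<^sub>M lborel)"
      unfolding K_def by measurable
    have "integrable (gauss \<Otimes>\<^sub>M lborel) K"
    proof (rule integrableI_bounded)
      have "(\<integral>\<^sup>+p. ennreal (norm (K p)) \<partial>(gauss \<Otimes>\<^sub>M lborel)) = (\<integral>\<^sup>+z. \<integral>\<^sup>+x. ennreal (norm (K (z, x))) \<partial>lborel \<partial>gauss)"
        by (rule lborel.nn_integral_fst[symmetric]) measurable
      also have "\<dots> \<le> (\<integral>\<^sup>+z. \<integral>\<^sup>+x. ennreal (cmod (H z)) * ennreal (exp (- (1 / c\<^sup>2) * (cmod (x - z))\<^sup>2)) \<partial>lborel \<partial>gauss)"
      proof (intro nn_integral_mono)
        fix z x
        have "cmod (g x) * exp (- (1 / c\<^sup>2) * (cmod (x - z))\<^sup>2) \<le> 1 * exp (- (1 / c\<^sup>2) * (cmod (x - z))\<^sup>2)"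
          by (intro mult_right_mono g) auto
        then show "ennreal (norm (K (z, x))) \<le> ennreal (cmod (H z)) * ennreal (exp (- (1 / c\<^sup>2) * (cmod (x - z))\<^sup>2))"
          by (simp add: K_def norm_mult ennreal_mult[symmetric] mult_left_mono)
      qed
      also have "\<dots> = (\<integral>\<^sup>+z. ennreal (cmod (H z)) * ennreal (pi * c\<^sup>2) \<partial>gauss)"
        using that by (subst nn_integral_cmult, measurable) (simp only: nn_integral_exp_lborel)
      also have "\<dots> = (\<integral>\<^sup>+z. ennreal (cmod (H z)) \<partial>gauss) * ennreal (pi * c\<^sup>2)"
        by (rule nn_integral_multc) measurable
      also have "\<dots> < \<infinity>"
        using poly_bounded_integrable_gauss[OF H] by (simp add: integrable_iff_bounded ennreal_mult_less_top)
      finally show "(\<integral>\<^sup>+p. ennreal (norm (K p)) \<partial>(gauss \<Otimes>\<^sub>M lborel)) < \<infinity>" .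
    qed measurable
    then have int: "integrable (gauss \<Otimes>\<^sub>M lborel) (\<lambda>(z, x). K (z, x))"
      by (simp add: case_prod_eta)
    have inner: "(\<integral>z. K (z, x) \<partial>gauss) = 0" for x
    proof -
      have "(\<integral>z. K (z, x) \<partial>gauss) = (\<integral>z. g x * (H z * of_real (exp (- (1 / c\<^sup>2) * (cmod (x - z))\<^sup>2))) \<partial>gauss)"
        by (simp add: K_def mult_ac)
      also have "\<dots> = g x * (\<integral>z. H z * of_real (exp (- (1 / c\<^sup>2) * (cmod (x - z))\<^sup>2)) \<partial>gauss)"
        by simp
      also have "(\<integral>z. H z * of_real (exp (- (1 / c\<^sup>2) * (cmod (x - z))\<^sup>2)) \<partial>gauss) = 0"
        using that by (intro gauss_moments_zero_imp_translate_zero(2)[OF H zero]) auto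
      finally show ?thesis by simp
    qed
    have "(\<integral>z. (\<integral>x. K (z, x) \<partial>lborel) \<partial>gauss) = (\<integral>x. (\<integral>z. K (z, x) \<partial>gauss) \<partial>lborel)"
      using Fubini_integral[OF int] by simp
    also have "\<dots> = 0" by (simp only: inner) simp
    finally have "(\<integral>z. (\<integral>x. K (z, x) \<partial>lborel) \<partial>gauss) = 0" .
    moreover have "H z * (\<integral>y. g (z + c *\<^sub>R y) \<partial>gauss) = of_real (1 / (pi * c\<^sup>2)) * (\<integral>x. K (z, x) \<partial>lborel)" for z
      using that by (subst gauss_average_eq) (auto simp: K_def)
    ultimately show ?thesis by simp
  qed
  have ptw: "(\<lambda>n. \<integral>y. g (z + (1 / real (Suc n)) *\<^sub>R y) \<partial>gauss) \<longlonglongrightarrow> g z" for z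
  proof -
    have "(\<lambda>n. \<integral>y. g (z + (1 / real (Suc n)) *\<^sub>R y) \<partial>gauss) \<longlonglongrightarrow> (\<integral>y. g z \<partial>gauss)"
    proof (rule integral_dominated_convergence[where w = "\<lambda>_. 1"])
      show "AE y in gauss. (\<lambda>n. g (z + (1 / real (Suc n)) *\<^sub>R y)) \<longlonglongrightarrow> g z"
      proof (rule AE_I2)
        fix y
        have "(\<lambda>n. z + (1 / real (Suc n)) *\<^sub>R y) \<longlonglongrightarrow> z + 0 *\<^sub>R y"
          by (intro tendsto_intros) (rule LIMSEQ_Suc[OF lim_1_over_n])
        then show "(\<lambda>n. g (z + (1 / real (Suc n)) *\<^sub>R y)) \<longlonglongrightarrow> g z"
          using continuous_on_tendsto_compose[OF g(1), of _ z] by simp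
      qed
    qed (use g in auto)
    then show ?thesis by (simp add: measure_gauss_UNIV)
  qed
  have avg_le: "cmod (\<integral>y. g (z + c *\<^sub>R y) \<partial>gauss) \<le> 1" for z c
  proof -
    have "integrable gauss (\<lambda>y. g (z + c *\<^sub>R y))"
      by (rule gauss.integrable_const_bound[where B = 1]) (use g in auto)
    then have "(\<integral>y. cmod (g (z + c *\<^sub>R y)) \<partial>gauss) \<le> (\<integral>y. 1 \<partial>gauss)"
      by (intro integral_mono) (use g in auto)
    moreover have "cmod (\<integral>y. g (z + c *\<^sub>R y) \<partial>gauss) \<le> (\<integral>y. cmod (g (z + c *\<^sub>R y)) \<partial>gauss)"
      by (rule integral_norm_bound)
    moreover have "(\<integral>y. 1 \<partial>gauss) = (1::real)" by (simp add: measure_gauss_UNIV)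
    ultimately show ?thesis by linarith
  qed
  have "(\<lambda>n. \<integral>z. H z * (\<integral>y. g (z + (1 / real (Suc n)) *\<^sub>R y) \<partial>gauss) \<partial>gauss) \<longlonglongrightarrow> (\<integral>z. H z * g z \<partial>gauss)"
  proof (rule integral_dominated_convergence[where w = "\<lambda>z. cmod (H z)"])
    show "integrable gauss (\<lambda>z. cmod (H z))"
      using poly_bounded_integrable_gauss[OF H] by simp
    show "AE z in gauss. (\<lambda>n. H z * (\<integral>y. g (z + (1 / real (Suc n)) *\<^sub>R y) \<partial>gauss)) \<longlonglongrightarrow> H z * g z"
      by (intro AE_I2 tendsto_mult tendsto_const ptw)
    show "AE z in gauss. norm (H z * (\<integral>y. g (z + (1 / real (Suc n)) *\<^sub>R y) \<partial>gauss)) \<le> cmod (H z)" for n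
      using avg_le by (intro AE_I2) (simp add: norm_mult mult_left_le)
    show "(\<lambda>z. H z * (\<integral>y. g (z + (1 / real (Suc n)) *\<^sub>R y) \<partial>gauss)) \<in> borel_measurable gauss" for n
      by measurable
  qed measurable
  then show ?thesis
    using smooth by (simp add: LIMSEQ_const_iff)
qed

text \<open>A function that is orthogonal to all bounded continuous functions has integral zero over every
closed set, hence over every Borel set.\<close>

theorem gauss_moments_zero_imp_AE_zero:
  assumes H: "poly_bounded H"
    and zero: "\<And>a b. (\<integral>z. H z * z ^ a * cnj z ^ b \<partial>gauss) = 0"
  shows "AE z in gauss. H z = 0"
proof (rule gauss.density_zero)
  show int: "integrable gauss H"
    by (rule poly_bounded_integrable_gauss[OF H])
  have [measurable]: "H \<in> borel_measurable borel" using H by measurable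
  have closed: "(\<integral>z. H z * of_real (indicator C z) \<partial>gauss) = 0" if "closed C" for C
  proof (cases "C = {}")
    case False
    have [measurable]: "C \<in> sets borel" using that by (rule borel_closed)
    define g where "g n z = complex_of_real (max 0 (1 - real n * infdist z C))" for n z
    have cont: "continuous_on UNIV (g n)" for n
      unfolding g_def by (intro continuous_intros)
    have [measurable]: "g n \<in> borel_measurable borel" for n
      using cont by (rule borel_measurable_continuous_onI)
    have g1: "cmod (g n z) \<le> 1" for n z
      using infdist_nonneg[of z C] by (auto simp: g_def)
    have "(\<lambda>n. \<integral>z. H z * g n z \<partial>gauss) \<longlonglongrightarrow> (\<integral>z. H z * of_real (indicator C z) \<partial>gauss)"
    proof (rule integral_dominated_convergence[where w = "\<lambda>z. cmod (H z)"])
      show "AE z in gauss. (\<lambda>n. H z * g n z) \<longlonglongrightarrow> H z * of_real (indicator C z)"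
      proof (intro AE_I2 tendsto_mult tendsto_const)
        fix z
        show "(\<lambda>n. g n z) \<longlonglongrightarrow> of_real (indicator C z)"
        proof (cases "z \<in> C")
          case True
          then show ?thesis by (simp add: g_def infdist_zero)
        next
          case False
          then have pos: "infdist z C > 0"
            using \<open>closed C\<close> \<open>C \<noteq> {}\<close> infdist_pos_not_in_closed by blast
          obtain N :: nat where "1 / infdist z C < real N" using reals_Archimedean2 by blast
          then have N: "1 < real N * infdist z C" using pos by (simp add: field_simps)
          have "g n z = 0" if "n \<ge> N" for n
          proof -
            have "real N * infdist z C \<le> real n * infdist z C" using that pos by simp
            then show ?thesis using N by (simp add: g_def)
          qed
          then have "\<forall>\<^sub>F n in sequentially. g n z = 0"
            unfolding eventually_sequentially by blast
          then show ?thesis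
            using False by (simp add: tendsto_eventually)
        qed
      qed
      show "AE z in gauss. norm (H z * g n z) \<le> cmod (H z)" for n
        using g1 by (intro AE_I2) (simp add: norm_mult mult_left_le)
    qed (use int in auto)
    then show ?thesis
      using gauss_moments_zero_imp_continuous_zero[OF H zero cont g1] by (simp add: LIMSEQ_const_iff)
  qed simp
  have all: "(\<integral>z. H z * of_real (indicator A z) \<partial>gauss) = 0" if "A \<in> sigma_sets UNIV (Collect closed)" for A
  proof -
    have b: "sigma_sets UNIV (Collect closed) = sets (borel :: complex measure)"
      by (simp add: borel_eq_closed)
    have int_ind: "integrable gauss (\<lambda>z. H z * of_real (indicator A z))" if "A \<in> sets borel" for A
      by (rule Bochner_Integration.integrable_bound[OF int]) (use that in \<open>auto split: split_indicator\<close>)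
    have "Int_stable (Collect closed :: complex set set)" "Collect closed \<subseteq> Pow (UNIV :: complex set)"
      by (auto simp: Int_stable_def)
    from this that show ?thesis
    proof (induction rule: sigma_sets_induct_disjoint)
      case (basic A)
      then show ?case using closed by simp
    next
      case empty
      then show ?case by simp
    next
      case (compl A)
      have "(\<integral>z. H z * of_real (indicator (UNIV - A) z) \<partial>gauss) = (\<integral>z. H z - H z * of_real (indicator A z) \<partial>gauss)"
        by (intro Bochner_Integration.integral_cong) (auto split: split_indicator)
      also have "\<dots> = (\<integral>z. H z * of_real (indicator UNIV z) \<partial>gauss) - (\<integral>z. H z * of_real (indicator A z) \<partial>gauss)"
        using int int_ind compl b by (subst Bochner_Integration.integral_diff) auto
      finally show ?case using compl closed[of UNIV] by simp
    next
      case (union A)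
      have A: "A i \<in> sets gauss" for i using union b by auto
      have conv: "H z * of_real (indicator B z) = indicator B z *\<^sub>R H z" for B z
        by (simp add: scaleR_conv_of_real mult.commute)
      have "(LINT z:(\<Union>i. A i)|gauss. H z) = (\<Sum>i. (LINT z:(A i)|gauss. H z))"
      proof (rule lebesgue_integral_countable_add[OF A])
        show "set_integrable gauss (\<Union>i. A i) H"
          unfolding set_integrable_def conv[symmetric] using A by (intro int_ind) auto
      qed (use union in \<open>auto simp: disjoint_family_on_def\<close>)
      then show ?case
        using union.IH by (simp add: set_lebesgue_integral_def conv)
    qed
  qed
  show "set_lebesgue_integral gauss A H = 0" if "A \<in> sets gauss" for A
    using all[of A] that
    by (simp add: set_lebesgue_integral_def scaleR_conv_of_real mult.commute borel_eq_closed)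
qed

section \<open>Radial functions\<close>

text \<open>The null set on which \<open>v(\<xi> z) = v(z)\<close> fails depends on \<open>\<xi>\<close>. Fubini's theorem shows that for almost every
\<open>z\<close> the function \<open>v\<close> equals \<open>v z\<close> at almost all points of the circle through \<open>z\<close>. Two such points on one
circle have the same value, and this value defines the radial profile.\<close>

lemma radial_if_rotation_invariant:
  assumes [measurable]: "v \<in> borel_measurable borel"
    and inv: "\<And>\<xi>. cmod \<xi> = 1 \<Longrightarrow> AE z in gauss. v (\<xi> * z) = v z"
  shows "radial v"
proof -
  interpret pair_sigma_finite "lborel :: real measure" gauss ..
  have [measurable]: "(\<lambda>x. cis (f x)) \<in> borel_measurable M" if "f \<in> borel_measurable M" for f and M :: "'x measure"
    using that by (simp add: borel_measurable_complex_iff)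
  have "AE \<theta> in lborel. AE z in gauss. v (cis \<theta> * z) = v z"
    using inv by auto
  then have AE: "AE z in gauss. AE \<theta> in lborel. v (cis \<theta> * z) = v z"
    by (subst (asm) AE_commute) measurable
  define G where "G = {z. AE \<theta> in lborel. v (cis \<theta> * z) = v z}"
  define \<phi> where "\<phi> r = v (SOME z. z \<in> G \<and> cmod z = r)" for r
  have "v z = \<phi> (cmod z)" if z: "z \<in> G" for z
  proof -
    define z' where "z' = (SOME w. w \<in> G \<and> cmod w = cmod z)"
    have "z' \<in> G \<and> cmod z' = cmod z"
      unfolding z'_def by (rule someI[of _ z]) (use z in auto)
    then have z': "z' \<in> G" "cmod z' = cmod z" by auto
    obtain \<alpha> where \<alpha>: "z' = cis \<alpha> * z"
    proof (cases "z = 0")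
      case True
      then show ?thesis using z' that[of 0] by simp
    next
      case False
      then have "cmod (z' / z) = 1" using z' by (simp add: norm_divide)
      then obtain \<alpha> where "z' / z = cis \<alpha>" by (metis cis_Arg norm_eq_zero sgn_eq div_by_1 of_real_1 zero_neq_one)
      then show ?thesis using that[of \<alpha>] False by (simp add: field_simps)
    qed
    have "AE \<theta> in lborel. v (cis \<theta> * z) = v z" using z by (simp add: G_def)
    then have "AE \<theta> in lborel. v (cis (\<alpha> + 1 * \<theta>) * z) = v z"
      by (intro AE_borel_affine) auto
    moreover have "AE \<theta> in lborel. v (cis \<theta> * z') = v z'" using z' by (simp add: G_def)
    ultimately have "AE \<theta> in lborel. v (cis (\<alpha> + 1 * \<theta>) * z) = v z \<and> v (cis \<theta> * z') = v z'"
      by (rule eventually_conj)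
    moreover have "ae_filter (lborel :: real measure) \<noteq> bot"
      by (simp add: ae_filter_eq_bot_iff)
    ultimately obtain \<theta> where \<theta>: "v (cis (\<alpha> + 1 * \<theta>) * z) = v z" "v (cis \<theta> * z') = v z'"
      using eventually_happens' by blast
    have "cis (\<alpha> + 1 * \<theta>) * z = cis \<theta> * z'"
      by (simp add: \<alpha> cis_mult[symmetric] mult_ac)
    then have "v z = v z'" using \<theta> by simp
    then show ?thesis by (simp add: \<phi>_def z'_def)
  qed
  then have "AE z in gauss. v z = \<phi> (cmod z)"
    using AE by (auto simp: G_def elim!: eventually_mono)
  then show ?thesis
    unfolding radial_def AE_lebesgue_iff_gauss by blast
qed

lemma gauss_moment_rotate:
  assumes [measurable]: "v \<in> borel_measurable borel" and "cmod \<xi> = 1"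
  shows "(\<integral>z. v (\<xi> * z) * z ^ a * cnj z ^ b \<partial>gauss) = cnj \<xi> ^ a * \<xi> ^ b * (\<integral>z. v z * z ^ a * cnj z ^ b \<partial>gauss)"
proof -
  have \<xi>: "\<xi> * cnj \<xi> = 1"
    using assms complex_norm_square[of \<xi>] by simp
  have "(\<integral>z. v (\<xi> * z) * z ^ a * cnj z ^ b \<partial>gauss)
     = (\<integral>z. cnj \<xi> ^ a * \<xi> ^ b * (v (\<xi> * z) * (\<xi> * z) ^ a * cnj (\<xi> * z) ^ b) \<partial>gauss)"
  proof (intro Bochner_Integration.integral_cong refl)
    fix z
    have "cnj \<xi> ^ a * \<xi> ^ b * (v (\<xi> * z) * (\<xi> * z) ^ a * cnj (\<xi> * z) ^ b)
        = (\<xi> * cnj \<xi>) ^ a * (\<xi> * cnj \<xi>) ^ b * (v (\<xi> * z) * z ^ a * cnj z ^ b)"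
      by (simp add: power_mult_distrib mult_ac)
    then show "v (\<xi> * z) * z ^ a * cnj z ^ b = cnj \<xi> ^ a * \<xi> ^ b * (v (\<xi> * z) * (\<xi> * z) ^ a * cnj (\<xi> * z) ^ b)"
      by (simp only: \<xi> power_one mult_1_left)
  qed
  also have "\<dots> = cnj \<xi> ^ a * \<xi> ^ b * (\<integral>z. v (\<xi> * z) * (\<xi> * z) ^ a * cnj (\<xi> * z) ^ b \<partial>gauss)"
    by simp
  also have "(\<integral>z. v (\<xi> * z) * (\<xi> * z) ^ a * cnj (\<xi> * z) ^ b \<partial>gauss) = (\<integral>z. v z * z ^ a * cnj z ^ b \<partial>gauss)"
    by (rule integral_gauss_rotate[OF assms(2), where f = "\<lambda>z. v z * z ^ a * cnj z ^ b"]) measurable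
  finally show ?thesis .
qed

text \<open>Rotating \<open>v\<close> by \<open>\<xi>\<close> multiplies its moment of type \<open>(a, b)\<close> by \<open>\<xi>^(b - a)\<close>. So if only the moments with
\<open>a = b\<close> are nonzero, all moments are invariant.\<close>

theorem radial_if_off_diagonal_moments_zero:
  assumes v: "poly_bounded v"
    and zero: "\<And>a b. a \<noteq> b \<Longrightarrow> (\<integral>z. v z * z ^ a * cnj z ^ b \<partial>gauss) = 0"
  shows "radial v"
proof (rule radial_if_rotation_invariant)
  show m [measurable]: "v \<in> borel_measurable borel" using v by measurable
  fix \<xi> :: complex assume \<xi>: "cmod \<xi> = 1"
  have v': "poly_bounded (\<lambda>z. v (\<xi> * z))" by (rule poly_bounded_rotate[OF v \<xi>])
  have "AE z in gauss. v (\<xi> * z) - v z = 0"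
  proof (rule gauss_moments_zero_imp_AE_zero)
    show "poly_bounded (\<lambda>z. v (\<xi> * z) - v z)" using v v' by auto
    fix a b
    have "(\<integral>z. (v (\<xi> * z) - v z) * z ^ a * cnj z ^ b \<partial>gauss)
      = (\<integral>z. v (\<xi> * z) * z ^ a * cnj z ^ b - v z * z ^ a * cnj z ^ b \<partial>gauss)"
      by (simp add: algebra_simps)
    also have "\<dots> = (\<integral>z. v (\<xi> * z) * z ^ a * cnj z ^ b \<partial>gauss) - (\<integral>z. v z * z ^ a * cnj z ^ b \<partial>gauss)"
      using v v' by (intro Bochner_Integration.integral_diff poly_bounded_integrable_gauss) auto
    also have "\<dots> = 0"
    proof (cases "a = b")
      case True
      have "cnj \<xi> ^ a * \<xi> ^ a = 1"
        using complex_norm_square[of \<xi>] \<xi> by (simp add: power_mult_distrib[symmetric] mult.commute)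
      then show ?thesis using gauss_moment_rotate[OF m \<xi>, of a b] True by simp
    next
      case False
      then show ?thesis using gauss_moment_rotate[OF m \<xi>, of a b] zero[OF False] by simp
    qed
    finally show "(\<integral>z. (v (\<xi> * z) - v z) * z ^ a * cnj z ^ b \<partial>gauss) = 0" .
  qed
  then show "AE z in gauss. v (\<xi> * z) = v z" by simp
qed

section \<open>Orthogonality of monomials and power series\<close>

text \<open>A symbol that is radial almost everywhere provides invariance in this form, with an exceptional null
set for each rotation.\<close>

definition rotation_invariant :: "(complex \<Rightarrow> complex) \<Rightarrow> bool" where
  "rotation_invariant k \<longleftrightarrow> k \<in> borel_measurable borel \<and> (\<forall>\<xi>. cmod \<xi> = 1 \<longrightarrow> (AE z in gauss. k (\<xi> * z) = k z))"

lemma rotation_invariant_measurable [measurable_dest]: "rotation_invariant k \<Longrightarrow> k \<in> borel_measurable borel"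
  by (simp add: rotation_invariant_def)

lemma rotation_invariant_norm:
  assumes "(\<lambda>z. g (cmod z)) \<in> borel_measurable borel"
  shows "rotation_invariant (\<lambda>z. g (cmod z))"
  using assms by (auto simp: rotation_invariant_def norm_mult)

lemma rotation_invariant_mult:
  assumes "rotation_invariant k" "rotation_invariant l"
  shows "rotation_invariant (\<lambda>z. k z * l z)"
  unfolding rotation_invariant_def
proof safe
  show "(\<lambda>z. k z * l z) \<in> borel_measurable borel" using assms by measurable
  fix \<xi> :: complex assume "cmod \<xi> = 1"
  then have "AE z in gauss. k (\<xi> * z) = k z" "AE z in gauss. l (\<xi> * z) = l z"
    using assms by (auto simp: rotation_invariant_def)
  then show "AE z in gauss. k (\<xi> * z) * l (\<xi> * z) = k z * l z"
    by eventually_elim simp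
qed

text \<open>Choose the rotation for which \<open>z\<^sup>n (cnj z)\<^sup>m\<close> changes sign.\<close>

lemma rotation_invariant_orthogonal:
  assumes k: "rotation_invariant k" and "n \<noteq> m"
  shows "(\<integral>z. k z * z ^ n * cnj z ^ m \<partial>gauss) = 0"
proof -
  have [measurable]: "k \<in> borel_measurable borel" using k by measurable
  define \<theta> where "\<theta> = pi / (real m - real n)"
  define \<xi> where "\<xi> = cis \<theta>"
  have \<xi>: "cmod \<xi> = 1" by (simp add: \<xi>_def)
  have "cnj \<xi> ^ n * \<xi> ^ m = cis (real n * (- \<theta>)) * cis (real m * \<theta>)"
    by (simp only: \<xi>_def cis_cnj Complex.DeMoivre)
  also have "\<dots> = cis (real n * (- \<theta>) + real m * \<theta>)" by (rule cis_mult)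
  also have "real n * (- \<theta>) + real m * \<theta> = (real m - real n) * \<theta>"
    by (simp add: algebra_simps)
  also have "\<dots> = pi"
    using \<open>n \<noteq> m\<close> by (simp add: \<theta>_def)
  also have "cis pi = -1" by simp
  finally have e: "cnj \<xi> ^ n * \<xi> ^ m = -1" .
  have "AE z in gauss. k (\<xi> * z) = k z" using k \<xi> by (simp add: rotation_invariant_def)
  then have "(\<integral>z. k z * z ^ n * cnj z ^ m \<partial>gauss) = (\<integral>z. k (\<xi> * z) * z ^ n * cnj z ^ m \<partial>gauss)"
    by (intro integral_cong_AE) auto
  also have "\<dots> = - (\<integral>z. k z * z ^ n * cnj z ^ m \<partial>gauss)"
    using gauss_moment_rotate[of k \<xi> n m] \<xi> e by simp
  finally show ?thesis by simp
qed

lemma mult_cnj_power: "z ^ n * cnj z ^ n = of_real (cmod z ^ (2 * n))"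
proof -
  have "z ^ n * cnj z ^ n = (z * cnj z) ^ n" by (simp add: power_mult_distrib)
  also have "\<dots> = of_real (cmod z ^ (2 * n))"
    by (simp add: complex_norm_square[symmetric] power_mult)
  finally show ?thesis .
qed

lemma entire_series_abs_summable:
  assumes "\<And>z. (\<lambda>n. b n * z ^ n) sums (g z :: complex)" and "R \<ge> (0::real)"
  shows "summable (\<lambda>n. cmod (b n) * R ^ n)"
proof -
  have "summable (\<lambda>n. b n * of_real (R + 1) ^ n)" using assms(1)[of "of_real (R + 1)"] by (simp add: sums_iff)
  then have "summable (\<lambda>n. norm (b n * of_real R ^ n))"
    by (rule powser_insidea) (use assms(2) in simp)
  then show ?thesis using assms(2) by (simp add: norm_mult norm_power)
qed

lemma entire_series_holomorphic:
  assumes "\<And>z. (\<lambda>n. b n * z ^ n) sums (g z :: complex)"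
  shows "g holomorphic_on UNIV" and "fps_nth (fps_expansion g 0) n = b n"
proof -
  have "g holomorphic_on ball 0 r" for r
    using assms by (intro power_series_holomorphic[where a = b]) auto
  then have "\<exists>f'. (g has_field_derivative f') (at z)" for z
    using holomorphic_on_open[of "ball 0 (cmod z + 1)" g] by (auto dest!: bspec[where x = z])
  then show "g holomorphic_on UNIV" by (simp add: holomorphic_on_open)
  have "conv_radius b \<ge> 1"
    using conv_radius_geI[of b 1] assms[of 1] by (simp add: sums_iff one_ereal_def)
  then have "fps_conv_radius (Abs_fps b) > 0"
    unfolding fps_conv_radius_def using less_le_trans[of "0::ereal" 1 "conv_radius b"] \<open>conv_radius b \<ge> 1\<close> by simp
  moreover have "eval_fps (Abs_fps b) = g"
    using assms by (auto simp: eval_fps_def fun_eq_iff sums_iff)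
  ultimately have "g has_fps_expansion Abs_fps b"
    using eval_fps_has_fps_expansion by metis
  then show "fps_nth (fps_expansion g 0) n = b n"
    by (simp add: fps_expansion_eqI)
qed

lemma entire_sums:
  assumes "f holomorphic_on UNIV"
  shows "(\<lambda>n. fps_nth (fps_expansion f 0) n * z ^ n) sums f z"
proof -
  have "f has_fps_expansion fps_expansion f 0"
    using assms by (intro has_fps_expansion_fps_expansion) auto
  then show ?thesis
    by (rule has_fps_expansion_imp_sums_complex[where r = \<infinity>]) (use assms in \<open>auto simp: holomorphic_on_subset\<close>)
qed

lemma entire_measurable:
  "f holomorphic_on UNIV \<Longrightarrow> f \<in> borel_measurable borel"
  by (intro borel_measurable_continuous_onI holomorphic_on_imp_continuous_on)

text \<open>On a disc the power series converges uniformly and orthogonality leaves only the term of degree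
\<open>m\<close>. The discs are then exhausted by dominated convergence.\<close>

lemma integral_entire_coefficient:
  assumes k: "rotation_invariant k" and intk: "integrable gauss k"
    and intm: "integrable gauss (\<lambda>z. k z * of_real (cmod z ^ (2 * m)))"
    and sums: "\<And>z. (\<lambda>n. b n * z ^ n) sums g z"
    and intg: "integrable gauss (\<lambda>z. k z * g z * cnj z ^ m)"
  shows "(\<integral>z. k z * g z * cnj z ^ m \<partial>gauss) = b m * (\<integral>z. k z * of_real (cmod z ^ (2 * m)) \<partial>gauss)"
proof -
  have [measurable]: "k \<in> borel_measurable borel" using k by measurable
  have [measurable]: "g \<in> borel_measurable borel"
    using entire_series_holomorphic(1)[OF sums] by (rule entire_measurable)
  define kR where "kR R z = k z * of_real (indicator {..R} (cmod z))" for R z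
  have kR: "rotation_invariant (kR R)" for R
    unfolding kR_def by (intro rotation_invariant_mult k rotation_invariant_norm) measurable
  then have [measurable]: "kR R \<in> borel_measurable borel" for R by measurable
  have kRle: "cmod (kR R z) \<le> cmod (k z)" for R z
    by (auto simp: kR_def norm_mult split: split_indicator)
  have disc: "(\<integral>z. kR R z * g z * cnj z ^ m \<partial>gauss) = b m * (\<integral>z. kR R z * of_real (cmod z ^ (2 * m)) \<partial>gauss)"
    if "R \<ge> 0" for R
  proof -
    define B where "B = (\<Sum>n. cmod (b n) * R ^ n)"
    have summ: "summable (\<lambda>n. cmod (b n) * R ^ n)"
      by (rule entire_series_abs_summable[OF sums that])
    have int: "integrable gauss (\<lambda>z. kR R z * z ^ i * cnj z ^ j)" for i j
    proof (rule Bochner_Integration.integrable_bound)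
      show "integrable gauss (\<lambda>z. k z * of_real (R ^ (i + j)))" using intk by simp
      show "AE z in gauss. norm (kR R z * z ^ i * cnj z ^ j) \<le> norm (k z * of_real (R ^ (i + j)))"
      proof (rule AE_I2)
        fix z
        show "norm (kR R z * z ^ i * cnj z ^ j) \<le> norm (k z * of_real (R ^ (i + j)))"
        proof (cases "cmod z \<le> R")
          case True
          have "cmod z ^ (i + j) \<le> R ^ (i + j)" using True by (intro power_mono) auto
          then show ?thesis using True that
            by (simp add: kR_def norm_mult norm_power power_add mult.assoc mult_left_mono)
        qed (simp add: kR_def)
      qed
    qed measurable
    have fin: "(\<integral>z. kR R z * (\<Sum>n<N. b n * z ^ n) * cnj z ^ m \<partial>gauss)
        = b m * (\<integral>z. kR R z * of_real (cmod z ^ (2 * m)) \<partial>gauss)" if "N > m" for N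
    proof -
      have "(\<integral>z. kR R z * (\<Sum>n<N. b n * z ^ n) * cnj z ^ m \<partial>gauss)
          = (\<integral>z. (\<Sum>n<N. b n * (kR R z * z ^ n * cnj z ^ m)) \<partial>gauss)"
        by (intro Bochner_Integration.integral_cong refl) (simp add: sum_distrib_left sum_distrib_right mult_ac)
      also have "\<dots> = (\<Sum>n<N. b n * (\<integral>z. kR R z * z ^ n * cnj z ^ m \<partial>gauss))"
        using int by (subst Bochner_Integration.integral_sum) auto
      also have "\<dots> = (\<Sum>n<N. if n = m then b m * (\<integral>z. kR R z * z ^ m * cnj z ^ m \<partial>gauss) else 0)"
        by (intro sum.cong) (auto simp: rotation_invariant_orthogonal[OF kR])
      also have "\<dots> = b m * (\<integral>z. kR R z * z ^ m * cnj z ^ m \<partial>gauss)"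
        using that by simp
      finally show ?thesis by (simp only: mult.assoc mult_cnj_power)
    qed
    have "(\<lambda>N. \<integral>z. kR R z * (\<Sum>n<N. b n * z ^ n) * cnj z ^ m \<partial>gauss) \<longlonglongrightarrow> (\<integral>z. kR R z * g z * cnj z ^ m \<partial>gauss)"
    proof (rule integral_dominated_convergence[where w = "\<lambda>z. cmod (k z) * (B * R ^ m)"])
      show "integrable gauss (\<lambda>z. cmod (k z) * (B * R ^ m))" using intk by (intro integrable_mult_left integrable_norm)
      show "AE z in gauss. (\<lambda>N. kR R z * (\<Sum>n<N. b n * z ^ n) * cnj z ^ m) \<longlonglongrightarrow> kR R z * g z * cnj z ^ m"
        using sums by (intro AE_I2 tendsto_mult tendsto_const) (auto simp: sums_def)
      show "AE z in gauss. norm (kR R z * (\<Sum>n<N. b n * z ^ n) * cnj z ^ m) \<le> cmod (k z) * (B * R ^ m)" for N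
      proof (rule AE_I2)
        fix z
        show "norm (kR R z * (\<Sum>n<N. b n * z ^ n) * cnj z ^ m) \<le> cmod (k z) * (B * R ^ m)"
        proof (cases "cmod z \<le> R")
          case True
          have "cmod (\<Sum>n<N. b n * z ^ n) \<le> (\<Sum>n<N. cmod (b n) * R ^ n)"
            using True by (intro sum_norm_le) (auto simp: norm_mult norm_power intro!: mult_left_mono power_mono)
          also have "\<dots> \<le> B"
            unfolding B_def using summ that by (intro sum_le_suminf) auto
          finally have "cmod (\<Sum>n<N. b n * z ^ n) * cmod z ^ m \<le> B * R ^ m"
            using True by (intro mult_mono power_mono) (auto intro: order_trans[OF norm_ge_zero])
          then show ?thesis using True
            by (simp add: kR_def norm_mult norm_power mult.assoc mult_left_mono)
        next
          case False
          have "0 \<le> B" unfolding B_def using summ that by (intro suminf_nonneg) auto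
          then show ?thesis using False that by (simp add: kR_def)
        qed
      qed
    qed measurable
    moreover have "(\<lambda>N. \<integral>z. kR R z * (\<Sum>n<N. b n * z ^ n) * cnj z ^ m \<partial>gauss) \<longlonglongrightarrow> b m * (\<integral>z. kR R z * of_real (cmod z ^ (2 * m)) \<partial>gauss)"
      by (rule tendsto_eventually, rule eventually_mono[OF eventually_gt_at_top[of m]], rule fin)
    ultimately show ?thesis by (rule LIMSEQ_unique)
  qed
  have exhaust: "(\<lambda>R. \<integral>z. kR (real R) z * f z \<partial>gauss) \<longlonglongrightarrow> (\<integral>z. k z * f z \<partial>gauss)"
    if [measurable]: "f \<in> borel_measurable borel" and int: "integrable gauss (\<lambda>z. k z * f z)" for f :: "complex \<Rightarrow> complex"
  proof (rule integral_dominated_convergence[where w = "\<lambda>z. cmod (k z * f z)"])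
    show "integrable gauss (\<lambda>z. cmod (k z * f z))" using int by (rule integrable_norm)
    show "AE z in gauss. norm (kR (real R) z * f z) \<le> cmod (k z * f z)" for R
      using kRle by (intro AE_I2) (simp add: norm_mult mult_right_mono)
    show "AE z in gauss. (\<lambda>R. kR (real R) z * f z) \<longlonglongrightarrow> k z * f z"
    proof (rule AE_I2)
      fix z
      obtain N :: nat where N: "cmod z \<le> real N" using real_arch_simple by blast
      have "kR (real R) z * f z = k z * f z" if "R \<ge> N" for R
      proof -
        have "cmod z \<le> real R" using N that by linarith
        then show ?thesis by (simp add: kR_def)
      qed
      then show "(\<lambda>R. kR (real R) z * f z) \<longlonglongrightarrow> k z * f z"
        by (intro tendsto_eventually) (auto simp: eventually_sequentially)
    qed
  qed measurable
  have "(\<lambda>R. \<integral>z. kR (real R) z * (g z * cnj z ^ m) \<partial>gauss) \<longlonglongrightarrow> (\<integral>z. k z * (g z * cnj z ^ m) \<partial>gauss)"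
    by (rule exhaust) (use intg in \<open>auto simp: mult.assoc\<close>)
  moreover have "(\<lambda>R. \<integral>z. kR (real R) z * (g z * cnj z ^ m) \<partial>gauss) \<longlonglongrightarrow> b m * (\<integral>z. k z * of_real (cmod z ^ (2 * m)) \<partial>gauss)"
    using tendsto_mult[OF tendsto_const exhaust[OF _ intm], of "b m"] disc by (simp add: mult.assoc)
  ultimately show ?thesis by (simp add: mult.assoc LIMSEQ_unique)
qed

lemma integrable_mult_square_integrable:
  fixes f g :: "'a \<Rightarrow> complex"
  assumes [measurable]: "f \<in> borel_measurable M" "g \<in> borel_measurable M"
    and int: "integrable M (\<lambda>x. (cmod (f x))\<^sup>2)" "integrable M (\<lambda>x. (cmod (g x))\<^sup>2)"
  shows "integrable M (\<lambda>x. f x * cnj (g x))"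
proof (rule Bochner_Integration.integrable_bound)
  show "integrable M (\<lambda>x. (cmod (f x))\<^sup>2 + (cmod (g x))\<^sup>2)" using int by simp
  show "AE x in M. norm (f x * cnj (g x)) \<le> norm ((cmod (f x))\<^sup>2 + (cmod (g x))\<^sup>2)"
  proof (rule AE_I2)
    fix x
    have "2 * (cmod (f x) * cmod (g x)) \<le> (cmod (f x))\<^sup>2 + (cmod (g x))\<^sup>2"
      using sum_squares_bound[of "cmod (f x)" "cmod (g x)"] by (simp add: mult.assoc)
    moreover have "0 \<le> cmod (f x) * cmod (g x)" by simp
    ultimately have "cmod (f x) * cmod (g x) \<le> (cmod (f x))\<^sup>2 + (cmod (g x))\<^sup>2" by linarith
    then show "norm (f x * cnj (g x)) \<le> norm ((cmod (f x))\<^sup>2 + (cmod (g x))\<^sup>2)"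
      by (simp add: norm_mult)
  qed
qed measurable

lemma square_integrable_diff_mult:
  fixes f g :: "'a \<Rightarrow> complex"
  assumes [measurable]: "f \<in> borel_measurable M" "g \<in> borel_measurable M"
    and int: "integrable M (\<lambda>x. (cmod (f x))\<^sup>2)" "integrable M (\<lambda>x. (cmod (g x))\<^sup>2)"
  shows "integrable M (\<lambda>x. (cmod (f x - c * g x))\<^sup>2)"
    and "(\<integral>x. (cmod (f x - c * g x))\<^sup>2 \<partial>M)
      = (\<integral>x. (cmod (f x))\<^sup>2 \<partial>M) - 2 * Re (cnj c * (\<integral>x. f x * cnj (g x) \<partial>M)) + (cmod c)\<^sup>2 * (\<integral>x. (cmod (g x))\<^sup>2 \<partial>M)"
proof -
  have fg: "integrable M (\<lambda>x. f x * cnj (g x))"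
    by (rule integrable_mult_square_integrable[OF assms(1,2) int])
  have eq: "(cmod (f x - c * g x))\<^sup>2 = (cmod (f x))\<^sup>2 - 2 * Re (cnj c * (f x * cnj (g x))) + (cmod c)\<^sup>2 * (cmod (g x))\<^sup>2" for x
    by (simp only: cmod_power2) (simp add: power2_eq_square algebra_simps)
  show "integrable M (\<lambda>x. (cmod (f x - c * g x))\<^sup>2)"
    unfolding eq by (intro Bochner_Integration.integrable_add Bochner_Integration.integrable_diff integrable_mult_right integrable_Re int fg)
  have re: "(\<integral>x. Re (cnj c * (f x * cnj (g x))) \<partial>M) = Re (\<integral>x. cnj c * (f x * cnj (g x)) \<partial>M)"
    by (rule integral_Re[OF integrable_mult_right[OF fg]])
  have "(\<integral>x. (cmod (f x - c * g x))\<^sup>2 \<partial>M) = (\<integral>x. (cmod (f x))\<^sup>2 - 2 * Re (cnj c * (f x * cnj (g x))) \<partial>M)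
      + (\<integral>x. (cmod c)\<^sup>2 * (cmod (g x))\<^sup>2 \<partial>M)"
    unfolding eq by (intro Bochner_Integration.integral_add Bochner_Integration.integrable_diff integrable_mult_right integrable_Re int fg)
  also have "(\<integral>x. (cmod (f x))\<^sup>2 - 2 * Re (cnj c * (f x * cnj (g x))) \<partial>M)
      = (\<integral>x. (cmod (f x))\<^sup>2 \<partial>M) - (\<integral>x. 2 * Re (cnj c * (f x * cnj (g x))) \<partial>M)"
    by (intro Bochner_Integration.integral_diff integrable_mult_right integrable_Re int fg)
  finally show "(\<integral>x. (cmod (f x - c * g x))\<^sup>2 \<partial>M)
      = (\<integral>x. (cmod (f x))\<^sup>2 \<partial>M) - 2 * Re (cnj c * (\<integral>x. f x * cnj (g x) \<partial>M)) + (cmod c)\<^sup>2 * (\<integral>x. (cmod (g x))\<^sup>2 \<partial>M)"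
    by (simp only: integral_mult_right_zero re)
qed

text \<open>Induction on the index set, removing from \<open>f\<close> its component along one vector at a time.\<close>

lemma bessel_inequality:
  fixes e :: "nat \<Rightarrow> 'a \<Rightarrow> complex"
  assumes e [measurable]: "\<And>i. e i \<in> borel_measurable M" and inte: "\<And>i. i \<in> I \<Longrightarrow> integrable M (\<lambda>x. (cmod (e i x))\<^sup>2)"
    and orth: "\<And>i j. i \<in> I \<Longrightarrow> j \<in> I \<Longrightarrow> i \<noteq> j \<Longrightarrow> (\<integral>x. e i x * cnj (e j x) \<partial>M) = 0"
    and pos: "\<And>i. i \<in> I \<Longrightarrow> (\<integral>x. (cmod (e i x))\<^sup>2 \<partial>M) > 0"
    and "finite I" and "f \<in> borel_measurable M" "integrable M (\<lambda>x. (cmod (f x))\<^sup>2)"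
  shows "(\<Sum>i\<in>I. (cmod (\<integral>x. f x * cnj (e i x) \<partial>M))\<^sup>2 / (\<integral>x. (cmod (e i x))\<^sup>2 \<partial>M)) \<le> (\<integral>x. (cmod (f x))\<^sup>2 \<partial>M)"
  using \<open>finite I\<close> inte orth pos assms(6,7)
proof (induction I arbitrary: f rule: finite_induct)
  case empty
  then show ?case by simp
next
  case (insert i J)
  note [measurable] = insert.prems(4)
  define N where "N j = (\<integral>x. (cmod (e j x))\<^sup>2 \<partial>M)" for j
  define c where "c = (\<integral>x. f x * cnj (e i x) \<partial>M) / of_real (N i)"
  have N: "N i > 0" using insert.prems(3)[of i] by (simp add: N_def)
  define f' where "f' x = f x - c * e i x" for x
  have [measurable]: "f' \<in> borel_measurable M" unfolding f'_def by measurable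
  have inti: "integrable M (\<lambda>x. (cmod (e i x))\<^sup>2)" using insert.prems by simp
  have f'int: "integrable M (\<lambda>x. (cmod (f' x))\<^sup>2)"
    unfolding f'_def by (rule square_integrable_diff_mult) (use insert.prems inti in measurable)
  have "(\<integral>x. (cmod (f' x))\<^sup>2 \<partial>M) = (\<integral>x. (cmod (f x))\<^sup>2 \<partial>M) - 2 * Re (cnj c * (c * of_real (N i))) + (cmod c)\<^sup>2 * N i"
    unfolding f'_def using N insert.prems inti by (subst square_integrable_diff_mult(2)) (auto simp: c_def N_def)
  also have "cnj c * (c * of_real (N i)) = of_real ((cmod c)\<^sup>2 * N i)"
    using complex_norm_square[of c] by (simp add: mult_ac)
  finally have f': "(\<integral>x. (cmod (f' x))\<^sup>2 \<partial>M) = (\<integral>x. (cmod (f x))\<^sup>2 \<partial>M) - (cmod c)\<^sup>2 * N i" by simp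
  have cN: "(cmod c)\<^sup>2 * N i = (cmod (\<integral>x. f x * cnj (e i x) \<partial>M))\<^sup>2 / N i"
    using N by (simp add: c_def norm_divide power_divide power2_eq_square)
  have same: "(\<integral>x. f' x * cnj (e j x) \<partial>M) = (\<integral>x. f x * cnj (e j x) \<partial>M)" if "j \<in> J" for j
  proof -
    have intj: "integrable M (\<lambda>x. (cmod (e j x))\<^sup>2)" using insert.prems that by simp
    have "(\<integral>x. f' x * cnj (e j x) \<partial>M) = (\<integral>x. f x * cnj (e j x) - c * (e i x * cnj (e j x)) \<partial>M)"
      by (simp add: f'_def algebra_simps)
    also have "\<dots> = (\<integral>x. f x * cnj (e j x) \<partial>M) - c * (\<integral>x. e i x * cnj (e j x) \<partial>M)"
      using insert.prems(5) inti intj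
      by (subst Bochner_Integration.integral_diff) (auto intro!: integrable_mult_square_integrable integrable_mult_right)
    also have "(\<integral>x. e i x * cnj (e j x) \<partial>M) = 0"
      using insert.prems(2)[of i j] insert.hyps that by auto
    finally show ?thesis by simp
  qed
  have "(\<Sum>j\<in>J. (cmod (\<integral>x. f' x * cnj (e j x) \<partial>M))\<^sup>2 / (\<integral>x. (cmod (e j x))\<^sup>2 \<partial>M)) \<le> (\<integral>x. (cmod (f' x))\<^sup>2 \<partial>M)"
    by (rule insert.IH) (use insert.prems f'int in auto)
  then have "(\<Sum>j\<in>J. (cmod (\<integral>x. f x * cnj (e j x) \<partial>M))\<^sup>2 / (\<integral>x. (cmod (e j x))\<^sup>2 \<partial>M)) \<le> (\<integral>x. (cmod (f x))\<^sup>2 \<partial>M) - (cmod c)\<^sup>2 * N i"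
    using same f' by (simp cong: sum.cong)
  then show ?case using insert.hyps cN by (simp add: N_def)
qed

text \<open>Fatou's lemma for the partial sums, whose norms are known by orthogonality.\<close>

lemma entire_square_integrable:
  fixes k :: "complex \<Rightarrow> real"
  assumes k: "rotation_invariant (\<lambda>z. of_real (k z))" and nonneg: "\<And>z. k z \<ge> 0"
    and intm: "\<And>n. integrable gauss (\<lambda>z. k z * cmod z ^ (2 * n))"
    and sums: "\<And>z. (\<lambda>n. b n * z ^ n) sums g z"
    and summ: "summable (\<lambda>n. (cmod (b n))\<^sup>2 * (\<integral>z. k z * cmod z ^ (2 * n) \<partial>gauss))"
  shows "integrable gauss (\<lambda>z. k z * (cmod (g z))\<^sup>2)"
    and "(\<integral>z. k z * (cmod (g z))\<^sup>2 \<partial>gauss) \<le> (\<Sum>n. (cmod (b n))\<^sup>2 * (\<integral>z. k z * cmod z ^ (2 * n) \<partial>gauss))"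
proof -
  define m where "m n = (\<integral>z. k z * cmod z ^ (2 * n) \<partial>gauss)" for n
  have m0: "m n \<ge> 0" for n unfolding m_def using nonneg by (intro integral_nonneg_AE AE_I2) auto
  have "(\<lambda>z. Re (complex_of_real (k z))) \<in> borel_measurable borel" using k by measurable
  then have [measurable]: "k \<in> borel_measurable borel" by simp
  have [measurable]: "g \<in> borel_measurable borel"
    using entire_series_holomorphic(1)[OF sums] by (rule entire_measurable)
  define S where "S N z = (\<Sum>n<N. b n * z ^ n)" for N z
  have [measurable]: "S N \<in> borel_measurable borel" for N unfolding S_def by measurable
  have int: "integrable gauss (\<lambda>z. of_real (k z) * z ^ i * cnj z ^ j)" for i j
  proof (rule Bochner_Integration.integrable_bound)
    show "integrable gauss (\<lambda>z. k z * cmod z ^ (2 * i) + k z * cmod z ^ (2 * j))" using intm by simp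
    show "AE z in gauss. norm (of_real (k z) * z ^ i * cnj z ^ j) \<le> norm (k z * cmod z ^ (2 * i) + k z * cmod z ^ (2 * j))"
    proof (rule AE_I2)
      fix z
      have "2 * (cmod z ^ i * cmod z ^ j) \<le> cmod z ^ (2 * i) + cmod z ^ (2 * j)"
        using sum_squares_bound[of "cmod z ^ i" "cmod z ^ j"] by (simp add: power_even_eq mult.assoc)
      moreover have "0 \<le> cmod z ^ i * cmod z ^ j" by simp
      ultimately have "cmod z ^ i * cmod z ^ j \<le> cmod z ^ (2 * i) + cmod z ^ (2 * j)" by linarith
      then have "k z * (cmod z ^ i * cmod z ^ j) \<le> k z * (cmod z ^ (2 * i) + cmod z ^ (2 * j))"
        using nonneg by (intro mult_left_mono)
      then show "norm (of_real (k z) * z ^ i * cnj z ^ j) \<le> norm (k z * cmod z ^ (2 * i) + k z * cmod z ^ (2 * j))"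
        using nonneg[of z] by (simp add: norm_mult norm_power distrib_left mult.assoc)
    qed
  qed measurable
  have S2: "complex_of_real (k z * (cmod (S N z))\<^sup>2) = (\<Sum>i<N. \<Sum>j<N. b i * cnj (b j) * (of_real (k z) * z ^ i * cnj z ^ j))" for N z
  proof -
    have "complex_of_real (k z * (cmod (S N z))\<^sup>2) = of_real (k z) * (S N z * cnj (S N z))"
      by (simp only: of_real_mult complex_norm_square)
    also have "S N z * cnj (S N z) = (\<Sum>i<N. \<Sum>j<N. (b i * z ^ i) * (cnj (b j) * cnj z ^ j))"
      by (simp add: S_def sum_product)
    finally show ?thesis by (simp add: sum_distrib_left mult_ac)
  qed
  have Sint: "integrable gauss (\<lambda>z. complex_of_real (k z * (cmod (S N z))\<^sup>2))" for N
    unfolding S2 using int by (intro Bochner_Integration.integrable_sum integrable_mult_right)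
  then have Sint': "integrable gauss (\<lambda>z. k z * (cmod (S N z))\<^sup>2)" for N
    using integrable_Re[OF Sint[of N]] by (simp only: Re_complex_of_real)
  have Seq: "(\<integral>z. k z * (cmod (S N z))\<^sup>2 \<partial>gauss) = (\<Sum>n<N. (cmod (b n))\<^sup>2 * m n)" for N
  proof -
    have "complex_of_real (\<integral>z. k z * (cmod (S N z))\<^sup>2 \<partial>gauss) = (\<integral>z. complex_of_real (k z * (cmod (S N z))\<^sup>2) \<partial>gauss)"
      by (rule integral_complex_of_real[symmetric])
    also have "\<dots> = (\<Sum>i<N. \<Sum>j<N. b i * cnj (b j) * (\<integral>z. of_real (k z) * z ^ i * cnj z ^ j \<partial>gauss))"
      unfolding S2 using int
      by (subst Bochner_Integration.integral_sum) (auto intro!: Bochner_Integration.integrable_sum integrable_mult_right sum.cong simp: Bochner_Integration.integral_sum)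
    also have "\<dots> = (\<Sum>i<N. \<Sum>j<N. if j = i then of_real ((cmod (b i))\<^sup>2 * m i) else 0)"
    proof (intro sum.cong refl)
      fix i j
      show "b i * cnj (b j) * (\<integral>z. of_real (k z) * z ^ i * cnj z ^ j \<partial>gauss) = (if j = i then of_real ((cmod (b i))\<^sup>2 * m i) else 0)"
      proof (cases "j = i")
        case True
        have "(\<integral>z. of_real (k z) * z ^ i * cnj z ^ i \<partial>gauss) = (\<integral>z. complex_of_real (k z * cmod z ^ (2 * i)) \<partial>gauss)"
          by (simp only: mult.assoc mult_cnj_power of_real_mult)
        also have "\<dots> = of_real (m i)" unfolding m_def by (rule integral_complex_of_real)
        finally show ?thesis using True by (simp add: complex_norm_square del: of_real_power)
      qed (simp add: rotation_invariant_orthogonal[OF k])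
    qed
    also have "\<dots> = of_real (\<Sum>n<N. (cmod (b n))\<^sup>2 * m n)" by simp
    finally show ?thesis by (simp only: of_real_eq_iff)
  qed
  have le: "(\<Sum>n<N. (cmod (b n))\<^sup>2 * m n) \<le> (\<Sum>n. (cmod (b n))\<^sup>2 * m n)" for N
    using summ m0 unfolding m_def[symmetric] by (intro sum_le_suminf) auto
  have nn: "(\<integral>\<^sup>+z. ennreal (k z * (cmod (g z))\<^sup>2) \<partial>gauss) \<le> ennreal (\<Sum>n. (cmod (b n))\<^sup>2 * m n)"
  proof -
    have lim: "(\<lambda>N. ennreal (k z * (cmod (S N z))\<^sup>2)) \<longlonglongrightarrow> ennreal (k z * (cmod (g z))\<^sup>2)" for z
      using sums unfolding S_def by (intro tendsto_intros) (auto simp: sums_def)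
    have "(\<integral>\<^sup>+z. ennreal (k z * (cmod (g z))\<^sup>2) \<partial>gauss) = (\<integral>\<^sup>+z. liminf (\<lambda>N. ennreal (k z * (cmod (S N z))\<^sup>2)) \<partial>gauss)"
      using lim_imp_Liminf[OF _ lim] by (intro nn_integral_cong) auto
    also have "\<dots> \<le> liminf (\<lambda>N. \<integral>\<^sup>+z. ennreal (k z * (cmod (S N z))\<^sup>2) \<partial>gauss)"
      by (rule nn_integral_liminf) measurable
    also have "\<dots> \<le> limsup (\<lambda>N. \<integral>\<^sup>+z. ennreal (k z * (cmod (S N z))\<^sup>2) \<partial>gauss)"
      by (rule Liminf_le_Limsup) simp
    also have "\<dots> \<le> ennreal (\<Sum>n. (cmod (b n))\<^sup>2 * m n)"
    proof (rule Limsup_bounded, rule always_eventually, rule allI)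
      fix N
      have "(\<integral>\<^sup>+z. ennreal (k z * (cmod (S N z))\<^sup>2) \<partial>gauss) = ennreal (\<Sum>n<N. (cmod (b n))\<^sup>2 * m n)"
        using nonneg Sint' by (subst nn_integral_eq_integral) (auto simp: Seq)
      then show "(\<integral>\<^sup>+z. ennreal (k z * (cmod (S N z))\<^sup>2) \<partial>gauss) \<le> ennreal (\<Sum>n. (cmod (b n))\<^sup>2 * m n)"
        using le by (simp add: ennreal_leI)
    qed
    finally show ?thesis .
  qed
  show int_g: "integrable gauss (\<lambda>z. k z * (cmod (g z))\<^sup>2)"
    using nonneg nn by (intro integrableI_nonneg) (auto intro: le_less_trans)
  have "ennreal (\<integral>z. k z * (cmod (g z))\<^sup>2 \<partial>gauss) \<le> ennreal (\<Sum>n. (cmod (b n))\<^sup>2 * m n)"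
    using nn nonneg by (subst (asm) nn_integral_eq_integral[OF int_g]) auto
  moreover have "0 \<le> (\<Sum>n. (cmod (b n))\<^sup>2 * m n)"
    using summ m0 unfolding m_def[symmetric] by (intro suminf_nonneg) auto
  ultimately show "(\<integral>z. k z * (cmod (g z))\<^sup>2 \<partial>gauss) \<le> (\<Sum>n. (cmod (b n))\<^sup>2 * (\<integral>z. k z * cmod z ^ (2 * n) \<partial>gauss))"
    unfolding m_def by (simp add: ennreal_le_iff)
qed

section \<open>The Fock-Sobolev norm of a power series\<close>

text \<open>This is \<open>G\<^sub>s\<close> relative to the Gaussian. At the origin the value is 0 even for \<open>s = 0\<close>, so identities for
\<open>s = 0\<close> hold almost everywhere only.\<close>

definition norm_weight :: "real \<Rightarrow> complex \<Rightarrow> real" where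
  "norm_weight s z = cmod z powr (2 * s)"

lemma norm_weight_measurable [measurable]: "norm_weight s \<in> borel_measurable borel"
  unfolding norm_weight_def by measurable

lemma norm_weight_nonneg [simp]: "norm_weight s z \<ge> 0"
  by (simp add: norm_weight_def)

lemma rotation_invariant_powr: "rotation_invariant (\<lambda>z. of_real (cmod z powr a))"
  by (rule rotation_invariant_norm[where g = "\<lambda>r. of_real (r powr a)"]) measurable

lemma rotation_invariant_norm_weight: "rotation_invariant (\<lambda>z. of_real (norm_weight s z))"
  unfolding norm_weight_def by (rule rotation_invariant_powr)

lemma powr_mult_even_power: "cmod z powr (2 * s) * cmod z ^ (2 * n) = cmod z powr (2 * (s + real n))"
proof (cases "z = 0")
  case False
  then have "cmod z ^ (2 * n) = cmod z powr (real (2 * n))"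
    by (intro powr_realpow[symmetric]) simp
  then show ?thesis
    by (simp add: powr_add[symmetric] distrib_left)
qed simp

lemma norm_weight_moment:
  assumes "s + real n > -1"
  shows "integrable gauss (\<lambda>z. norm_weight s z * cmod z ^ (2 * n))"
    and "(\<integral>z. norm_weight s z * cmod z ^ (2 * n) \<partial>gauss) = Gamma (s + real n + 1)"
  using has_bochner_integral_gauss_powr[OF assms]
  by (auto simp: norm_weight_def powr_mult_even_power has_bochner_integral_iff)

lemma gauss_even_moment:
  shows "integrable gauss (\<lambda>z. cmod z ^ (2 * n))"
    and "(\<integral>z. cmod z ^ (2 * n) \<partial>gauss) = fact n"
proof -
  have "AE z in gauss. z \<noteq> 0"
    unfolding AE_gauss_iff by (rule AE_lborel_singleton)
  then have ae: "AE z in gauss. norm_weight 0 z * cmod z ^ (2 * n) = cmod z ^ (2 * n)"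
    by eventually_elim (simp add: norm_weight_def)
  have i: "integrable gauss (\<lambda>z. norm_weight 0 z * cmod z ^ (2 * n))"
    by (rule norm_weight_moment) simp
  show "integrable gauss (\<lambda>z. cmod z ^ (2 * n))"
    by (rule integrable_cong_AE_imp[OF i _ ae]) measurable
  have "(\<integral>z. cmod z ^ (2 * n) \<partial>gauss) = (\<integral>z. norm_weight 0 z * cmod z ^ (2 * n) \<partial>gauss)"
    by (rule integral_cong_AE) (use ae in auto)
  also have "\<dots> = fact n"
    using norm_weight_moment(2)[of 0 n] Gamma_fact[of n, where 'a = real] by (simp add: add.commute)
  finally show "(\<integral>z. cmod z ^ (2 * n) \<partial>gauss) = fact n" .
qed

lemma integral_weighted_gaussian:
  fixes f :: "complex \<Rightarrow> complex"
  assumes [measurable]: "f \<in> borel_measurable borel"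
  shows "(\<integral>z. f z \<partial>weighted_gaussian s) = (\<integral>z. of_real (norm_weight s z) * f z \<partial>gauss)"
proof -
  have mf: "f \<in> borel_measurable lebesgue"
    by (rule measurable_completion) simp
  have md: "(\<lambda>z. 1 / pi * cmod z powr (2 * s) * exp (- (cmod z)\<^sup>2)) \<in> borel_measurable lebesgue"
    by (rule measurable_completion) measurable
  have "(\<integral>z. f z \<partial>weighted_gaussian s) = (\<integral>z. (1 / pi * cmod z powr (2 * s) * exp (- (cmod z)\<^sup>2)) *\<^sub>R f z \<partial>lebesgue)"
    unfolding weighted_gaussian_def by (rule integral_density[OF mf md]) auto
  also have "\<dots> = (\<integral>z. (1 / pi * cmod z powr (2 * s) * exp (- (cmod z)\<^sup>2)) *\<^sub>R f z \<partial>lborel)"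
    by (rule integral_completion) measurable
  also have "\<dots> = (\<integral>z. (1 / pi * exp (- (cmod z)\<^sup>2)) *\<^sub>R (of_real (norm_weight s z) * f z) \<partial>lborel)"
    by (intro Bochner_Integration.integral_cong refl) (simp add: norm_weight_def scaleR_conv_of_real)
  also have "\<dots> = (\<integral>z. of_real (norm_weight s z) * f z \<partial>gauss)"
    unfolding gauss_def by (subst integral_density) auto
  finally show ?thesis .
qed

lemma weighted_inner_gauss:
  assumes [measurable]: "f \<in> borel_measurable borel" "g \<in> borel_measurable borel"
  shows "weighted_inner s f g = (\<integral>z. of_real (norm_weight s z) * (f z * cnj (g z)) \<partial>gauss)"
  unfolding weighted_inner_def by (rule integral_weighted_gaussian) measurable

lemma square_integrable_gaussian_iff:
  assumes [measurable]: "f \<in> borel_measurable borel"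
  shows "f \<in> square_integrable gaussian \<longleftrightarrow> integrable gauss (\<lambda>z. (cmod (f z))\<^sup>2)"
proof -
  have mf: "f \<in> borel_measurable lebesgue"
    by (rule measurable_completion) simp
  have md: "(\<lambda>z::complex. 1 / pi * exp (- (cmod z)\<^sup>2)) \<in> borel_measurable lebesgue"
    by (rule measurable_completion) measurable
  have mg: "(\<lambda>z. (cmod (f z))\<^sup>2) \<in> borel_measurable lebesgue"
    by (rule measurable_completion) measurable
  have "f \<in> borel_measurable gaussian"
    unfolding gaussian_def using mf by simp
  moreover have "integrable gaussian (\<lambda>z. (cmod (f z))\<^sup>2) \<longleftrightarrow> integrable lebesgue (\<lambda>z. (1 / pi * exp (- (cmod z)\<^sup>2)) *\<^sub>R (cmod (f z))\<^sup>2)"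
    unfolding gaussian_def by (rule integrable_density[OF mg md]) auto
  moreover have "\<dots> \<longleftrightarrow> integrable lborel (\<lambda>z. (1 / pi * exp (- (cmod z)\<^sup>2)) *\<^sub>R (cmod (f z))\<^sup>2)"
    by (rule integrable_completion) measurable
  moreover have "\<dots> \<longleftrightarrow> integrable gauss (\<lambda>z. (cmod (f z))\<^sup>2)"
    unfolding gauss_def by (subst integrable_density) auto
  ultimately show ?thesis unfolding square_integrable_def by simp
qed

lemma Gamma_Suc_shift:
  assumes "x > (0::real)"
  shows "Gamma (x + 1) = x * Gamma x"
  using assms by (intro Gamma_plus1) (auto elim!: nonpos_Ints_cases)

text \<open>The quotient \<open>\<Gamma>(y - d) \<Gamma>(y + d) / \<Gamma>(y)\<^sup>2\<close> is multiplied by \<open>(y\<^sup>2 - d\<^sup>2) / y\<^sup>2 \<le> 1\<close> when \<open>y\<close> grows by one.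
This elementary estimate takes the place of Stirling's formula.\<close>

lemma Gamma_product_bound:
  fixes x d :: real
  assumes "0 \<le> d" "d < x"
  shows "Gamma (x + real n - d) * Gamma (x + real n + d) \<le> (Gamma (x - d) * Gamma (x + d) / (Gamma x)\<^sup>2) * (Gamma (x + real n))\<^sup>2"
proof (induction n)
  case 0
  have "Gamma x > 0" using assms by (intro Gamma_real_pos) auto
  then show ?case by simp
next
  case (Suc n)
  define y where "y = x + real n"
  have y: "y > d" "y > 0" using assms by (auto simp: y_def)
  have G: "Gamma (y - d) > 0" "Gamma (y + d) > 0" "Gamma y > 0"
    using y assms by (auto intro!: Gamma_real_pos)
  have e1: "y + 1 - d = (y - d) + 1" and e2: "y + 1 + d = (y + d) + 1" by auto
  have "Gamma (y + 1 - d) = (y - d) * Gamma (y - d)"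
    unfolding e1 using y by (intro Gamma_Suc_shift) simp
  moreover have "Gamma (y + 1 + d) = (y + d) * Gamma (y + d)"
    unfolding e2 using y assms by (intro Gamma_Suc_shift) simp
  ultimately have "Gamma (y + 1 - d) * Gamma (y + 1 + d) = ((y - d) * Gamma (y - d)) * ((y + d) * Gamma (y + d))"
    by simp
  also have "\<dots> = (y\<^sup>2 - d\<^sup>2) * (Gamma (y - d) * Gamma (y + d))"
    by (simp add: power2_eq_square algebra_simps)
  also have "\<dots> \<le> y\<^sup>2 * (Gamma (y - d) * Gamma (y + d))"
    using G by (intro mult_right_mono) auto
  also have "\<dots> \<le> y\<^sup>2 * ((Gamma (x - d) * Gamma (x + d) / (Gamma x)\<^sup>2) * (Gamma y)\<^sup>2)"
    using Suc.IH unfolding y_def by (intro mult_left_mono) auto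
  also have "\<dots> = (Gamma (x - d) * Gamma (x + d) / (Gamma x)\<^sup>2) * (Gamma (y + 1))\<^sup>2"
    using Gamma_Suc_shift[of y] y by (simp add: power_mult_distrib)
  finally show ?case by (simp add: y_def add_ac)
qed

lemma fock_Gamma_pos: "s \<ge> 0 \<Longrightarrow> Gamma (s + real n + 1) > 0"
  by (intro Gamma_real_pos) auto

lemma fock_Gamma_Suc: "s \<ge> 0 \<Longrightarrow> Gamma (s + real (Suc n) + 1) = (s + real n + 1) * Gamma (s + real n + 1)"
  using Gamma_Suc_shift[of "s + real n + 1"] by (simp add: add_ac)

lemma fock_Gamma_ge: "s \<ge> 0 \<Longrightarrow> Gamma (s + 1) * fact n \<le> Gamma (s + real n + 1)"
proof (induction n)
  case (Suc n)
  have "Gamma (s + 1) * fact (Suc n) = (real n + 1) * (Gamma (s + 1) * fact n)" by (simp add: algebra_simps)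
  also have "\<dots> \<le> (s + real n + 1) * Gamma (s + real n + 1)"
    using Suc fock_Gamma_pos[of s 0] by (intro mult_mono) auto
  finally show ?case using Suc.prems by (simp only: fock_Gamma_Suc)
qed simp

lemma fock_Gamma_le: "s \<ge> 0 \<Longrightarrow> Gamma (s + real n + 1) / fact n \<le> Gamma (s + 1) * (1 + s) ^ n"
proof (induction n)
  case (Suc n)
  have "Gamma (s + real (Suc n) + 1) / fact (Suc n) = ((s + real n + 1) / (real n + 1)) * (Gamma (s + real n + 1) / fact n)"
    using Suc.prems by (simp only: fock_Gamma_Suc) (simp add: field_simps)
  also have "\<dots> \<le> (1 + s) * (Gamma (s + 1) * (1 + s) ^ n)"
  proof (rule mult_mono)
    show "(s + real n + 1) / (real n + 1) \<le> 1 + s" using Suc.prems by (simp add: field_simps)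
    show "0 \<le> Gamma (s + real n + 1) / fact n" using fock_Gamma_pos[OF Suc.prems, of n] by simp
  qed (use Suc in auto)
  finally show ?case by (simp add: mult_ac)
qed simp

text \<open>The square of the factor \<open>(1 + |z|)^(-s)\<close> in the definition of the radial derivative \<open>R\<^sup>s\<close>.\<close>

definition fock_weight :: "real \<Rightarrow> complex \<Rightarrow> real" where
  "fock_weight s z = (1 + cmod z) powr (- (2 * s))"

lemma fock_weight_measurable [measurable]: "fock_weight s \<in> borel_measurable borel"
  unfolding fock_weight_def by measurable

lemma rotation_invariant_fock_weight: "rotation_invariant (\<lambda>z. of_real (fock_weight s z))"
  unfolding fock_weight_def
  by (rule rotation_invariant_norm[where g = "\<lambda>r. of_real ((1 + r) powr (- (2 * s)))"]) measurable

lemma fock_weight_moment: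
  assumes "s \<ge> 0"
  shows "integrable gauss (\<lambda>z. fock_weight s z * cmod z ^ (2 * n))"
    and "(\<integral>z. fock_weight s z * cmod z ^ (2 * n) \<partial>gauss) > 0"
proof -
  show int: "integrable gauss (\<lambda>z. fock_weight s z * cmod z ^ (2 * n))"
  proof (rule Bochner_Integration.integrable_bound[OF gauss_even_moment(1)])
    have "fock_weight s z \<le> 1" for z
    proof -
      have "1 + cmod z > 0" by (simp add: add_pos_nonneg)
      then show ?thesis
        using powr_mono[of "- (2 * s)" 0 "1 + cmod z"] assms by (simp add: fock_weight_def)
    qed
    then show "AE z in gauss. norm (fock_weight s z * cmod z ^ (2 * n)) \<le> norm (cmod z ^ (2 * n))"
      by (intro AE_I2) (simp add: mult_left_le_one_le fock_weight_def)
  qed measurable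
  have nn: "0 \<le> fock_weight s z * cmod z ^ (2 * n)" for z by (simp add: fock_weight_def)
  have "(\<integral>z. fock_weight s z * cmod z ^ (2 * n) \<partial>gauss) \<noteq> 0"
  proof
    assume "(\<integral>z. fock_weight s z * cmod z ^ (2 * n) \<partial>gauss) = 0"
    then have "AE z in gauss. fock_weight s z * cmod z ^ (2 * n) = 0"
      using integral_nonneg_eq_0_iff_AE[OF int] nn by simp
    moreover have "AE z in gauss. z \<noteq> 0"
      unfolding AE_gauss_iff by (rule AE_lborel_singleton)
    ultimately have "AE z in gauss. False"
    proof eventually_elim
      case (elim z)
      have "1 + cmod z \<noteq> 0" using norm_ge_zero[of z] by linarith
      then show ?case using elim by (simp add: fock_weight_def)
    qed
    then have "ae_filter gauss = bot" by (simp add: eventually_False)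
    then show False by (simp add: ae_filter_eq_bot_iff emeasure_gauss_UNIV)
  qed
  moreover have "0 \<le> (\<integral>z. fock_weight s z * cmod z ^ (2 * n) \<partial>gauss)"
    using nn by (intro integral_nonneg_AE AE_I2)
  ultimately show "(\<integral>z. fock_weight s z * cmod z ^ (2 * n) \<partial>gauss) > 0" by simp
qed

text \<open>By the Cauchy-Schwarz inequality, \<open>(n!)\<^sup>2\<close> is at most the product of the moments of \<open>(1 + |z|)^(-2 s)\<close>
and of its reciprocal, and the latter moment is of order \<open>\<Gamma>(s + n + 1)\<close>.\<close>

lemma fock_weight_moment_lower:
  assumes s: "s \<ge> 0"
  shows "\<exists>K>0. \<forall>n. Gamma (s + real n + 1)
    \<le> K * ((Gamma (s + real n + 1) / fact n)\<^sup>2 * (\<integral>z. fock_weight s z * cmod z ^ (2 * n) \<partial>gauss))"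
proof -
  define K where "K = 4 powr s * (1 / Gamma (s + 1) + 1)"
  have G0: "Gamma (s + 1) > 0" using fock_Gamma_pos[OF s, of 0] by simp
  have K: "K > 0" using G0 by (simp add: K_def add_pos_pos)
  have "Gamma (s + real n + 1)
    \<le> K * ((Gamma (s + real n + 1) / fact n)\<^sup>2 * (\<integral>z. fock_weight s z * cmod z ^ (2 * n) \<partial>gauss))" for n
  proof -
    define G where "G = Gamma (s + real n + 1)"
    define I where "I = (\<integral>z. fock_weight s z * cmod z ^ (2 * n) \<partial>gauss)"
    have G: "G > 0" using fock_Gamma_pos[OF s] by (simp add: G_def)
    \<comment> \<open>The value that balances the two terms in \<open>2 \<le> l k + 1 / (l k)\<close>.\<close>
    define l where "l = K * G / fact n"
    have l: "l > 0" using K G by (simp add: l_def)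
    have ptw: "2 * cmod z ^ (2 * n) \<le> l * (fock_weight s z * cmod z ^ (2 * n))
        + (4 powr s / l) * (cmod z ^ (2 * n) + norm_weight s z * cmod z ^ (2 * n))" for z
    proof -
      define k where "k = fock_weight s z"
      have k: "k > 0" using norm_ge_zero[of z] unfolding k_def fock_weight_def by (smt (verit) powr_gt_zero)
      have ik: "1 / k \<le> 4 powr s * (1 + norm_weight s z)"
      proof -
        have "1 / k = (1 + cmod z) powr (2 * s)"
          by (simp add: k_def fock_weight_def powr_minus_divide)
        also have "\<dots> \<le> (2 * max 1 (cmod z)) powr (2 * s)"
          using s by (intro powr_mono2) auto
        also have "\<dots> = 2 powr (2 * s) * max 1 (cmod z) powr (2 * s)"
          by (simp add: powr_mult)
        also have "2 powr (2 * s) = (4::real) powr s"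
          using powr_powr[of 2 2 s] by simp
        also have "max 1 (cmod z) powr (2 * s) \<le> 1 + norm_weight s z"
          by (auto simp: norm_weight_def max_def)
        finally show ?thesis by simp
      qed
      have "0 \<le> (l * k - 1)\<^sup>2 / (l * k)" using l k by simp
      also have "\<dots> = l * k + 1 / (l * k) - 2" using l k by (simp add: power2_eq_square field_simps)
      also have "1 / (l * k) = (1 / k) / l" by simp
      also have "\<dots> \<le> (4 powr s * (1 + norm_weight s z)) / l"
        using ik l by (intro divide_right_mono) auto
      finally have "2 \<le> l * k + 4 powr s / l * (1 + norm_weight s z)" by simp
      then have "2 * cmod z ^ (2 * n) \<le> (l * k + 4 powr s / l * (1 + norm_weight s z)) * cmod z ^ (2 * n)"
        by (intro mult_right_mono) auto
      then show ?thesis by (simp add: k_def algebra_simps add_divide_distrib)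
    qed
    have i1: "integrable gauss (\<lambda>z. norm_weight s z * cmod z ^ (2 * n))" using s by (intro norm_weight_moment) auto
    note i = gauss_even_moment(1)[of n] i1 fock_weight_moment(1)[OF s, of n]
    have "2 * fact n = (\<integral>z. 2 * cmod z ^ (2 * n) \<partial>gauss)" by (simp add: gauss_even_moment(2))
    also have "\<dots> \<le> (\<integral>z. l * (fock_weight s z * cmod z ^ (2 * n))
        + (4 powr s / l) * (cmod z ^ (2 * n) + norm_weight s z * cmod z ^ (2 * n)) \<partial>gauss)"
      by (intro integral_mono ptw Bochner_Integration.integrable_add integrable_mult_right i)
    also have "\<dots> = l * I + (4 powr s / l) * (fact n + G)"
      using s by (simp only: Bochner_Integration.integral_add Bochner_Integration.integrable_add integrable_mult_right i
         integral_mult_right_zero gauss_even_moment(2) norm_weight_moment(2) I_def G_def)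
    also have "(4 powr s / l) * (fact n + G) \<le> (4 powr s / l) * (G / Gamma (s + 1) + G)"
      using fock_Gamma_ge[OF s, of n] G0 l by (intro mult_left_mono add_right_mono) (auto simp: G_def field_simps)
    also have "\<dots> = K * G / l" by (simp add: K_def algebra_simps add_divide_distrib)
    also have "\<dots> = fact n" using K G by (simp add: l_def)
    finally have "fact n \<le> l * I" by simp
    then have "(fact n)\<^sup>2 \<le> K * G * I" by (simp add: l_def field_simps power2_eq_square)
    then have "G * (fact n)\<^sup>2 \<le> G * (K * G * I)" using G by (intro mult_left_mono) auto
    then show ?thesis
      unfolding G_def[symmetric] I_def[symmetric] by (simp add: field_simps power2_eq_square)
  qed
  then show ?thesis using K by blast
qed

text \<open>For large \<open>n\<close> the weight may be replaced by \<open>|z|^(-2 s)\<close>, whose moments are \<open>\<Gamma>(n - s + 1)\<close>.\<close>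

lemma fock_weight_moment_upper:
  assumes s: "s \<ge> 0"
  shows "\<exists>K N. \<forall>n\<ge>N. (Gamma (s + real n + 1) / fact n)\<^sup>2 * (\<integral>z. fock_weight s z * cmod z ^ (2 * n) \<partial>gauss)
    \<le> K * Gamma (s + real n + 1)"
proof -
  obtain N :: nat where N: "s < real N" using reals_Archimedean2 by blast
  define x where "x = real N + 1"
  define K where "K = Gamma (x - s) * Gamma (x + s) / (Gamma x)\<^sup>2"
  have "(Gamma (s + real n + 1) / fact n)\<^sup>2 * (\<integral>z. fock_weight s z * cmod z ^ (2 * n) \<partial>gauss)
    \<le> K * Gamma (s + real n + 1)" if "n \<ge> N" for n
  proof -
    define G where "G = Gamma (s + real n + 1)"
    have G: "G > 0" using fock_Gamma_pos[OF s] by (simp add: G_def)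
    have ns: "- s + real n > -1" using N that by (simp add: of_nat_le_iff[symmetric] del: of_nat_le_iff)
    have "(\<integral>z. fock_weight s z * cmod z ^ (2 * n) \<partial>gauss) \<le> (\<integral>z. norm_weight (- s) z * cmod z ^ (2 * n) \<partial>gauss)"
    proof (rule integral_mono_AE)
      have "AE z in gauss. z \<noteq> 0"
        unfolding AE_gauss_iff by (rule AE_lborel_singleton)
      then show "AE z in gauss. fock_weight s z * cmod z ^ (2 * n) \<le> norm_weight (- s) z * cmod z ^ (2 * n)"
      proof eventually_elim
        case (elim z)
        have "fock_weight s z \<le> norm_weight (- s) z"
          unfolding fock_weight_def norm_weight_def using s elim by (auto intro!: powr_mono2')
        then show ?case by (intro mult_right_mono) auto
      qed
    qed (use fock_weight_moment(1)[OF s] norm_weight_moment(1)[OF ns] in auto)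
    also have "\<dots> = Gamma (- s + real n + 1)" by (rule norm_weight_moment(2)[OF ns])
    finally have le: "(\<integral>z. fock_weight s z * cmod z ^ (2 * n) \<partial>gauss) \<le> Gamma (- s + real n + 1)" .
    have "Gamma (- s + real n + 1) * G \<le> K * (fact n)\<^sup>2"
    proof -
      have e: "x + real (n - N) = real n + 1" using that by (simp add: x_def of_nat_diff)
      have "s < x" using N by (simp add: x_def)
      then have "Gamma (real n + 1 - s) * Gamma (real n + 1 + s) \<le> K * (Gamma (real n + 1))\<^sup>2"
        using Gamma_product_bound[OF s, of x "n - N", unfolded e K_def[symmetric]] by blast
      moreover have "Gamma (real n + 1) = fact n" using Gamma_fact[of n, where 'a = real] by (simp add: add.commute)
      moreover have "real n + 1 - s = - s + real n + 1" "real n + 1 + s = s + real n + 1" by auto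
      ultimately show ?thesis by (simp only: G_def)
    qed
    then have *: "Gamma (- s + real n + 1) * G / (fact n)\<^sup>2 \<le> K" by (simp add: field_simps)
    have "(G / fact n)\<^sup>2 * (\<integral>z. fock_weight s z * cmod z ^ (2 * n) \<partial>gauss) \<le> (G / fact n)\<^sup>2 * Gamma (- s + real n + 1)"
      by (intro mult_left_mono le) auto
    also have "\<dots> = (Gamma (- s + real n + 1) * G / (fact n)\<^sup>2) * G"
      by (simp add: power_divide power2_eq_square)
    also have "\<dots> \<le> K * G" using * G by (intro mult_right_mono) auto
    finally show ?thesis by (simp only: G_def)
  qed
  then show ?thesis by blast
qed

lemma bessel_monomials:
  fixes k :: "complex \<Rightarrow> real"
  assumes k: "rotation_invariant (\<lambda>z. of_real (k z))" and "finite I"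
    and intm: "\<And>n. n \<in> I \<Longrightarrow> integrable gauss (\<lambda>z. (k z)\<^sup>2 * cmod z ^ (2 * n))"
    and pos: "\<And>n. n \<in> I \<Longrightarrow> (\<integral>z. (k z)\<^sup>2 * cmod z ^ (2 * n) \<partial>gauss) > 0"
    and f: "f \<in> borel_measurable borel" "integrable gauss (\<lambda>z. (cmod (f z))\<^sup>2)"
  shows "(\<Sum>n\<in>I. (cmod (\<integral>z. of_real (k z) * f z * cnj z ^ n \<partial>gauss))\<^sup>2 / (\<integral>z. (k z)\<^sup>2 * cmod z ^ (2 * n) \<partial>gauss))
    \<le> (\<integral>z. (cmod (f z))\<^sup>2 \<partial>gauss)"
proof -
  have "(\<lambda>z. Re (complex_of_real (k z))) \<in> borel_measurable borel" using k by measurable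
  then have [measurable]: "k \<in> borel_measurable borel" by simp
  define e where "e n z = of_real (k z) * z ^ n" for n z
  have e2: "(cmod (e n z))\<^sup>2 = (k z)\<^sup>2 * cmod z ^ (2 * n)" for n z
    by (simp add: e_def norm_mult norm_power power_mult_distrib power_even_eq)
  have fe: "f z * cnj (e n z) = of_real (k z) * f z * cnj z ^ n" for n z
    by (simp add: e_def)
  have "(\<Sum>n\<in>I. (cmod (\<integral>z. f z * cnj (e n z) \<partial>gauss))\<^sup>2 / (\<integral>z. (cmod (e n z))\<^sup>2 \<partial>gauss)) \<le> (\<integral>z. (cmod (f z))\<^sup>2 \<partial>gauss)"
  proof (rule bessel_inequality)
    show "e n \<in> borel_measurable gauss" for n unfolding e_def by measurable
    show "(\<integral>z. e i z * cnj (e j z) \<partial>gauss) = 0" if "i \<noteq> j" for i j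
    proof -
      have "(\<integral>z. e i z * cnj (e j z) \<partial>gauss) = (\<integral>z. (of_real (k z) * of_real (k z)) * z ^ i * cnj z ^ j \<partial>gauss)"
        by (simp add: e_def mult_ac)
      then show ?thesis
        using rotation_invariant_orthogonal[OF rotation_invariant_mult[OF k k] that] by simp
    qed
  qed (use intm pos f \<open>finite I\<close> in \<open>auto simp: e2\<close>)
  then show ?thesis by (simp only: e2 fe)
qed

lemma fock_sobolev_series_sums:
  assumes s: "s \<ge> 0" and sums: "\<And>z. (\<lambda>n. a n * z ^ n) sums (f z :: complex)"
  shows "summable (\<lambda>n. of_real (Gamma (s + real n + 1) / fact n) * a n * z ^ n)"
proof (rule summable_comparison_test)
  have "summable (\<lambda>n. cmod (a n) * ((1 + s) * cmod z) ^ n)"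
    using s by (intro entire_series_abs_summable[OF sums]) auto
  then show "summable (\<lambda>n. Gamma (s + 1) * (cmod (a n) * ((1 + s) * cmod z) ^ n))"
    by (rule summable_mult)
  have "cmod (of_real (Gamma (s + real n + 1) / fact n) * a n * z ^ n) \<le> Gamma (s + 1) * (cmod (a n) * ((1 + s) * cmod z) ^ n)" for n
  proof -
    have "cmod (of_real (Gamma (s + real n + 1) / fact n) * a n * z ^ n) = (Gamma (s + real n + 1) / fact n) * (cmod (a n) * cmod z ^ n)"
      using fock_Gamma_pos[OF s, of n] by (simp add: norm_mult norm_power norm_divide)
    also have "\<dots> \<le> (Gamma (s + 1) * (1 + s) ^ n) * (cmod (a n) * cmod z ^ n)"
      by (intro mult_right_mono fock_Gamma_le s) auto
    finally show ?thesis by (simp add: power_mult_distrib mult_ac)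
  qed
  then show "\<exists>N. \<forall>n\<ge>N. cmod (of_real (Gamma (s + real n + 1) / fact n) * a n * z ^ n) \<le> Gamma (s + 1) * (cmod (a n) * ((1 + s) * cmod z) ^ n)"
    by blast
qed

text \<open>The coefficients of \<open>R\<^sup>s f\<close> carry the factor \<open>\<Gamma>(s + n + 1) / n!\<close>, and the two preceding bounds say that
its square times the moment of the weight is of exact order \<open>\<Gamma>(s + n + 1)\<close>. So the space defined
through \<open>R\<^sup>s\<close> consists of the power series that are square integrable for \<open>G\<^sub>s\<close>.\<close>

theorem fock_sobolev_iff:
  assumes s: "s \<ge> 0" and sums: "\<And>z. (\<lambda>n. a n * z ^ n) sums (f z :: complex)"
  shows "f \<in> fock_sobolev s \<longleftrightarrow> summable (\<lambda>n. Gamma (s + real n + 1) * (cmod (a n))\<^sup>2)"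
proof -
  define b where "b n = of_real (Gamma (s + real n + 1) / fact n) * a n" for n
  define G where "G z = (\<Sum>n. b n * z ^ n)" for z
  define I where "I n = (\<integral>z. fock_weight s z * cmod z ^ (2 * n) \<partial>gauss)" for n
  have Gsums: "(\<lambda>n. b n * z ^ n) sums G z" for z
    unfolding G_def b_def using fock_sobolev_series_sums[OF s sums] by (rule summable_sums)
  have [measurable]: "G \<in> borel_measurable borel"
    using entire_series_holomorphic(1)[OF Gsums] by (rule entire_measurable)
  have R: "fock_sobolev_R s f z = of_real ((1 + cmod z) powr (- s)) * G z" for z
    by (simp add: fock_sobolev_R_def G_def b_def entire_series_holomorphic(2)[OF sums])
  then have [measurable]: "fock_sobolev_R s f \<in> borel_measurable borel"
    by (simp add: fun_eq_iff[THEN iffD2, of "fock_sobolev_R s f" "\<lambda>z. of_real ((1 + cmod z) powr (- s)) * G z"])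
  have sq: "((1 + cmod z) powr (- s))\<^sup>2 = fock_weight s z" for z
    by (simp add: fock_weight_def power2_eq_square powr_add[symmetric])
  have R2: "(cmod (fock_sobolev_R s f z))\<^sup>2 = fock_weight s z * (cmod (G z))\<^sup>2" for z
    by (simp add: R norm_mult power_mult_distrib sq)
  have b2: "(cmod (b n))\<^sup>2 * I n = ((Gamma (s + real n + 1) / fact n)\<^sup>2 * I n) * (cmod (a n))\<^sup>2" for n
    by (simp add: b_def norm_mult norm_divide power_mult_distrib power_divide)
  have I: "I n > 0" for n unfolding I_def by (rule fock_weight_moment(2)[OF s])
  have mem: "f \<in> fock_sobolev s \<longleftrightarrow> integrable gauss (\<lambda>z. fock_weight s z * (cmod (G z))\<^sup>2)"
    using entire_series_holomorphic(1)[OF sums]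
    by (simp add: fock_sobolev_def square_integrable_gaussian_iff R2)
  show ?thesis
  proof
    assume "f \<in> fock_sobolev s"
    then have int: "integrable gauss (\<lambda>z. fock_weight s z * (cmod (G z))\<^sup>2)" by (simp add: mem)
    have coeff: "(\<integral>z. of_real ((1 + cmod z) powr (- s)) * fock_sobolev_R s f z * cnj z ^ n \<partial>gauss) = b n * of_real (I n)" for n
    proof -
      have "(\<integral>z. of_real ((1 + cmod z) powr (- s)) * fock_sobolev_R s f z * cnj z ^ n \<partial>gauss)
         = (\<integral>z. of_real (fock_weight s z) * G z * cnj z ^ n \<partial>gauss)"
        by (simp add: R sq[symmetric] power2_eq_square mult_ac)
      also have "\<dots> = b n * (\<integral>z. of_real (fock_weight s z) * of_real (cmod z ^ (2 * n)) \<partial>gauss)"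
      proof (rule integral_entire_coefficient[OF rotation_invariant_fock_weight _ _ Gsums])
        show "integrable gauss (\<lambda>z. complex_of_real (fock_weight s z))"
          using integrable_of_real[OF fock_weight_moment(1)[OF s, of 0]] by simp
        show "integrable gauss (\<lambda>z. complex_of_real (fock_weight s z) * of_real (cmod z ^ (2 * n)))"
          using integrable_of_real[OF fock_weight_moment(1)[OF s, of n]] by simp
        have "integrable gauss (\<lambda>z. (of_real ((1 + cmod z) powr (- s)) * G z) * cnj (of_real ((1 + cmod z) powr (- s)) * z ^ n))"
        proof (rule integrable_mult_square_integrable)
          show "integrable gauss (\<lambda>z. (cmod (of_real ((1 + cmod z) powr (- s)) * G z))\<^sup>2)"
            using int by (simp add: R[symmetric] R2)
          show "integrable gauss (\<lambda>z. (cmod (of_real ((1 + cmod z) powr (- s)) * z ^ n))\<^sup>2)"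
            using fock_weight_moment(1)[OF s, of n]
            by (simp add: norm_mult norm_power power_mult_distrib sq power_even_eq)
        qed measurable
        then show "integrable gauss (\<lambda>z. of_real (fock_weight s z) * G z * cnj z ^ n)"
          by (simp add: sq[symmetric] power2_eq_square mult_ac)
      qed
      also have "(\<integral>z. of_real (fock_weight s z) * of_real (cmod z ^ (2 * n)) \<partial>gauss) = complex_of_real (I n)"
        unfolding I_def integral_complex_of_real[symmetric] by simp
      finally show ?thesis .
    qed
    have "summable (\<lambda>n. (cmod (b n))\<^sup>2 * I n)"
    proof (rule summableI_nonneg_bounded)
      fix N
      have "(\<Sum>n<N. (cmod (\<integral>z. of_real ((1 + cmod z) powr (- s)) * fock_sobolev_R s f z * cnj z ^ n \<partial>gauss))\<^sup>2
          / (\<integral>z. ((1 + cmod z) powr (- s))\<^sup>2 * cmod z ^ (2 * n) \<partial>gauss)) \<le> (\<integral>z. (cmod (fock_sobolev_R s f z))\<^sup>2 \<partial>gauss)"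
      proof (rule bessel_monomials)
        show "rotation_invariant (\<lambda>z. of_real ((1 + cmod z) powr (- s)))"
          by (rule rotation_invariant_norm[where g = "\<lambda>r. of_real ((1 + r) powr (- s))"]) measurable
      qed (use int fock_weight_moment[OF s] in \<open>simp_all add: sq R2\<close>)
      also have "(cmod (b n * of_real (I n)))\<^sup>2 / I n = (cmod (b n))\<^sup>2 * I n" for n
        using I[of n] by (simp add: norm_mult power_mult_distrib power2_eq_square)
      then have "(\<Sum>n<N. (cmod (\<integral>z. of_real ((1 + cmod z) powr (- s)) * fock_sobolev_R s f z * cnj z ^ n \<partial>gauss))\<^sup>2
          / (\<integral>z. ((1 + cmod z) powr (- s))\<^sup>2 * cmod z ^ (2 * n) \<partial>gauss)) = (\<Sum>n<N. (cmod (b n))\<^sup>2 * I n)"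
        by (simp only: coeff sq I_def[symmetric])
      finally show "(\<Sum>n<N. (cmod (b n))\<^sup>2 * I n) \<le> (\<integral>z. (cmod (fock_sobolev_R s f z))\<^sup>2 \<partial>gauss)" .
    qed (intro mult_nonneg_nonneg zero_le_power2 less_imp_le[OF I])
    moreover obtain K where K: "K > 0" "\<And>n. Gamma (s + real n + 1) \<le> K * ((Gamma (s + real n + 1) / fact n)\<^sup>2 * I n)"
      using fock_weight_moment_lower[OF s] unfolding I_def by blast
    ultimately have "summable (\<lambda>n. K * ((cmod (b n))\<^sup>2 * I n))" by (intro summable_mult)
    then show "summable (\<lambda>n. Gamma (s + real n + 1) * (cmod (a n))\<^sup>2)"
    proof (rule summable_comparison_test[rotated], intro exI allI impI)
      fix n
      have "Gamma (s + real n + 1) * (cmod (a n))\<^sup>2 \<le> (K * ((Gamma (s + real n + 1) / fact n)\<^sup>2 * I n)) * (cmod (a n))\<^sup>2"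
        by (intro mult_right_mono K) auto
      also have "\<dots> = K * ((cmod (b n))\<^sup>2 * I n)" unfolding b2 by (simp add: mult_ac)
      finally show "norm (Gamma (s + real n + 1) * (cmod (a n))\<^sup>2) \<le> K * ((cmod (b n))\<^sup>2 * I n)"
        using fock_Gamma_pos[OF s, of n] by simp
    qed
  next
    assume summ: "summable (\<lambda>n. Gamma (s + real n + 1) * (cmod (a n))\<^sup>2)"
    obtain K N where K: "\<And>n. n \<ge> N \<Longrightarrow> (Gamma (s + real n + 1) / fact n)\<^sup>2 * I n \<le> K * Gamma (s + real n + 1)"
      using fock_weight_moment_upper[OF s] unfolding I_def by blast
    have "summable (\<lambda>n. (cmod (b n))\<^sup>2 * I n)"
    proof (rule summable_comparison_test)
      show "summable (\<lambda>n. K * (Gamma (s + real n + 1) * (cmod (a n))\<^sup>2))" using summ by (rule summable_mult)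
      have "norm ((cmod (b n))\<^sup>2 * I n) \<le> K * (Gamma (s + real n + 1) * (cmod (a n))\<^sup>2)" if "n \<ge> N" for n
        using mult_right_mono[OF K[OF that], of "(cmod (a n))\<^sup>2"] I[of n] by (simp add: b2 mult.assoc)
      then show "\<exists>N. \<forall>n\<ge>N. norm ((cmod (b n))\<^sup>2 * I n) \<le> K * (Gamma (s + real n + 1) * (cmod (a n))\<^sup>2)" by blast
    qed
    then show "f \<in> fock_sobolev s"
      unfolding mem I_def
      by (intro entire_square_integrable(1)[OF rotation_invariant_fock_weight _ fock_weight_moment(1)[OF s] Gsums])
         (auto simp: fock_weight_def)
  qed
qed

section \<open>The Fock-Sobolev projection\<close>

lemma weighted_product_integrable:
  assumes [measurable]: "F \<in> borel_measurable borel" "G \<in> borel_measurable borel"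
    and "integrable gauss (\<lambda>z. norm_weight s z * (cmod (F z))\<^sup>2)" "integrable gauss (\<lambda>z. norm_weight s z * (cmod (G z))\<^sup>2)"
  shows "integrable gauss (\<lambda>z. of_real (norm_weight s z) * (F z * cnj (G z)))"
proof -
  have sq: "(cmod z powr s)\<^sup>2 = norm_weight s z" for z
    by (simp add: norm_weight_def power2_eq_square powr_add[symmetric])
  have "integrable gauss (\<lambda>z. (of_real (cmod z powr s) * F z) * cnj (of_real (cmod z powr s) * G z))"
    by (rule integrable_mult_square_integrable) (use assms(3,4) in \<open>simp_all add: norm_mult power_mult_distrib sq\<close>)
  moreover have "(of_real (cmod z powr s) * F z) * cnj (of_real (cmod z powr s) * G z) = of_real (norm_weight s z) * (F z * cnj (G z))" for z
    by (simp add: sq[symmetric] power2_eq_square mult_ac)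
  ultimately show ?thesis by (simp only:)
qed

text \<open>The Cauchy-Schwarz inequality in additive form, which avoids square roots.\<close>

lemma weighted_inner_bound:
  assumes [measurable]: "F \<in> borel_measurable borel" "G \<in> borel_measurable borel"
    and F: "integrable gauss (\<lambda>z. norm_weight s z * (cmod (F z))\<^sup>2)" and G: "integrable gauss (\<lambda>z. norm_weight s z * (cmod (G z))\<^sup>2)"
    and "e > 0"
  shows "cmod (\<integral>z. of_real (norm_weight s z) * (F z * cnj (G z)) \<partial>gauss)
    \<le> e * (\<integral>z. norm_weight s z * (cmod (F z))\<^sup>2 \<partial>gauss) + (\<integral>z. norm_weight s z * (cmod (G z))\<^sup>2 \<partial>gauss) / e"
proof -
  have "cmod (\<integral>z. of_real (norm_weight s z) * (F z * cnj (G z)) \<partial>gauss)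
      \<le> (\<integral>z. cmod (of_real (norm_weight s z) * (F z * cnj (G z))) \<partial>gauss)"
    by (rule integral_norm_bound)
  also have "\<dots> \<le> (\<integral>z. e * (norm_weight s z * (cmod (F z))\<^sup>2) + (norm_weight s z * (cmod (G z))\<^sup>2) / e \<partial>gauss)"
  proof (rule integral_mono)
    show "integrable gauss (\<lambda>z. cmod (of_real (norm_weight s z) * (F z * cnj (G z))))"
      by (intro integrable_norm weighted_product_integrable F G) measurable
    show "integrable gauss (\<lambda>z. e * (norm_weight s z * (cmod (F z))\<^sup>2) + (norm_weight s z * (cmod (G z))\<^sup>2) / e)"
      using F G by simp
    fix z
    define x y where "x = cmod (F z)" and "y = cmod (G z)"
    have xy: "0 \<le> x * y" by (simp add: x_def y_def)
    have "0 \<le> (e * x - y)\<^sup>2 / e" using \<open>e > 0\<close> by simp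
    also have "\<dots> = e * x\<^sup>2 + y\<^sup>2 / e - 2 * (x * y)" using \<open>e > 0\<close> by (simp add: power2_eq_square field_simps)
    finally have "x * y \<le> e * x\<^sup>2 + y\<^sup>2 / e" using xy by linarith
    then have "norm_weight s z * (x * y) \<le> norm_weight s z * (e * x\<^sup>2 + y\<^sup>2 / e)"
      by (intro mult_left_mono) auto
    then show "cmod (of_real (norm_weight s z) * (F z * cnj (G z)))
        \<le> e * (norm_weight s z * (cmod (F z))\<^sup>2) + (norm_weight s z * (cmod (G z))\<^sup>2) / e"
      by (simp add: norm_mult x_def y_def algebra_simps)
  qed
  also have "\<dots> = e * (\<integral>z. norm_weight s z * (cmod (F z))\<^sup>2 \<partial>gauss) + (\<integral>z. norm_weight s z * (cmod (G z))\<^sup>2 \<partial>gauss) / e"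
    using F G by simp
  finally show ?thesis .
qed

lemma fock_series_square_integrable:
  assumes s: "s \<ge> 0" and sums: "\<And>z. (\<lambda>n. a n * z ^ n) sums (f z :: complex)"
    and summ: "summable (\<lambda>n. Gamma (s + real n + 1) * (cmod (a n))\<^sup>2)"
  shows "integrable gauss (\<lambda>z. norm_weight s z * (cmod (f z))\<^sup>2)"
    and "(\<integral>z. norm_weight s z * (cmod (f z))\<^sup>2 \<partial>gauss) \<le> (\<Sum>n. Gamma (s + real n + 1) * (cmod (a n))\<^sup>2)"
proof -
  have m: "integrable gauss (\<lambda>z. norm_weight s z * cmod z ^ (2 * n))"
    "(\<integral>z. norm_weight s z * cmod z ^ (2 * n) \<partial>gauss) = Gamma (s + real n + 1)" for n
    using s by (auto intro!: norm_weight_moment)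
  have summ': "summable (\<lambda>n. (cmod (a n))\<^sup>2 * (\<integral>z. norm_weight s z * cmod z ^ (2 * n) \<partial>gauss))"
    using summ unfolding m(2) by (simp add: mult.commute)
  show "integrable gauss (\<lambda>z. norm_weight s z * (cmod (f z))\<^sup>2)"
    by (rule entire_square_integrable(1)[OF rotation_invariant_norm_weight norm_weight_nonneg m(1) sums summ'])
  show "(\<integral>z. norm_weight s z * (cmod (f z))\<^sup>2 \<partial>gauss) \<le> (\<Sum>n. Gamma (s + real n + 1) * (cmod (a n))\<^sup>2)"
    using entire_square_integrable(2)[OF rotation_invariant_norm_weight norm_weight_nonneg m(1) sums summ']
    unfolding m(2) by (simp add: mult.commute)
qed

lemma monomial_square_integrable:
  assumes "s \<ge> 0"
  shows "integrable gauss (\<lambda>z. norm_weight s z * (cmod (z ^ m))\<^sup>2)"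
  using norm_weight_moment(1)[of s m] assms by (simp add: norm_power power_even_eq)

lemma monomial_in_fock_sobolev:
  assumes "s \<ge> 0"
  shows "(\<lambda>z. z ^ m) \<in> fock_sobolev s"
proof -
  have "(\<lambda>n. (if n = m then 1 else 0) * z ^ n) sums (z ^ m :: complex)" for z
    using sums_single[of m "\<lambda>n. z ^ n"] by (simp add: if_distrib if_distribR cong: if_cong)
  moreover have "summable (\<lambda>n. Gamma (s + real n + 1) * (cmod (if n = m then 1 else 0))\<^sup>2)"
    by (rule summable_finite[of "{m}"]) auto
  ultimately show ?thesis
    using fock_sobolev_iff[OF assms, of "\<lambda>n. if n = m then 1 else 0" "\<lambda>z. z ^ m"] by blast
qed

lemma fock_coefficient:
  assumes s: "s \<ge> 0" and sums: "\<And>z. (\<lambda>n. a n * z ^ n) sums (f z :: complex)"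
    and int: "integrable gauss (\<lambda>z. norm_weight s z * (cmod (f z))\<^sup>2)"
  shows "(\<integral>z. of_real (norm_weight s z) * (f z * cnj (z ^ m)) \<partial>gauss) = a m * of_real (Gamma (s + real m + 1))"
proof -
  have [measurable]: "f \<in> borel_measurable borel"
    using entire_series_holomorphic(1)[OF sums] by (rule entire_measurable)
  have m: "integrable gauss (\<lambda>z. norm_weight s z * cmod z ^ (2 * n))"
    "(\<integral>z. norm_weight s z * cmod z ^ (2 * n) \<partial>gauss) = Gamma (s + real n + 1)" for n
    using s by (auto intro!: norm_weight_moment)
  have i: "integrable gauss (\<lambda>z. of_real (norm_weight s z) * (f z * cnj (z ^ m)))"
    by (intro weighted_product_integrable int monomial_square_integrable s) measurable
  have "(\<integral>z. of_real (norm_weight s z) * f z * cnj z ^ m \<partial>gauss)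
      = a m * (\<integral>z. of_real (norm_weight s z) * of_real (cmod z ^ (2 * m)) \<partial>gauss)"
  proof (rule integral_entire_coefficient[OF rotation_invariant_norm_weight _ _ sums])
    show "integrable gauss (\<lambda>z. complex_of_real (norm_weight s z))"
      using integrable_of_real[OF m(1)[of 0]] by simp
    show "integrable gauss (\<lambda>z. complex_of_real (norm_weight s z) * of_real (cmod z ^ (2 * m)))"
      using integrable_of_real[OF m(1)[of m]] by simp
    show "integrable gauss (\<lambda>z. of_real (norm_weight s z) * f z * cnj z ^ m)"
      using i by (simp add: mult.assoc)
  qed
  also have "(\<integral>z. of_real (norm_weight s z) * of_real (cmod z ^ (2 * m)) \<partial>gauss) = complex_of_real (Gamma (s + real m + 1))"
    unfolding m(2)[symmetric] integral_complex_of_real[symmetric] by simp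
  finally show ?thesis by (simp add: mult.assoc)
qed

lemma fock_series_converges:
  assumes s: "s \<ge> 0" and summ: "summable (\<lambda>n. Gamma (s + real n + 1) * (cmod (a n))\<^sup>2)"
  shows "summable (\<lambda>n. a n * z ^ n)"
proof (rule summable_comparison_test)
  have G0: "Gamma (s + 1) > 0" using fock_Gamma_pos[OF s, of 0] by simp
  have "summable (\<lambda>n. ((cmod z)\<^sup>2) ^ n /\<^sub>R fact n)" by (rule summable_exp_generic)
  then have "summable (\<lambda>n. ((cmod z)\<^sup>2) ^ n /\<^sub>R fact n / Gamma (s + 1))" by (rule summable_divide)
  then show "summable (\<lambda>n. Gamma (s + real n + 1) * (cmod (a n))\<^sup>2 + ((cmod z)\<^sup>2) ^ n /\<^sub>R fact n / Gamma (s + 1))"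
    using summ by (intro summable_add)
  have "cmod (a n * z ^ n) \<le> Gamma (s + real n + 1) * (cmod (a n))\<^sup>2 + ((cmod z)\<^sup>2) ^ n /\<^sub>R fact n / Gamma (s + 1)" for n
  proof -
    define G where "G = Gamma (s + real n + 1)"
    have G: "G > 0" using fock_Gamma_pos[OF s] by (simp add: G_def)
    define x y where "x = cmod (a n)" and "y = cmod z ^ n"
    have xy: "0 \<le> x * y" by (simp add: x_def y_def)
    have "0 \<le> (G * x - y)\<^sup>2 / G" using G by simp
    also have "\<dots> = G * x\<^sup>2 + y\<^sup>2 / G - 2 * (x * y)" using G by (simp add: power2_eq_square field_simps)
    finally have "x * y \<le> G * x\<^sup>2 + y\<^sup>2 / G" using xy by linarith
    also have "y\<^sup>2 / G \<le> y\<^sup>2 / (Gamma (s + 1) * fact n)"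
      using fock_Gamma_ge[OF s, of n] G0 by (intro divide_left_mono) (auto simp: G_def intro!: mult_pos_pos fock_Gamma_pos[OF s])
    finally show ?thesis
      by (simp add: norm_mult norm_power x_def y_def G_def power_mult[symmetric] mult.commute divide_inverse mult_ac)
  qed
  then show "\<exists>N. \<forall>n\<ge>N. cmod (a n * z ^ n) \<le> Gamma (s + real n + 1) * (cmod (a n))\<^sup>2 + ((cmod z)\<^sup>2) ^ n /\<^sub>R fact n / Gamma (s + 1)"
    by blast
qed

text \<open>The coefficient that the orthogonal projection of \<open>F\<close> must have.\<close>

definition fock_coeff :: "real \<Rightarrow> (complex \<Rightarrow> complex) \<Rightarrow> nat \<Rightarrow> complex" where
  "fock_coeff s F m = (\<integral>z. of_real (norm_weight s z) * (F z * cnj (z ^ m)) \<partial>gauss) / of_real (Gamma (s + real m + 1))"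

lemma fock_coeff_summable:
  assumes s: "s \<ge> 0" and [measurable]: "F \<in> borel_measurable borel"
    and int: "integrable gauss (\<lambda>z. norm_weight s z * (cmod (F z))\<^sup>2)"
  shows "summable (\<lambda>n. Gamma (s + real n + 1) * (cmod (fock_coeff s F n))\<^sup>2)"
proof (rule summableI_nonneg_bounded)
  fix N
  have sq: "(cmod z powr s)\<^sup>2 = norm_weight s z" for z
    by (simp add: norm_weight_def power2_eq_square powr_add[symmetric])
  have m: "integrable gauss (\<lambda>z. norm_weight s z * cmod z ^ (2 * n))"
    "(\<integral>z. norm_weight s z * cmod z ^ (2 * n) \<partial>gauss) = Gamma (s + real n + 1)" for n
    using s by (auto intro!: norm_weight_moment)
  have "(\<Sum>n<N. (cmod (\<integral>z. of_real (cmod z powr s) * (of_real (cmod z powr s) * F z) * cnj z ^ n \<partial>gauss))\<^sup>2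
      / (\<integral>z. (cmod z powr s)\<^sup>2 * cmod z ^ (2 * n) \<partial>gauss)) \<le> (\<integral>z. (cmod (of_real (cmod z powr s) * F z))\<^sup>2 \<partial>gauss)"
    by (rule bessel_monomials[OF rotation_invariant_powr])
      (use int m fock_Gamma_pos[OF s] in \<open>simp_all add: sq norm_mult power_mult_distrib\<close>)
  moreover have "(cmod (\<integral>z. of_real (cmod z powr s) * (of_real (cmod z powr s) * F z) * cnj z ^ n \<partial>gauss))\<^sup>2
      / (\<integral>z. (cmod z powr s)\<^sup>2 * cmod z ^ (2 * n) \<partial>gauss) = Gamma (s + real n + 1) * (cmod (fock_coeff s F n))\<^sup>2" for n
  proof -
    have eq: "of_real (cmod z powr s) * (of_real (cmod z powr s) * F z) * cnj z ^ n = of_real (norm_weight s z) * (F z * cnj (z ^ n))" for z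
      by (simp add: sq[symmetric] power2_eq_square mult_ac)
    show ?thesis
      unfolding eq sq m(2) fock_coeff_def
      using fock_Gamma_pos[OF s, of n] by (simp add: norm_divide power_divide power2_eq_square)
  qed
  ultimately show "(\<Sum>n<N. Gamma (s + real n + 1) * (cmod (fock_coeff s F n))\<^sup>2) \<le> (\<integral>z. (cmod (of_real (cmod z powr s) * F z))\<^sup>2 \<partial>gauss)"
    by simp
qed (intro mult_nonneg_nonneg less_imp_le[OF fock_Gamma_pos[OF s]] zero_le_power2)

text \<open>The series \<open>g\<close> with these coefficients lies in the space by Bessel's inequality. The difference \<open>F - g\<close>
is orthogonal to monomials, hence to every \<open>h\<close> in the space, because the tails of the power
series of \<open>h\<close> are small in norm. Testing with monomials gives uniqueness.\<close>

theorem fock_projection_series: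
  assumes s: "s \<ge> 0" and F [measurable]: "F \<in> borel_measurable borel"
    and int: "integrable gauss (\<lambda>z. norm_weight s z * (cmod (F z))\<^sup>2)"
  shows "(\<lambda>n. fock_coeff s F n * z ^ n) sums fock_projection s F z"
proof -
  define c where "c = fock_coeff s F"
  define g where "g z = (\<Sum>n. c n * z ^ n)" for z
  have summ: "summable (\<lambda>n. Gamma (s + real n + 1) * (cmod (c n))\<^sup>2)"
    unfolding c_def by (rule fock_coeff_summable[OF s F int])
  have gsums: "(\<lambda>n. c n * z ^ n) sums g z" for z
    unfolding g_def by (rule summable_sums[OF fock_series_converges[OF s summ]])
  have [measurable]: "g \<in> borel_measurable borel"
    using entire_series_holomorphic(1)[OF gsums] by (rule entire_measurable)
  have gfs: "g \<in> fock_sobolev s"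
    using fock_sobolev_iff[OF s gsums] summ by simp
  have gint: "integrable gauss (\<lambda>z. norm_weight s z * (cmod (g z))\<^sup>2)"
    by (rule fock_series_square_integrable(1)[OF s gsums summ])
  have hol: "h holomorphic_on UNIV" if "h \<in> fock_sobolev s" for h
    using that by (simp add: fock_sobolev_def)
  have hsums: "(\<lambda>n. fps_nth (fps_expansion h 0) n * z ^ n) sums h z" if "h \<in> fock_sobolev s" for h z
    by (rule entire_sums[OF hol[OF that]])
  have hsumm: "summable (\<lambda>n. Gamma (s + real n + 1) * (cmod (fps_nth (fps_expansion h 0) n))\<^sup>2)" if "h \<in> fock_sobolev s" for h
    using fock_sobolev_iff[OF s hsums[OF that]] that by simp
  have hint: "integrable gauss (\<lambda>z. norm_weight s z * (cmod (h z))\<^sup>2)" if "h \<in> fock_sobolev s" for h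
    by (rule fock_series_square_integrable(1)[OF s hsums[OF that] hsumm[OF that]])
  have hmeas: "h \<in> borel_measurable borel" if "h \<in> fock_sobolev s" for h
    by (rule entire_measurable[OF hol[OF that]])
  have inner_mono: "weighted_inner s (\<lambda>z. F z - h z) (\<lambda>z. z ^ m)
      = (c m - fps_nth (fps_expansion h 0) m) * of_real (Gamma (s + real m + 1))" if h: "h \<in> fock_sobolev s" for h m
  proof -
    note [measurable] = hmeas[OF h]
    have "weighted_inner s (\<lambda>z. F z - h z) (\<lambda>z. z ^ m)
      = (\<integral>z. of_real (norm_weight s z) * ((F z - h z) * cnj (z ^ m)) \<partial>gauss)"
      by (rule weighted_inner_gauss) measurable
    also have "\<dots> = (\<integral>z. of_real (norm_weight s z) * (F z * cnj (z ^ m)) - of_real (norm_weight s z) * (h z * cnj (z ^ m)) \<partial>gauss)"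
      by (simp add: algebra_simps)
    also have "\<dots> = (\<integral>z. of_real (norm_weight s z) * (F z * cnj (z ^ m)) \<partial>gauss) - (\<integral>z. of_real (norm_weight s z) * (h z * cnj (z ^ m)) \<partial>gauss)"
      by (intro Bochner_Integration.integral_diff weighted_product_integrable monomial_square_integrable s int hint[OF h]) measurable
    also have "(\<integral>z. of_real (norm_weight s z) * (F z * cnj (z ^ m)) \<partial>gauss) = c m * of_real (Gamma (s + real m + 1))"
      using fock_Gamma_pos[OF s, of m] by (simp add: c_def fock_coeff_def)
    finally show ?thesis
      by (simp only: fock_coefficient[OF s hsums[OF h] hint[OF h]] left_diff_distrib)
  qed
  have "fock_projection s F = g"
    unfolding fock_projection_def
  proof (rule the_equality)
    show "g \<in> fock_sobolev s \<and> (\<forall>h\<in>fock_sobolev s. weighted_inner s (\<lambda>z. F z - g z) h = 0)"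
    proof (intro conjI gfs ballI)
      fix h assume h: "h \<in> fock_sobolev s"
      note [measurable] = hmeas[OF h]
      define D where "D z = F z - g z" for z
      have [measurable]: "D \<in> borel_measurable borel" unfolding D_def by measurable
      define b where "b = (\<lambda>n. fps_nth (fps_expansion h 0) n)"
      have bsumm: "summable (\<lambda>n. Gamma (s + real n + 1) * (cmod (b n))\<^sup>2)"
        unfolding b_def by (rule hsumm[OF h])
      have Dint: "integrable gauss (\<lambda>z. norm_weight s z * (cmod (D z))\<^sup>2)"
      proof (rule Bochner_Integration.integrable_bound)
        show "integrable gauss (\<lambda>z. 2 * (norm_weight s z * (cmod (F z))\<^sup>2) + 2 * (norm_weight s z * (cmod (g z))\<^sup>2))"
          using int gint by simp
        show "AE z in gauss. norm (norm_weight s z * (cmod (D z))\<^sup>2) \<le> norm (2 * (norm_weight s z * (cmod (F z))\<^sup>2) + 2 * (norm_weight s z * (cmod (g z))\<^sup>2))"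
        proof (rule AE_I2)
          fix z
          have "(cmod (D z))\<^sup>2 \<le> (cmod (F z) + cmod (g z))\<^sup>2"
            unfolding D_def by (intro power_mono norm_triangle_ineq4) auto
          also have "\<dots> \<le> 2 * (cmod (F z))\<^sup>2 + 2 * (cmod (g z))\<^sup>2"
            using sum_squares_bound[of "cmod (F z)" "cmod (g z)"] by (simp add: power2_sum)
          finally have "norm_weight s z * (cmod (D z))\<^sup>2 \<le> norm_weight s z * (2 * (cmod (F z))\<^sup>2 + 2 * (cmod (g z))\<^sup>2)"
            by (intro mult_left_mono) auto
          then show "norm (norm_weight s z * (cmod (D z))\<^sup>2) \<le> norm (2 * (norm_weight s z * (cmod (F z))\<^sup>2) + 2 * (norm_weight s z * (cmod (g z))\<^sup>2))"
            by (simp add: algebra_simps)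
        qed
      qed measurable
      have Dmono: "(\<integral>z. of_real (norm_weight s z) * (D z * cnj (z ^ n)) \<partial>gauss) = 0" for n
      proof -
        have "weighted_inner s D (\<lambda>z. z ^ n) = 0"
          unfolding D_def inner_mono[OF gfs] by (simp add: entire_series_holomorphic(2)[OF gsums])
        then show ?thesis by (subst (asm) weighted_inner_gauss) measurable
      qed
      define nD where "nD = (\<integral>z. norm_weight s z * (cmod (D z))\<^sup>2 \<partial>gauss)"
      define J where "J = (\<integral>z. of_real (norm_weight s z) * (D z * cnj (h z)) \<partial>gauss)"
      have nD: "nD \<ge> 0" unfolding nD_def by (intro integral_nonneg_AE AE_I2) auto
      have bound: "cmod J \<le> e * (nD + 1)" if "e > 0" for e
      proof -
        obtain N where N: "(\<Sum>n. Gamma (s + real (n + N) + 1) * (cmod (b (n + N)))\<^sup>2) < e\<^sup>2"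
          using suminf_exist_split[OF _ bsumm, of "e\<^sup>2"] \<open>e > 0\<close>
          by (fastforce dest: abs_le_D1 simp: abs_less_iff)
        define b' where "b' n = (if n < N then 0 else b n)" for n
        define T where "T z = h z - (\<Sum>n<N. b n * z ^ n)" for z
        have [measurable]: "T \<in> borel_measurable borel" unfolding T_def by measurable
        have Tsums: "(\<lambda>n. b' n * z ^ n) sums T z" for z
        proof -
          have "(\<lambda>n. (if n \<in> {..<N} then b n * z ^ n else 0)) sums (\<Sum>n<N. b n * z ^ n)"
            by (rule sums_If_finite_set) simp
          then have "(\<lambda>n. b n * z ^ n - (if n \<in> {..<N} then b n * z ^ n else 0)) sums T z"
            unfolding T_def b_def by (intro sums_diff hsums[OF h])
          moreover have "b n * z ^ n - (if n \<in> {..<N} then b n * z ^ n else 0) = b' n * z ^ n" for n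
            by (simp add: b'_def)
          ultimately show ?thesis by simp
        qed
        have tail: "(\<lambda>n. Gamma (s + real n + 1) * (cmod (b' n))\<^sup>2) sums (\<Sum>n. Gamma (s + real (n + N) + 1) * (cmod (b (n + N)))\<^sup>2)"
        proof -
          have "(\<lambda>n. Gamma (s + real (n + N) + 1) * (cmod (b' (n + N)))\<^sup>2) sums (\<Sum>n. Gamma (s + real (n + N) + 1) * (cmod (b (n + N)))\<^sup>2)"
            using summable_sums[OF summable_ignore_initial_segment[OF bsumm, of N]] by (simp add: b'_def)
          then show ?thesis
            by (subst (asm) sums_iff_shift) (simp add: b'_def)
        qed
        have Tint: "integrable gauss (\<lambda>z. norm_weight s z * (cmod (T z))\<^sup>2)"
          by (rule fock_series_square_integrable(1)[OF s Tsums sums_summable[OF tail]])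
        have Tle: "(\<integral>z. norm_weight s z * (cmod (T z))\<^sup>2 \<partial>gauss) \<le> e\<^sup>2"
          using fock_series_square_integrable(2)[OF s Tsums sums_summable[OF tail]] N sums_unique[OF tail] by simp
        have i: "integrable gauss (\<lambda>z. of_real (norm_weight s z) * (D z * cnj (z ^ n)))" for n
          by (intro weighted_product_integrable Dint monomial_square_integrable s) measurable
        have iT: "integrable gauss (\<lambda>z. of_real (norm_weight s z) * (D z * cnj (T z)))"
          by (intro weighted_product_integrable Dint Tint) measurable
        have "J = (\<integral>z. (\<Sum>n<N. cnj (b n) * (of_real (norm_weight s z) * (D z * cnj (z ^ n)))) + of_real (norm_weight s z) * (D z * cnj (T z)) \<partial>gauss)"
          unfolding J_def T_def
          by (intro Bochner_Integration.integral_cong refl) (simp add: sum_distrib_left mult_ac right_diff_distrib)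
        also have "\<dots> = (\<integral>z. (\<Sum>n<N. cnj (b n) * (of_real (norm_weight s z) * (D z * cnj (z ^ n)))) \<partial>gauss) + (\<integral>z. of_real (norm_weight s z) * (D z * cnj (T z)) \<partial>gauss)"
          by (intro Bochner_Integration.integral_add Bochner_Integration.integrable_sum integrable_mult_right i iT)
        also have "(\<integral>z. (\<Sum>n<N. cnj (b n) * (of_real (norm_weight s z) * (D z * cnj (z ^ n)))) \<partial>gauss) = 0"
          by (subst Bochner_Integration.integral_sum, intro integrable_mult_right i) (simp only: integral_mult_right_zero Dmono, simp)
        finally have "cmod J \<le> e * nD + (\<integral>z. norm_weight s z * (cmod (T z))\<^sup>2 \<partial>gauss) / e"
          unfolding nD_def using weighted_inner_bound[OF _ _ Dint Tint \<open>e > 0\<close>] by simp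
        also have "(\<integral>z. norm_weight s z * (cmod (T z))\<^sup>2 \<partial>gauss) / e \<le> e\<^sup>2 / e"
          using Tle \<open>e > 0\<close> by (intro divide_right_mono) auto
        finally show ?thesis using \<open>e > 0\<close> by (simp add: power2_eq_square algebra_simps)
      qed
      have "cmod J \<le> 0"
      proof (rule field_le_epsilon)
        fix e :: real assume "e > 0"
        then have "cmod J \<le> e / (nD + 1) * (nD + 1)" using nD by (intro bound) auto
        then show "cmod J \<le> 0 + e" using nD by simp
      qed
      then have "J = 0" by simp
      then show "weighted_inner s (\<lambda>z. F z - g z) h = 0"
        unfolding D_def[symmetric] by (subst weighted_inner_gauss) (simp_all add: J_def)
    qed
  next
    fix h assume *: "h \<in> fock_sobolev s \<and> (\<forall>k\<in>fock_sobolev s. weighted_inner s (\<lambda>z. F z - h z) k = 0)"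
    then have h: "h \<in> fock_sobolev s" by blast
    have "c m = fps_nth (fps_expansion h 0) m" for m
      using inner_mono[OF h, of m] * monomial_in_fock_sobolev[OF s, of m] fock_Gamma_pos[OF s, of m] by simp
    then have "h z = g z" for z
      using sums_unique2[OF hsums[OF h, of z]] gsums[of z] by simp
    then show "h = g" by auto
  qed
  then show ?thesis using gsums by (simp add: c_def)
qed

section \<open>From even moments to fractional moments\<close>

text \<open>The sum of the exponential transforms at \<open>h\<close> and \<open>-h\<close>: the odd moments cancel in its power series.\<close>

definition two_sided_transform :: "'a measure \<Rightarrow> ('a \<Rightarrow> complex) \<Rightarrow> ('a \<Rightarrow> real) \<Rightarrow> complex \<Rightarrow> complex" where
  "two_sided_transform M F X h = (\<integral>x. F x * exp (h * of_real (X x)) \<partial>M) + (\<integral>x. F x * exp (h * of_real (- X x)) \<partial>M)"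

text \<open>Both transforms are holomorphic on the strip \<open>|Re h| < c\<close> and have the same power series at 0; the
imaginary axis, where they are cosine transforms, lies in the strip.\<close>

lemma even_moments_eq_imp_cos_eq:
  fixes F1 :: "'a \<Rightarrow> complex" and X1 :: "'a \<Rightarrow> real" and F2 :: "'b \<Rightarrow> complex" and X2 :: "'b \<Rightarrow> real"
  assumes m1: "F1 \<in> borel_measurable M1" "X1 \<in> borel_measurable M1"
    and m2: "F2 \<in> borel_measurable M2" "X2 \<in> borel_measurable M2"
    and int1: "integrable M1 (\<lambda>x. F1 x * exp (of_real (c * \<bar>X1 x\<bar>)))"
    and int2: "integrable M2 (\<lambda>x. F2 x * exp (of_real (c * \<bar>X2 x\<bar>)))"
    and c: "c > 0"
    and eq: "\<And>n. (\<integral>x. F1 x * of_real (X1 x) ^ (2 * n) \<partial>M1) = (\<integral>x. F2 x * of_real (X2 x) ^ (2 * n) \<partial>M2)"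
  shows "(\<integral>x. F1 x * of_real (cos (w * X1 x)) \<partial>M1) = (\<integral>x. F2 x * of_real (cos (w * X2 x)) \<partial>M2)"
proof -
  define S where "S = {h. - c < Re h \<and> Re h < c}"
  have S: "S = {h. - c < Re h} \<inter> {h. Re h < c}" by (auto simp: S_def)
  have op: "open S" and conn: "connected S"
    unfolding S by (intro open_Int open_halfspace_Re_gt open_halfspace_Re_lt
        convex_connected convex_Int convex_halfspace_Re_gt convex_halfspace_Re_lt)+
  have "\<bar>Re z\<bar> < c" if "cmod z < c" for z using that abs_Re_le_cmod[of z] by linarith
  then have sub: "ball 0 c \<subseteq> S" by (fastforce simp: abs_less_iff S_def)
  have ne: "ball (0::complex) c \<noteq> {}" and mem: "\<i> * of_real w \<in> S" using c by (auto simp: S_def)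
  have T_hol: "two_sided_transform M F X holomorphic_on S"
    if m [measurable]: "F \<in> borel_measurable M" "X \<in> borel_measurable M"
      and int: "integrable M (\<lambda>x. F x * exp (of_real (c * \<bar>X x\<bar>)))" for M :: "'x measure" and F X
  proof -
    have *: "integrable M (\<lambda>x. F x * exp (of_real (t * Y x)))"
      if t: "- c < t" "t < c" and [measurable]: "Y \<in> borel_measurable M" and Y: "\<And>x. \<bar>Y x\<bar> = \<bar>X x\<bar>" for t Y
    proof (rule Bochner_Integration.integrable_bound[OF int])
      show "AE x in M. norm (F x * exp (of_real (t * Y x))) \<le> norm (F x * exp (of_real (c * \<bar>X x\<bar>)))"
      proof (rule AE_I2)
        fix x
        have "t * Y x \<le> \<bar>t\<bar> * \<bar>X x\<bar>" using abs_ge_self[of "t * Y x"] Y[of x] by (simp add: abs_mult)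
        also have "\<dots> \<le> c * \<bar>X x\<bar>" using t by (intro mult_right_mono) auto
        finally show "norm (F x * exp (of_real (t * Y x))) \<le> norm (F x * exp (of_real (c * \<bar>X x\<bar>)))"
          by (simp add: norm_mult norm_exp_eq_Re mult_left_mono del: of_real_mult)
      qed
    qed measurable
    show ?thesis
      unfolding two_sided_transform_def S_def by (intro holomorphic_on_add holomorphic_integral_exp m * borel_measurable_uminus) auto
  qed
  have T_sums: "(\<lambda>n. h ^ n / fact n * ((1 + (-1) ^ n) * (\<integral>x. F x * of_real (X x) ^ n \<partial>M))) sums two_sided_transform M F X h"
    if m [measurable]: "F \<in> borel_measurable M" "X \<in> borel_measurable M"
      and int: "integrable M (\<lambda>x. F x * exp (of_real (c * \<bar>X x\<bar>)))" and h: "cmod h \<le> c" for M :: "'x measure" and F X h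
  proof -
    have "(\<lambda>n. h ^ n / fact n * (\<integral>x. F x * of_real (X x) ^ n \<partial>M)
            + h ^ n / fact n * (\<integral>x. F x * of_real (- X x) ^ n \<partial>M)) sums two_sided_transform M F X h"
      unfolding two_sided_transform_def
      by (intro sums_add sums_integral_exp(2)[where r = c]) (use int h in auto)
    moreover have "(\<integral>x. F x * of_real (- X x) ^ n \<partial>M) = (-1) ^ n * (\<integral>x. F x * of_real (X x) ^ n \<partial>M)" for n
    proof -
      have "(\<integral>x. F x * of_real (- X x) ^ n \<partial>M) = (\<integral>x. (-1) ^ n * (F x * of_real (X x) ^ n) \<partial>M)"
        by (intro Bochner_Integration.integral_cong refl) (subst power_minus, simp add: power_minus[of "complex_of_real _"])
      then show ?thesis by simp
    qed
    ultimately show ?thesis by (simp add: algebra_simps)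
  qed
  have small: "two_sided_transform M1 F1 X1 h = two_sided_transform M2 F2 X2 h" if "h \<in> ball 0 c" for h
  proof -
    have h: "cmod h \<le> c" using that by simp
    have eq': "(1 + (-1) ^ n) * (\<integral>x. F1 x * of_real (X1 x) ^ n \<partial>M1) = (1 + (-1) ^ n) * (\<integral>x. F2 x * of_real (X2 x) ^ n \<partial>M2)" for n
      using eq[of "n div 2"] by (cases "even n") auto
    show ?thesis
      by (rule sums_unique2[OF T_sums[OF m1 int1 h, unfolded eq'] T_sums[OF m2 int2 h]])
  qed
  have "two_sided_transform M1 F1 X1 (\<i> * of_real w) = two_sided_transform M2 F2 X2 (\<i> * of_real w)"
    by (rule analytic_continuation_open[OF open_ball op ne conn sub T_hol[OF m1 int1] T_hol[OF m2 int2] small mem])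
  moreover have conv: "two_sided_transform M F X (\<i> * of_real w) = 2 * (\<integral>x. F x * of_real (cos (w * X x)) \<partial>M)"
    if m [measurable]: "F \<in> borel_measurable M" "X \<in> borel_measurable M"
      and int: "integrable M (\<lambda>x. F x * exp (of_real (c * \<bar>X x\<bar>)))" for M :: "'x measure" and F X
  proof -
    have "integrable M F"
    proof (rule Bochner_Integration.integrable_bound[OF int])
      show "AE x in M. norm (F x) \<le> norm (F x * exp (of_real (c * \<bar>X x\<bar>)))"
        using c by (intro AE_I2) (simp add: norm_mult norm_exp_eq_Re mult_le_cancel_left1 del: of_real_mult)
    qed measurable
    then have i: "integrable M (\<lambda>x. F x * exp (\<i> * of_real w * of_real (Y x)))" if [measurable]: "Y \<in> borel_measurable M" for Y
      by (rule Bochner_Integration.integrable_bound) (measurable, simp add: norm_mult norm_exp_eq_Re)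
    have "two_sided_transform M F X (\<i> * of_real w) = (\<integral>x. F x * exp (\<i> * of_real w * of_real (X x)) + F x * exp (\<i> * of_real w * of_real (- X x)) \<partial>M)"
      unfolding two_sided_transform_def by (intro Bochner_Integration.integral_add[symmetric] i) auto
    also have "\<dots> = (\<integral>x. 2 * (F x * of_real (cos (w * X x))) \<partial>M)"
    proof (intro Bochner_Integration.integral_cong refl)
      fix x
      have "complex_of_real (cos (w * X x)) = (exp (\<i> * of_real w * of_real (X x)) + exp (\<i> * of_real w * of_real (- X x))) / 2"
        using cos_exp_eq[of "of_real (w * X x)"] unfolding cos_of_real by (simp add: mult.assoc)
      then show "F x * exp (\<i> * of_real w * of_real (X x)) + F x * exp (\<i> * of_real w * of_real (- X x)) = 2 * (F x * of_real (cos (w * X x)))"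
        by (simp only: distrib_left[symmetric]) simp
    qed
    finally show ?thesis by simp
  qed
  ultimately show ?thesis using conv[OF m1 int1] conv[OF m2 int2] by simp
qed

definition cos_kernel :: "real \<Rightarrow> real \<Rightarrow> real" where
  "cos_kernel p w = indicator {0<..} w * w powr (- 1 - p)"

lemma cos_kernel_measurable [measurable]: "cos_kernel p \<in> borel_measurable borel"
  unfolding cos_kernel_def by measurable

lemma cos_kernel_nonneg: "cos_kernel p w \<ge> 0"
  by (simp add: cos_kernel_def)

definition cos_const :: "real \<Rightarrow> real" where
  "cos_const p = (\<integral>w. (1 - cos w) * cos_kernel p w \<partial>lborel)"

lemma one_minus_cos_le: "1 - cos x \<le> x\<^sup>2 / 2" for x :: real
proof -
  have "1 - cos x = 2 * (sin (x/2))\<^sup>2"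
    using cos_double_sin[of "x/2"] by simp
  also have "(sin (x/2))\<^sup>2 \<le> (x/2)\<^sup>2"
    using abs_sin_x_le_abs_x[of "x/2"] by (simp only: abs_le_square_iff)
  finally show ?thesis by (simp add: power2_eq_square)
qed

lemma integrable_cos_kernel:
  assumes "0 < p" "p < 2"
  shows "integrable lborel (\<lambda>w. (1 - cos w) * cos_kernel p w)"
proof -
  have A: "integrable lborel (\<lambda>w::real. indicator {0..1} w * w powr (1 - p))"
  proof -
    have "(\<lambda>w. w powr (1 - p)) integrable_on {0..1}"
      using assms by (intro integrable_on_powr_from_0) auto
    then have "(\<lambda>w. w powr (1 - p)) absolutely_integrable_on {0..1}"
      by (intro nonnegative_absolutely_integrable_1) auto
    then show ?thesis
      unfolding set_integrable_def by (subst (asm) integrable_completion) auto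
  qed
  have B: "integrable lborel (\<lambda>w::real. indicator {1..} w * w powr (- 1 - p))"
  proof -
    have "(\<lambda>w. w powr (- 1 - p)) integrable_on {1..}"
      using has_integral_powr_to_inf[of "- 1 - p" 1] assms unfolding integrable_on_def by auto
    then have "(\<lambda>w. w powr (- 1 - p)) absolutely_integrable_on {1..}"
      by (intro nonnegative_absolutely_integrable_1) auto
    then show ?thesis
      unfolding set_integrable_def by (subst (asm) integrable_completion) auto
  qed
  have "integrable lborel (\<lambda>w. 1/2 * (indicator {0..1} w * w powr (1 - p)) + 2 * (indicator {1..} w * w powr (- 1 - p)))"
    by (intro Bochner_Integration.integrable_add integrable_mult_right A B)
  then show ?thesis
  proof (rule Bochner_Integration.integrable_bound)
    show "AE w in lborel. norm ((1 - cos w) * cos_kernel p w)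
        \<le> norm (1/2 * (indicator {0..1} w * w powr (1 - p)) + 2 * (indicator {1..} w * w powr (- 1 - p)))"
    proof (rule AE_I2)
      fix w :: real
      have c: "0 \<le> 1 - cos w" "1 - cos w \<le> 2" using cos_ge_minus_one[of w] by auto
      have "(1 - cos w) * cos_kernel p w \<le> 1/2 * (indicator {0..1} w * w powr (1 - p)) + 2 * (indicator {1..} w * w powr (- 1 - p))"
      proof (cases "w > 0")
        case True
        show ?thesis
        proof (cases "w < 1")
          case w1: True
          have "(1 - cos w) * w powr (- 1 - p) \<le> w\<^sup>2 / 2 * w powr (- 1 - p)"
            by (intro mult_right_mono one_minus_cos_le) auto
          also have "\<dots> = 1/2 * w powr (1 - p)"
            using True by (simp add: powr_add[symmetric] flip: powr_numeral)
          finally show ?thesis using True w1 by (simp add: cos_kernel_def)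
        next
          case w1: False
          have "(1 - cos w) * w powr (- 1 - p) \<le> 2 * w powr (- 1 - p)"
            using c by (intro mult_right_mono) auto
          moreover have "0 \<le> 1/2 * (indicator {0..1} w * w powr (1 - p))"
            by (auto split: split_indicator)
          moreover have i: "indicator {1..} w = (1::real)" "indicator {0<..} w = (1::real)" using True w1 by auto
          ultimately show ?thesis unfolding cos_kernel_def i mult_1_left by linarith
        qed
      qed (auto simp: cos_kernel_def)
      then show "norm ((1 - cos w) * cos_kernel p w)
        \<le> norm (1/2 * (indicator {0..1} w * w powr (1 - p)) + 2 * (indicator {1..} w * w powr (- 1 - p)))"
        using c cos_kernel_nonneg[of p w] by (simp add: abs_mult)
    qed
  qed measurable
qed

text \<open>Only positivity matters: it allows the constant to be cancelled.\<close>

lemma cos_const_pos: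
  assumes "0 < p" "p < 2"
  shows "cos_const p > 0"
proof -
  have nn: "0 \<le> (1 - cos w) * cos_kernel p w" for w
    by (intro mult_nonneg_nonneg cos_kernel_nonneg) auto
  have "cos_const p \<noteq> 0"
  proof
    assume "cos_const p = 0"
    then have "AE w in lborel. (1 - cos w) * cos_kernel p w = 0"
      unfolding cos_const_def using integral_nonneg_eq_0_iff_AE[OF integrable_cos_kernel[OF assms]] nn by simp
    then have "AE w in lborel. w \<notin> {1<..<2::real}"
    proof eventually_elim
      case (elim w)
      have "cos w < 1" if "1 < w" "w < 2"
        using cos_monotone_0_pi[of 0 w] that pi_gt3 by simp
      then show ?case using elim by (auto simp: cos_kernel_def)
    qed
    then have "{1<..<2::real} \<in> null_sets lborel"
      by (subst (asm) AE_iff_null_sets[symmetric]) auto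
    then show False by (auto simp: null_sets_def)
  qed
  moreover have "cos_const p \<ge> 0"
    unfolding cos_const_def using nn by (intro integral_nonneg_AE) auto
  ultimately show ?thesis by simp
qed

text \<open>Substituting \<open>w \<mapsto> x w\<close> shows that the integral of \<open>1 - cos(w x)\<close> is homogeneous of degree \<open>p\<close> in \<open>x\<close>.\<close>

lemma cos_kernel_scale:
  assumes "0 < p" "p < 2" "x \<ge> 0"
  shows "integrable lborel (\<lambda>w. (1 - cos (w * x)) * cos_kernel p w)"
    and "(\<integral>w. (1 - cos (w * x)) * cos_kernel p w \<partial>lborel) = cos_const p * x powr p"
proof -
  have *: "integrable lborel (\<lambda>w. (1 - cos (w * x)) * cos_kernel p w)
     \<and> (\<integral>w. (1 - cos (w * x)) * cos_kernel p w \<partial>lborel) = cos_const p * x powr p"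
  proof (cases "x = 0")
    case False
    then have x: "x > 0" using assms by simp
    have eq: "(1 - cos (w * x)) * cos_kernel p w = x powr (1 + p) * ((1 - cos (0 + x * w)) * cos_kernel p (0 + x * w))" for w
    proof (cases "w > 0")
      case True
      have "x powr (1 + p) * (x * w) powr (- 1 - p) = w powr (- 1 - p)"
        using x True by (simp add: powr_mult powr_add[symmetric] mult.assoc[symmetric])
      then show ?thesis using True x by (simp add: cos_kernel_def mult_ac)
    next
      case False
      then have "\<not> x * w > 0" using x by (simp add: zero_less_mult_iff)
      then show ?thesis using False by (simp add: cos_kernel_def)
    qed
    have I: "integrable lborel (\<lambda>w. (1 - cos (0 + x * w)) * cos_kernel p (0 + x * w))"
      using x lborel_integrable_real_affine[OF integrable_cos_kernel[OF assms(1,2)], of x 0] by simp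
    have "cos_const p = x * (\<integral>w. (1 - cos (0 + x * w)) * cos_kernel p (0 + x * w) \<partial>lborel)"
      unfolding cos_const_def using x by (subst lborel_integral_real_affine[of x _ 0]) auto
    then have "(\<integral>w. (1 - cos (0 + x * w)) * cos_kernel p (0 + x * w) \<partial>lborel) = cos_const p / x"
      using x by (simp add: field_simps)
    then show ?thesis
      unfolding eq using I x by (simp add: powr_add)
  qed simp
  then show "integrable lborel (\<lambda>w. (1 - cos (w * x)) * cos_kernel p w)"
    and "(\<integral>w. (1 - cos (w * x)) * cos_kernel p w \<partial>lborel) = cos_const p * x powr p" by auto
qed

lemma powr_le_one_plus_square:
  assumes "0 < p" "p < 2" "x \<ge> (0::real)"
  shows "x powr p \<le> 1 + x\<^sup>2"
proof (cases "x \<le> 1")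
  case True
  then have "x powr p \<le> 1" using assms by (simp add: powr_le1)
  then show ?thesis using zero_le_power2[of x] by linarith
next
  case False
  then have "x powr p \<le> x powr 2" using assms by (intro powr_mono) auto
  then show ?thesis using False by simp
qed

lemma (in sigma_finite_measure) integral_powr_conv_cos:
  fixes F :: "'a \<Rightarrow> complex" and X :: "'a \<Rightarrow> real"
  assumes [measurable]: "F \<in> borel_measurable M" "X \<in> borel_measurable M"
    and nonneg: "\<And>x. X x \<ge> 0" and p: "0 < p" "p < 2"
    and int: "integrable M (\<lambda>x. F x * of_real (X x powr p))" "integrable M F"
  shows "of_real (cos_const p) * (\<integral>x. F x * of_real (X x powr p) \<partial>M)
    = (\<integral>w. of_real (cos_kernel p w) * ((\<integral>x. F x \<partial>M) - (\<integral>x. F x * of_real (cos (w * X x)) \<partial>M)) \<partial>lborel)"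
proof -
  interpret pair_sigma_finite M lborel ..
  define K where "K x w = F x * of_real ((1 - cos (w * X x)) * cos_kernel p w)" for x w
  have [measurable]: "(\<lambda>(x, w). K x w) \<in> borel_measurable (M \<Otimes>\<^sub>M lborel)"
    unfolding K_def by measurable
  have cpos: "0 \<le> (1 - cos (w * y)) * cos_kernel p w" for w y
    by (intro mult_nonneg_nonneg cos_kernel_nonneg) auto
  have intK: "integrable (M \<Otimes>\<^sub>M lborel) (\<lambda>(x, w). K x w)"
  proof (rule Fubini_integrable)
    show "AE x in M. integrable lborel (\<lambda>w. (\<lambda>(x, w). K x w) (x, w))"
      unfolding K_def using cos_kernel_scale(1)[OF p nonneg] by (intro AE_I2) (simp add: integrable_mult_right del: of_real_mult)
    have "(\<integral>w. norm ((\<lambda>(x, w). K x w) (x, w)) \<partial>lborel) = cmod (F x) * (cos_const p * X x powr p)" for x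
    proof -
      have "(\<integral>w. norm ((\<lambda>(x, w). K x w) (x, w)) \<partial>lborel) = (\<integral>w. cmod (F x) * ((1 - cos (w * X x)) * cos_kernel p w) \<partial>lborel)"
        using cpos by (simp add: K_def norm_mult abs_of_nonneg del: of_real_mult)
      also have "\<dots> = cmod (F x) * (cos_const p * X x powr p)"
        by (simp add: cos_kernel_scale(2)[OF p nonneg])
      finally show ?thesis .
    qed
    moreover have "integrable M (\<lambda>x. cmod (F x) * (cos_const p * X x powr p))"
      using integrable_mult_right[OF integrable_norm[OF int(1)], of "cos_const p"] by (simp add: norm_mult mult_ac)
    ultimately show "integrable M (\<lambda>x. \<integral>w. norm ((\<lambda>(x, w). K x w) (x, w)) \<partial>lborel)" by simp
  qed measurable
  have "of_real (cos_const p) * (\<integral>x. F x * of_real (X x powr p) \<partial>M) = (\<integral>x. F x * of_real (cos_const p * X x powr p) \<partial>M)"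
    by (subst integral_mult_right_zero[symmetric]) (simp add: mult_ac)
  also have "\<dots> = (\<integral>x. (\<integral>w. K x w \<partial>lborel) \<partial>M)"
  proof (intro Bochner_Integration.integral_cong refl)
    fix x
    have "(\<integral>w. K x w \<partial>lborel) = F x * (\<integral>w. complex_of_real ((1 - cos (w * X x)) * cos_kernel p w) \<partial>lborel)"
      unfolding K_def by (rule integral_mult_right_zero)
    also have "(\<integral>w. complex_of_real ((1 - cos (w * X x)) * cos_kernel p w) \<partial>lborel) = of_real (cos_const p * X x powr p)"
      using cos_kernel_scale(2)[OF p nonneg] by (simp only: integral_complex_of_real)
    finally show "F x * of_real (cos_const p * X x powr p) = (\<integral>w. K x w \<partial>lborel)" by simp
  qed
  also have "\<dots> = (\<integral>w. (\<integral>x. K x w \<partial>M) \<partial>lborel)"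
    using Fubini_integral[OF intK] by simp
  also have "\<dots> = (\<integral>w. of_real (cos_kernel p w) * ((\<integral>x. F x \<partial>M) - (\<integral>x. F x * of_real (cos (w * X x)) \<partial>M)) \<partial>lborel)"
  proof (intro Bochner_Integration.integral_cong refl)
    fix w
    have i: "integrable M (\<lambda>x. F x * of_real (cos (w * X x)))"
      by (rule Bochner_Integration.integrable_bound[OF int(2)]) (measurable, simp add: norm_mult mult_left_le)
    have "(\<integral>x. K x w \<partial>M) = (\<integral>x. of_real (cos_kernel p w) * (F x - F x * of_real (cos (w * X x))) \<partial>M)"
      unfolding K_def by (intro Bochner_Integration.integral_cong refl) (simp add: algebra_simps)
    then show "(\<integral>x. K x w \<partial>M) = of_real (cos_kernel p w) * ((\<integral>x. F x \<partial>M) - (\<integral>x. F x * of_real (cos (w * X x)) \<partial>M))"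
      using int(2) i by simp
  qed
  finally show ?thesis .
qed

lemma integrable_powr_between_moments:
  fixes F :: "'a \<Rightarrow> complex" and X :: "'a \<Rightarrow> real"
  assumes [measurable]: "F \<in> borel_measurable M" "X \<in> borel_measurable M"
    and nonneg: "\<And>x. X x \<ge> 0" and p: "0 < p" "p < 2"
    and int: "integrable M F" "integrable M (\<lambda>x. F x * of_real (X x) ^ 2)"
  shows "integrable M (\<lambda>x. F x * of_real (X x powr p))"
proof -
  have "integrable M (\<lambda>x. norm (F x) + norm (F x * of_real (X x) ^ 2))"
    using int by (intro Bochner_Integration.integrable_add integrable_norm)
  then show ?thesis
  proof (rule Bochner_Integration.integrable_bound)
    show "AE x in M. norm (F x * of_real (X x powr p)) \<le> norm (norm (F x) + norm (F x * of_real (X x) ^ 2))"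
    proof (rule AE_I2)
      fix x
      have "cmod (F x) * X x powr p \<le> cmod (F x) * (1 + (X x)\<^sup>2)"
        by (intro mult_left_mono powr_le_one_plus_square p nonneg) auto
      then show "norm (F x * of_real (X x powr p)) \<le> norm (norm (F x) + norm (F x * of_real (X x) ^ 2))"
        by (simp add: norm_mult norm_power distrib_left)
    qed
  qed measurable
qed

text \<open>The moment of order zero gives equal integrals of \<open>1 - cos(w X)\<close>, and these are integrated against
\<open>w^(-1-p) dw\<close>. Allowing two different spaces lets a difference of two moment sequences be
treated without forming a signed measure.\<close>

lemma even_moments_eq_imp_powr_eq:
  fixes F1 :: "'a \<Rightarrow> complex" and X1 :: "'a \<Rightarrow> real" and F2 :: "'b \<Rightarrow> complex" and X2 :: "'b \<Rightarrow> real"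
  assumes "sigma_finite_measure M1" "sigma_finite_measure M2"
    and m1: "F1 \<in> borel_measurable M1" "X1 \<in> borel_measurable M1" and n1: "\<And>x. X1 x \<ge> 0"
    and m2: "F2 \<in> borel_measurable M2" "X2 \<in> borel_measurable M2" and n2: "\<And>x. X2 x \<ge> 0"
    and int1: "integrable M1 (\<lambda>x. F1 x * exp (of_real (X1 x)))"
    and int2: "integrable M2 (\<lambda>x. F2 x * exp (of_real (X2 x)))"
    and eq: "\<And>n. (\<integral>x. F1 x * of_real (X1 x) ^ (2 * n) \<partial>M1) = (\<integral>x. F2 x * of_real (X2 x) ^ (2 * n) \<partial>M2)"
    and p: "0 < p" "p < 2"
  shows "(\<integral>x. F1 x * of_real (X1 x powr p) \<partial>M1) = (\<integral>x. F2 x * of_real (X2 x powr p) \<partial>M2)"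
proof -
  have i1: "integrable M1 (\<lambda>x. F1 x * exp (of_real (1 * \<bar>X1 x\<bar>)))" using int1 n1 by simp
  have i2: "integrable M2 (\<lambda>x. F2 x * exp (of_real (1 * \<bar>X2 x\<bar>)))" using int2 n2 by simp
  have q1: "integrable M1 F1" "integrable M1 (\<lambda>x. F1 x * of_real (X1 x) ^ 2)"
    using sums_integral_exp(1)[OF m1 i1, of 0 0] sums_integral_exp(1)[OF m1 i1, of 0 2] by simp_all
  have q2: "integrable M2 F2" "integrable M2 (\<lambda>x. F2 x * of_real (X2 x) ^ 2)"
    using sums_integral_exp(1)[OF m2 i2, of 0 0] sums_integral_exp(1)[OF m2 i2, of 0 2] by simp_all
  have "of_real (cos_const p) * (\<integral>x. F1 x * of_real (X1 x powr p) \<partial>M1) = of_real (cos_const p) * (\<integral>x. F2 x * of_real (X2 x powr p) \<partial>M2)"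
    using even_moments_eq_imp_cos_eq[OF m1 m2 i1 i2 zero_less_one eq] eq[of 0]
    by (simp add: sigma_finite_measure.integral_powr_conv_cos[OF assms(1) m1 n1 p integrable_powr_between_moments[OF m1 n1 p q1] q1(1)]
       sigma_finite_measure.integral_powr_conv_cos[OF assms(2) m2 n2 p integrable_powr_between_moments[OF m2 n2 p q2] q2(1)])
  then show ?thesis using cos_const_pos[OF p] by simp
qed

lemma integral_pair_mult:
  fixes f :: "'a \<Rightarrow> complex" and g :: "'b \<Rightarrow> complex"
  assumes M: "sigma_finite_measure M" and N: "sigma_finite_measure N"
    and f: "integrable M f" and g: "integrable N g"
  shows "integrable (M \<Otimes>\<^sub>M N) (\<lambda>p. f (fst p) * g (snd p))"
    and "(\<integral>p. f (fst p) * g (snd p) \<partial>(M \<Otimes>\<^sub>M N)) = (\<integral>x. f x \<partial>M) * (\<integral>y. g y \<partial>N)"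
proof -
  interpret M: sigma_finite_measure M by fact
  interpret N: sigma_finite_measure N by fact
  interpret pair_sigma_finite M N ..
  have [measurable]: "f \<in> borel_measurable M" "g \<in> borel_measurable N" using f g by auto
  show int: "integrable (M \<Otimes>\<^sub>M N) (\<lambda>p. f (fst p) * g (snd p))"
    by (rule Fubini_integrable) (use f g in \<open>auto simp: norm_mult\<close>)
  have "(\<integral>p. f (fst p) * g (snd p) \<partial>(M \<Otimes>\<^sub>M N)) = (\<integral>x. (\<integral>y. f x * g y \<partial>N) \<partial>M)"
    using integral_fst'[OF int] by simp
  then show "(\<integral>p. f (fst p) * g (snd p) \<partial>(M \<Otimes>\<^sub>M N)) = (\<integral>x. f x \<partial>M) * (\<integral>y. g y \<partial>N)"
    by simp
qed

lemma integrable_even_moments: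
  fixes F :: "'a \<Rightarrow> complex" and X :: "'a \<Rightarrow> real"
  assumes m [measurable]: "F \<in> borel_measurable M" "X \<in> borel_measurable M"
    and int: "integrable M (\<lambda>x. F x * exp (of_real ((X x)\<^sup>2 / 2)))"
  shows "integrable M (\<lambda>x. F x * of_real (X x) ^ (2 * n))"
proof -
  have "integrable M (\<lambda>x. F x * exp (of_real (1/2 * \<bar>(X x)\<^sup>2\<bar>)))" using int by simp
  from sums_integral_exp(1)[OF _ _ this, of 0 n] show ?thesis
    by (simp add: power_mult)
qed

text \<open>The product of the moments of \<open>X\<close> and \<open>Y\<close> is the moment of \<open>X Y\<close> on the product space. Gaussian decay
in each variable is exactly enough, since \<open>X Y \<le> X\<^sup>2 / 2 + Y\<^sup>2 / 2\<close>.\<close>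

theorem moment_product_zero:
  fixes F1 :: "'a \<Rightarrow> complex" and X1 :: "'a \<Rightarrow> real" and F2 :: "'b \<Rightarrow> complex" and X2 :: "'b \<Rightarrow> real"
    and H :: "'c \<Rightarrow> complex" and Y :: "'c \<Rightarrow> real"
  assumes sf: "sigma_finite_measure M1" "sigma_finite_measure M2" "sigma_finite_measure N"
    and m1 [measurable]: "F1 \<in> borel_measurable M1" "X1 \<in> borel_measurable M1" and n1: "\<And>x. X1 x \<ge> 0"
    and m2 [measurable]: "F2 \<in> borel_measurable M2" "X2 \<in> borel_measurable M2" and n2: "\<And>x. X2 x \<ge> 0"
    and mH [measurable]: "H \<in> borel_measurable N" "Y \<in> borel_measurable N" and nY: "\<And>x. Y x \<ge> 0"
    and int1: "integrable M1 (\<lambda>x. F1 x * exp (of_real ((X1 x)\<^sup>2 / 2)))"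
    and int2: "integrable M2 (\<lambda>x. F2 x * exp (of_real ((X2 x)\<^sup>2 / 2)))"
    and intH: "integrable N (\<lambda>y. H y * exp (of_real ((Y y)\<^sup>2 / 2)))"
    and eq: "\<And>n. ((\<integral>x. F1 x * of_real (X1 x) ^ (2 * n) \<partial>M1) - (\<integral>x. F2 x * of_real (X2 x) ^ (2 * n) \<partial>M2))
        * (\<integral>y. H y * of_real (Y y) ^ (2 * n) \<partial>N) = 0"
    and p: "0 < p" "p < 2"
  shows "((\<integral>x. F1 x * of_real (X1 x powr p) \<partial>M1) - (\<integral>x. F2 x * of_real (X2 x powr p) \<partial>M2))
        * (\<integral>y. H y * of_real (Y y powr p) \<partial>N) = 0"
proof -
  have int_exp: "integrable (M \<Otimes>\<^sub>M N) (\<lambda>q. (F (fst q) * H (snd q)) * exp (of_real (X (fst q) * Y (snd q))))"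
    if s: "sigma_finite_measure M" and [measurable]: "F \<in> borel_measurable M" "X \<in> borel_measurable M"
      and i: "integrable M (\<lambda>x. F x * exp (of_real ((X x)\<^sup>2 / 2)))" for M :: "'x measure" and F X
  proof (rule Bochner_Integration.integrable_bound)
    show "integrable (M \<Otimes>\<^sub>M N) (\<lambda>q. (F (fst q) * exp (of_real ((X (fst q))\<^sup>2 / 2))) * (H (snd q) * exp (of_real ((Y (snd q))\<^sup>2 / 2))))"
      by (rule integral_pair_mult(1)[OF s sf(3) i intH])
    show "AE q in M \<Otimes>\<^sub>M N. norm ((F (fst q) * H (snd q)) * exp (of_real (X (fst q) * Y (snd q))))
      \<le> norm ((F (fst q) * exp (of_real ((X (fst q))\<^sup>2 / 2))) * (H (snd q) * exp (of_real ((Y (snd q))\<^sup>2 / 2))))"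
    proof (rule AE_I2)
      fix q
      have "X (fst q) * Y (snd q) \<le> (X (fst q))\<^sup>2 / 2 + (Y (snd q))\<^sup>2 / 2"
        using sum_squares_bound[of "X (fst q)" "Y (snd q)"] by simp
      then have "exp (X (fst q) * Y (snd q)) \<le> exp ((X (fst q))\<^sup>2 / 2) * exp ((Y (snd q))\<^sup>2 / 2)"
        by (simp add: exp_add[symmetric])
      then have "cmod (F (fst q)) * cmod (H (snd q)) * exp (X (fst q) * Y (snd q)) \<le> cmod (F (fst q)) * cmod (H (snd q)) * (exp ((X (fst q))\<^sup>2 / 2) * exp ((Y (snd q))\<^sup>2 / 2))"
        by (intro mult_left_mono) auto
      then show "norm ((F (fst q) * H (snd q)) * exp (of_real (X (fst q) * Y (snd q))))
        \<le> norm ((F (fst q) * exp (of_real ((X (fst q))\<^sup>2 / 2))) * (H (snd q) * exp (of_real ((Y (snd q))\<^sup>2 / 2))))"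
        by (simp only: norm_mult norm_exp_eq_Re Re_complex_of_real mult_ac)
    qed
  qed measurable
  have fac: "(\<integral>q. (F (fst q) * H (snd q)) * of_real (X (fst q) * Y (snd q)) ^ (2 * n) \<partial>(M \<Otimes>\<^sub>M N))
      = (\<integral>x. F x * of_real (X x) ^ (2 * n) \<partial>M) * (\<integral>y. H y * of_real (Y y) ^ (2 * n) \<partial>N)"
    and facp: "(\<integral>q. (F (fst q) * H (snd q)) * of_real ((X (fst q) * Y (snd q)) powr p) \<partial>(M \<Otimes>\<^sub>M N))
      = (\<integral>x. F x * of_real (X x powr p) \<partial>M) * (\<integral>y. H y * of_real (Y y powr p) \<partial>N)"
    if s: "sigma_finite_measure M" and m [measurable]: "F \<in> borel_measurable M" "X \<in> borel_measurable M" and nX: "\<And>x. X x \<ge> 0"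
      and i: "integrable M (\<lambda>x. F x * exp (of_real ((X x)\<^sup>2 / 2)))" for M :: "'x measure" and F X n
  proof -
    have "(\<integral>q. (F (fst q) * of_real (X (fst q)) ^ (2 * n)) * (H (snd q) * of_real (Y (snd q)) ^ (2 * n)) \<partial>(M \<Otimes>\<^sub>M N))
      = (\<integral>x. F x * of_real (X x) ^ (2 * n) \<partial>M) * (\<integral>y. H y * of_real (Y y) ^ (2 * n) \<partial>N)"
      by (rule integral_pair_mult(2)[OF s sf(3) integrable_even_moments[OF m i] integrable_even_moments[OF mH intH]])
    then show "(\<integral>q. (F (fst q) * H (snd q)) * of_real (X (fst q) * Y (snd q)) ^ (2 * n) \<partial>(M \<Otimes>\<^sub>M N))
      = (\<integral>x. F x * of_real (X x) ^ (2 * n) \<partial>M) * (\<integral>y. H y * of_real (Y y) ^ (2 * n) \<partial>N)"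
      by (simp add: power_mult_distrib mult_ac)
    have "integrable M (\<lambda>x. F x * of_real (X x powr p))"
      by (rule integrable_powr_between_moments[OF m nX p]) (use integrable_even_moments[OF m i, of 0] integrable_even_moments[OF m i, of 1] in auto)
    moreover have "integrable N (\<lambda>y. H y * of_real (Y y powr p))"
      by (rule integrable_powr_between_moments[OF mH nY p]) (use integrable_even_moments[OF mH intH, of 0] integrable_even_moments[OF mH intH, of 1] in auto)
    ultimately have "(\<integral>q. (F (fst q) * of_real (X (fst q) powr p)) * (H (snd q) * of_real (Y (snd q) powr p)) \<partial>(M \<Otimes>\<^sub>M N))
      = (\<integral>x. F x * of_real (X x powr p) \<partial>M) * (\<integral>y. H y * of_real (Y y powr p) \<partial>N)"
      by (rule integral_pair_mult(2)[OF s sf(3)])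
    then show "(\<integral>q. (F (fst q) * H (snd q)) * of_real ((X (fst q) * Y (snd q)) powr p) \<partial>(M \<Otimes>\<^sub>M N))
      = (\<integral>x. F x * of_real (X x powr p) \<partial>M) * (\<integral>y. H y * of_real (Y y powr p) \<partial>N)"
      using nX nY by (simp add: powr_mult mult_ac)
  qed
  have s1: "sigma_finite_measure (M1 \<Otimes>\<^sub>M N)" and s2: "sigma_finite_measure (M2 \<Otimes>\<^sub>M N)"
    using sf by (auto intro!: sigma_finite_pair_measure)
  have "(\<integral>q. (F1 (fst q) * H (snd q)) * of_real ((X1 (fst q) * Y (snd q)) powr p) \<partial>(M1 \<Otimes>\<^sub>M N))
     = (\<integral>q. (F2 (fst q) * H (snd q)) * of_real ((X2 (fst q) * Y (snd q)) powr p) \<partial>(M2 \<Otimes>\<^sub>M N))"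
  proof (rule even_moments_eq_imp_powr_eq[OF s1 s2])
    show "(\<integral>q. (F1 (fst q) * H (snd q)) * of_real (X1 (fst q) * Y (snd q)) ^ (2 * n) \<partial>(M1 \<Otimes>\<^sub>M N))
     = (\<integral>q. (F2 (fst q) * H (snd q)) * of_real (X2 (fst q) * Y (snd q)) ^ (2 * n) \<partial>(M2 \<Otimes>\<^sub>M N))" for n
      using eq[of n] unfolding fac[OF sf(1) m1 n1 int1] fac[OF sf(2) m2 n2 int2] by (simp add: algebra_simps)
  qed (use p n1 n2 nY int_exp[OF sf(1) m1 int1] int_exp[OF sf(2) m2 int2] in \<open>measurable, auto\<close>)
  then show ?thesis
    unfolding facp[OF sf(1) m1 n1 int1] facp[OF sf(2) m2 n2 int2] by (simp add: algebra_simps)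
qed

section \<open>The commutator on coefficients\<close>

lemma poly_bounded_square_integrable:
  assumes F: "poly_bounded F" and "a > -1"
  shows "integrable gauss (\<lambda>z. norm_weight a z * (cmod (F z))\<^sup>2)"
proof -
  have "integrable gauss (\<lambda>z. cmod (F z * cnj (F z) * of_real (cmod z powr (2 * a))))"
    using assms by (intro integrable_norm integrable_gauss_poly_bounded_powr) auto
  then show ?thesis
    by (simp add: norm_mult norm_weight_def power2_eq_square mult_ac)
qed

text \<open>Projecting a polynomially bounded function gives coefficients that decay faster than the norm of
the space requires, by any power of \<open>n\<close>. The reason is Bessel's inequality for the vectors
\<open>|z|^(s - M) z\<^sup>n\<close>, \<open>n \<ge> M\<close>, and \<open>f = |z|^(s + M) F\<close>: the inner products are unchanged, but the squared norms
\<open>\<Gamma>(s - M + n + 1)\<close> are smaller by a factor of order \<open>n\<^sup>M\<close>.\<close>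

lemma fock_coeff_summable_shifted:
  assumes s: "s \<ge> 0" and F: "poly_bounded F"
  shows "summable (\<lambda>n. Gamma (s + real M + real n + 1) * (cmod (fock_coeff s F n))\<^sup>2)"
proof -
  have [measurable]: "F \<in> borel_measurable borel" using F by measurable
  define f where "f z = of_real (cmod z powr (s + real M)) * F z" for z
  have [measurable]: "f \<in> borel_measurable borel" unfolding f_def by measurable
  define C where "C = Gamma (s + 1) * Gamma (s + 2 * real M + 1) / (Gamma (s + real M + 1))\<^sup>2"
  define t where "t n = Gamma (s + real M + real n + 1) * (cmod (fock_coeff s F n))\<^sup>2" for n
  define A where "A n = (\<integral>z. of_real (norm_weight s z) * (F z * cnj (z ^ n)) \<partial>gauss)" for n
  have sq: "(cmod z powr (s - real M))\<^sup>2 = norm_weight (s - real M) z" "(cmod z powr (s + real M))\<^sup>2 = norm_weight (s + real M) z" for z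
    by (simp_all add: norm_weight_def power2_eq_square powr_add[symmetric])
  have mom: "integrable gauss (\<lambda>z. norm_weight (s - real M) z * cmod z ^ (2 * n))"
    "(\<integral>z. norm_weight (s - real M) z * cmod z ^ (2 * n) \<partial>gauss) = Gamma (s - real M + real n + 1)"
    "Gamma (s - real M + real n + 1) > 0" if "n \<ge> M" for n
  proof -
    have *: "s - real M + real n > -1" using s that by simp
    show "integrable gauss (\<lambda>z. norm_weight (s - real M) z * cmod z ^ (2 * n))" by (rule norm_weight_moment[OF *])
    show "(\<integral>z. norm_weight (s - real M) z * cmod z ^ (2 * n) \<partial>gauss) = Gamma (s - real M + real n + 1)" by (rule norm_weight_moment[OF *])
    show "Gamma (s - real M + real n + 1) > 0" using * by (intro Gamma_real_pos) simp
  qed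
  have f2: "integrable gauss (\<lambda>z. (cmod (f z))\<^sup>2)"
    using poly_bounded_square_integrable[OF F, of "s + real M"] s
    by (simp add: f_def norm_mult power_mult_distrib sq)
  have integrand: "of_real (cmod z powr (s - real M)) * f z * cnj z ^ n = of_real (norm_weight s z) * (F z * cnj (z ^ n))" for z n
  proof -
    have "cmod z powr (s - real M) * cmod z powr (s + real M) = norm_weight s z"
      by (simp add: norm_weight_def powr_add[symmetric])
    then have "complex_of_real (cmod z powr (s - real M)) * of_real (cmod z powr (s + real M)) = of_real (norm_weight s z)"
      by (simp only: of_real_mult[symmetric])
    then show ?thesis by (simp add: f_def mult.assoc[symmetric])
  qed
  have le: "t n \<le> C * ((cmod (A n))\<^sup>2 / Gamma (s - real M + real n + 1))" if "n \<ge> M" for n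
  proof -
    define G where "G = Gamma (s + real n + 1)"
    define G' where "G' = Gamma (s - real M + real n + 1)"
    have G: "G > 0" "G' > 0" using fock_Gamma_pos[OF s] mom(3)[OF that] by (auto simp: G_def G'_def)
    have "s + real M + 1 + real (n - M) = s + real n + 1" using that by (simp add: of_nat_diff)
    then have "Gamma (s + real n + 1 - real M) * Gamma (s + real n + 1 + real M) \<le> (Gamma (s + real M + 1 - real M) * Gamma (s + real M + 1 + real M) / (Gamma (s + real M + 1))\<^sup>2) * G\<^sup>2"
      using Gamma_product_bound[of "real M" "s + real M + 1" "n - M"] s by (simp only: G_def)
    moreover have "s + real n + 1 - real M = s - real M + real n + 1" "s + real n + 1 + real M = s + real M + real n + 1"
      "s + real M + 1 - real M = s + 1" "s + real M + 1 + real M = s + 2 * real M + 1" by auto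
    ultimately have "G' * Gamma (s + real M + real n + 1) \<le> C * G\<^sup>2"
      unfolding G'_def C_def by (simp only:)
    then have "Gamma (s + real M + real n + 1) / G\<^sup>2 \<le> C / G'" using G by (simp add: field_simps)
    then have "(cmod (A n))\<^sup>2 * (Gamma (s + real M + real n + 1) / G\<^sup>2) \<le> (cmod (A n))\<^sup>2 * (C / G')"
      by (intro mult_left_mono) auto
    moreover have "(cmod (fock_coeff s F n))\<^sup>2 = (cmod (A n))\<^sup>2 / G\<^sup>2"
      using G by (simp add: fock_coeff_def A_def G_def norm_divide power_divide)
    ultimately show ?thesis by (simp add: t_def G'_def mult_ac)
  qed
  have C: "C \<ge> 0"
    unfolding C_def using s by (intro divide_nonneg_nonneg mult_nonneg_nonneg less_imp_le[OF Gamma_real_pos]) auto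
  have "summable (\<lambda>n. t (n + M))"
  proof (rule summableI_nonneg_bounded)
    show "0 \<le> t (n + M)" for n
      unfolding t_def using s by (intro mult_nonneg_nonneg less_imp_le[OF Gamma_real_pos]) auto
    fix N
    have "(\<Sum>n<N. t (n + M)) = (\<Sum>n\<in>{0+M..<N+M}. t n)"
      by (simp only: sum.shift_bounds_nat_ivl lessThan_atLeast0)
    also have "\<dots> \<le> (\<Sum>n\<in>{0+M..<N+M}. C * ((cmod (A n))\<^sup>2 / Gamma (s - real M + real n + 1)))"
      by (intro sum_mono le) auto
    also have "\<dots> = C * (\<Sum>n\<in>{0+M..<N+M}. (cmod (\<integral>z. of_real (cmod z powr (s - real M)) * f z * cnj z ^ n \<partial>gauss))\<^sup>2
        / (\<integral>z. (cmod z powr (s - real M))\<^sup>2 * cmod z ^ (2 * n) \<partial>gauss))"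
      unfolding sum_distrib_left integrand sq by (intro sum.cong) (auto simp: mom A_def)
    also have "\<dots> \<le> C * (\<integral>z. (cmod (f z))\<^sup>2 \<partial>gauss)"
    proof (intro mult_left_mono C bessel_monomials rotation_invariant_powr f2)
      show "0 < (\<integral>z. (cmod z powr (s - real M))\<^sup>2 * cmod z ^ (2 * n) \<partial>gauss)" if "n \<in> {0+M..<N+M}" for n
        using mom(2,3)[of n] that unfolding sq by simp
      show "integrable gauss (\<lambda>z. (cmod z powr (s - real M))\<^sup>2 * cmod z ^ (2 * n))" if "n \<in> {0+M..<N+M}" for n
        using mom(1)[of n] that unfolding sq by simp
    qed auto
    finally show "(\<Sum>n<N. t (n + M)) \<le> C * (\<integral>z. (cmod (f z))\<^sup>2 \<partial>gauss)" .
  qed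
  then show ?thesis unfolding t_def[symmetric] by (subst (asm) summable_iff_shift)
qed

text \<open>By the extra decay of the coefficients, \<open>T\<^sub>v z\<^sup>n\<close> multiplied by a symbol is still in the domain of the
projection. So products of Toeplitz operators are defined on polynomials.\<close>

lemma poly_bounded_times_series:
  assumes s: "s \<ge> 0" and u: "poly_bounded u"
    and sums: "\<And>z. (\<lambda>n. c n * z ^ n) sums (g z :: complex)"
    and summ: "\<And>M::nat. summable (\<lambda>n. Gamma (s + real M + real n + 1) * (cmod (c n))\<^sup>2)"
  shows "integrable gauss (\<lambda>z. norm_weight s z * (cmod (u z * g z))\<^sup>2)"
proof -
  have [measurable]: "u \<in> borel_measurable borel" using u by measurable
  have [measurable]: "g \<in> borel_measurable borel"
    using entire_series_holomorphic(1)[OF sums] by (rule entire_measurable)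
  obtain C m where C: "C \<ge> 0" "\<And>z. cmod (u z) \<le> C * (1 + cmod z) ^ m"
    using poly_boundedD[OF u] by blast
  have "integrable gauss (\<lambda>z. C\<^sup>2 * 4 ^ m * (norm_weight s z * (cmod (g z))\<^sup>2 + norm_weight (s + real m) z * (cmod (g z))\<^sup>2))"
    using s summ[of 0] summ[of m]
    by (intro integrable_mult_right Bochner_Integration.integrable_add fock_series_square_integrable(1)[OF _ sums]) auto
  then show ?thesis
  proof (rule Bochner_Integration.integrable_bound)
    show "AE z in gauss. norm (norm_weight s z * (cmod (u z * g z))\<^sup>2)
      \<le> norm (C\<^sup>2 * 4 ^ m * (norm_weight s z * (cmod (g z))\<^sup>2 + norm_weight (s + real m) z * (cmod (g z))\<^sup>2))"
    proof (rule AE_I2)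
      fix z
      have "(cmod (u z))\<^sup>2 \<le> (C * (1 + cmod z) ^ m)\<^sup>2" by (intro power_mono C) auto
      also have "\<dots> = C\<^sup>2 * ((1 + cmod z)\<^sup>2) ^ m" by (simp add: power_mult_distrib power_mult[symmetric] mult.commute)
      also have "\<dots> \<le> C\<^sup>2 * (4 ^ m * (1 + cmod z ^ (2 * m)))"
      proof (intro mult_left_mono)
        have "((1 + cmod z)\<^sup>2) ^ m \<le> (4 * (max 1 (cmod z))\<^sup>2) ^ m"
          using power_mono[of "1 + cmod z" "2 * max 1 (cmod z)" 2]
          by (intro power_mono) (auto simp: power_mult_distrib)
        also have "\<dots> = 4 ^ m * max 1 (cmod z) ^ (2 * m)" by (simp add: power_mult_distrib power_mult)
        also have "\<dots> \<le> 4 ^ m * (1 + cmod z ^ (2 * m))"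
          by (intro mult_left_mono) (auto simp: max_def)
        finally show "((1 + cmod z)\<^sup>2) ^ m \<le> 4 ^ m * (1 + cmod z ^ (2 * m))" .
      qed auto
      finally have "(cmod (u z))\<^sup>2 * (norm_weight s z * (cmod (g z))\<^sup>2)
          \<le> (C\<^sup>2 * (4 ^ m * (1 + cmod z ^ (2 * m)))) * (norm_weight s z * (cmod (g z))\<^sup>2)"
        by (intro mult_right_mono) auto
      also have "\<dots> = C\<^sup>2 * 4 ^ m * (norm_weight s z * (cmod (g z))\<^sup>2 + (norm_weight s z * cmod z ^ (2 * m)) * (cmod (g z))\<^sup>2)"
        by (simp add: algebra_simps)
      also have "norm_weight s z * cmod z ^ (2 * m) = norm_weight (s + real m) z"
        by (simp add: norm_weight_def powr_mult_even_power)
      finally show "norm (norm_weight s z * (cmod (u z * g z))\<^sup>2)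
        \<le> norm (C\<^sup>2 * 4 ^ m * (norm_weight s z * (cmod (g z))\<^sup>2 + norm_weight (s + real m) z * (cmod (g z))\<^sup>2))"
        by (simp add: norm_mult power_mult_distrib mult_ac)
    qed
  qed measurable
qed

text \<open>\<open>T\<^sub>u\<close> multiplies the coefficient of index \<open>k\<close> by \<open>\<omega>(k)\<close>, on polynomials as well as on the series
\<open>T\<^sub>v z\<^sup>n\<close>. The two orders of composition give the factors \<open>\<omega>(m)\<close> and \<open>\<omega>(n)\<close>.\<close>

theorem toeplitz_commutator_coefficients:
  assumes s: "s \<ge> 0" and u: "poly_bounded u" and v: "poly_bounded v" and rot: "rotation_invariant u"
    and comm: "toeplitz_commutator s u v (\<lambda>z. z ^ n) = (\<lambda>z. 0)"
  shows "(fock_coeff s (\<lambda>z. u z * z ^ m) m - fock_coeff s (\<lambda>z. u z * z ^ n) n) * fock_coeff s (\<lambda>z. v z * z ^ n) m = 0"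
proof -
  have [measurable]: "u \<in> borel_measurable borel" "v \<in> borel_measurable borel" using u v by measurable
  define w where "w k = fock_coeff s (\<lambda>z. u z * z ^ k) k" for k
  define c where "c = fock_coeff s (\<lambda>z. v z * z ^ n)"
  define g where "g = toeplitz s v (\<lambda>z. z ^ n)"
  have pb: "poly_bounded (\<lambda>z. v z * z ^ n)" "poly_bounded (\<lambda>z. u z * z ^ n)" using u v by auto
  have gsums: "(\<lambda>k. c k * z ^ k) sums g z" for z
    unfolding c_def g_def toeplitz_def
    by (rule fock_projection_series[OF s]) (use s pb in \<open>auto intro!: poly_bounded_square_integrable\<close>)
  have [measurable]: "g \<in> borel_measurable borel"
    using entire_series_holomorphic(1)[OF gsums] by (rule entire_measurable)
  have ugint: "integrable gauss (\<lambda>z. norm_weight s z * (cmod (u z * g z))\<^sup>2)"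
    by (rule poly_bounded_times_series[OF s u gsums]) (simp add: c_def fock_coeff_summable_shifted[OF s pb(1)])
  have kappa: "rotation_invariant (\<lambda>z. of_real (norm_weight s z) * u z)"
    by (intro rotation_invariant_mult rotation_invariant_norm_weight rot)
  have kappa_int: "integrable gauss (\<lambda>z. of_real (norm_weight s z) * u z * of_real (cmod z ^ (2 * k)))" for k
  proof -
    have "integrable gauss (\<lambda>z. u z * of_real (cmod z powr (2 * (s + real k))))"
      by (rule integrable_gauss_poly_bounded_powr[OF u]) (use s in simp)
    moreover have "of_real (norm_weight s z) * u z * of_real (cmod z ^ (2 * k)) = u z * of_real (cmod z powr (2 * (s + real k)))" for z
      unfolding powr_mult_even_power[symmetric] norm_weight_def by (simp add: mult_ac)
    ultimately show ?thesis by (simp only:)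
  qed
  have diag: "(\<integral>z. of_real (norm_weight s z) * u z * of_real (cmod z ^ (2 * k)) \<partial>gauss) = w k * of_real (Gamma (s + real k + 1))" for k
  proof -
    have "(\<integral>z. of_real (norm_weight s z) * u z * of_real (cmod z ^ (2 * k)) \<partial>gauss) = (\<integral>z. of_real (norm_weight s z) * (u z * z ^ k * cnj (z ^ k)) \<partial>gauss)"
      unfolding mult_cnj_power[symmetric] by (simp add: mult_ac)
    then show ?thesis
      using fock_Gamma_pos[OF s, of k] by (simp add: w_def fock_coeff_def)
  qed
  have coeff_ug: "fock_coeff s (\<lambda>z. u z * g z) k = w k * c k" for k
  proof -
    have "integrable gauss (\<lambda>z. of_real (norm_weight s z) * ((u z * g z) * cnj (z ^ k)))"
      by (intro weighted_product_integrable ugint monomial_square_integrable s) measurable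
    then have i: "integrable gauss (\<lambda>z. of_real (norm_weight s z) * u z * g z * cnj z ^ k)"
      by (simp add: mult.assoc)
    have "(\<integral>z. of_real (norm_weight s z) * ((u z * g z) * cnj (z ^ k)) \<partial>gauss) = (\<integral>z. of_real (norm_weight s z) * u z * g z * cnj z ^ k \<partial>gauss)"
      by (simp add: mult.assoc)
    also have "\<dots> = c k * (\<integral>z. of_real (norm_weight s z) * u z * of_real (cmod z ^ (2 * k)) \<partial>gauss)"
      by (rule integral_entire_coefficient[OF kappa _ kappa_int gsums i]) (use kappa_int[of 0] in simp)
    also have "(\<integral>z. of_real (norm_weight s z) * u z * of_real (cmod z ^ (2 * k)) \<partial>gauss) = w k * of_real (Gamma (s + real k + 1))"
      by (rule diag)
    finally show ?thesis
      using fock_Gamma_pos[OF s, of k] by (simp add: fock_coeff_def)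
  qed
  have Tug: "(\<lambda>k. (w k * c k) * z ^ k) sums toeplitz s u g z" for z
    unfolding toeplitz_def coeff_ug[symmetric]
    by (rule fock_projection_series[OF s]) (use ugint in auto)
  have Tu: "toeplitz s u (\<lambda>z. z ^ n) = (\<lambda>z. w n * z ^ n)"
  proof
    fix z
    have "(\<lambda>k. fock_coeff s (\<lambda>z. u z * z ^ n) k * z ^ k) sums toeplitz s u (\<lambda>z. z ^ n) z"
      unfolding toeplitz_def
      by (rule fock_projection_series[OF s]) (use s pb in \<open>auto intro!: poly_bounded_square_integrable\<close>)
    moreover have "fock_coeff s (\<lambda>z. u z * z ^ n) k = (if k = n then w n else 0)" for k
    proof (cases "k = n")
      case False
      then have "(\<integral>z. of_real (norm_weight s z) * u z * z ^ n * cnj z ^ k \<partial>gauss) = 0"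
        by (intro rotation_invariant_orthogonal[OF kappa]) auto
      then show ?thesis using False by (simp add: fock_coeff_def mult.assoc)
    qed (simp add: w_def)
    ultimately have "(\<lambda>k. if k = n then w n * z ^ n else 0) sums toeplitz s u (\<lambda>z. z ^ n) z"
      by (simp add: if_distribR if_distrib cong: if_cong)
    then show "toeplitz s u (\<lambda>z. z ^ n) z = w n * z ^ n"
      using sums_single[of n "\<lambda>_. w n * z ^ n"] sums_unique2 by blast
  qed
  have Tvu: "(\<lambda>k. (w n * c k) * z ^ k) sums toeplitz s v (toeplitz s u (\<lambda>z. z ^ n)) z" for z
  proof -
    have "fock_coeff s (\<lambda>z. v z * (w n * z ^ n)) k = w n * c k" for k
    proof -
      have "(\<integral>z. of_real (norm_weight s z) * ((v z * (w n * z ^ n)) * cnj (z ^ k)) \<partial>gauss)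
        = (\<integral>z. w n * (of_real (norm_weight s z) * (v z * z ^ n * cnj (z ^ k))) \<partial>gauss)"
        by (simp add: mult_ac)
      then show ?thesis by (simp add: fock_coeff_def c_def)
    qed
    moreover have "(\<lambda>k. fock_coeff s (\<lambda>z. v z * (w n * z ^ n)) k * z ^ k) sums toeplitz s v (\<lambda>z. w n * z ^ n) z"
      unfolding toeplitz_def
      by (rule fock_projection_series[OF s]) (use s v in \<open>auto intro!: poly_bounded_square_integrable\<close>)
    ultimately show ?thesis by (simp add: Tu)
  qed
  have "toeplitz s u g z = toeplitz s v (toeplitz s u (\<lambda>z. z ^ n)) z" for z
    using fun_cong[OF comm, of z] by (simp add: toeplitz_commutator_def g_def)
  then have "toeplitz s u g = toeplitz s v (toeplitz s u (\<lambda>z. z ^ n))" by auto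
  then have "w m * c m = w n * c m"
    using entire_series_holomorphic(2)[OF Tug, of m] entire_series_holomorphic(2)[OF Tvu, of m] by auto
  then show ?thesis by (simp add: w_def c_def algebra_simps)
qed

section \<open>Mellin transforms\<close>

text \<open>The power \<open>|z|^(2 y)\<close> is written as an exponential of \<open>2 ln |z|\<close>, so that the lemmas on exponential
transforms apply; the origin, where \<open>ln\<close> has a default value, is a null set.\<close>

definition mellin :: "(complex \<Rightarrow> complex) \<Rightarrow> complex \<Rightarrow> complex" where
  "mellin f y = (\<integral>z. f z * exp (y * of_real (2 * ln (cmod z))) \<partial>gauss)"

lemma exp_ln_norm_weight: "z \<noteq> 0 \<Longrightarrow> exp (complex_of_real (a * (2 * ln (cmod z)))) = of_real (norm_weight a z)"
  by (simp add: norm_weight_def powr_def exp_of_real[symmetric] mult_ac)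

lemma AE_gauss_nonzero: "AE z in gauss. z \<noteq> 0"
  unfolding AE_gauss_iff by (rule AE_lborel_singleton)

lemma integrable_norm_weight:
  assumes "poly_bounded f" "a > -1"
  shows "integrable gauss (\<lambda>z. f z * of_real (norm_weight a z))"
  unfolding norm_weight_def by (rule integrable_gauss_poly_bounded_powr[OF assms])

lemma mellin_of_real:
  assumes "poly_bounded f"
  shows "mellin f (of_real a) = (\<integral>z. f z * of_real (norm_weight a z) \<partial>gauss)"
proof -
  have [measurable]: "f \<in> borel_measurable borel" using assms by measurable
  show ?thesis
    unfolding mellin_def
  proof (rule integral_cong_AE)
    show "AE z in gauss. f z * exp (of_real a * of_real (2 * ln (cmod z))) = f z * of_real (norm_weight a z)"
      using AE_gauss_nonzero
    proof eventually_elim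
      case (elim z)
      show ?case using exp_ln_norm_weight[OF elim, of a] by simp
    qed
  qed measurable
qed

lemma mellin_holomorphic:
  assumes f: "poly_bounded f"
  shows "mellin f holomorphic_on {y. Re y > -1}"
proof -
  have [measurable]: "f \<in> borel_measurable borel" using f by measurable
  have "\<exists>f'. (mellin f has_field_derivative f') (at y)" if y: "Re y > -1" for y
  proof -
    let ?S = "{h. -1 < Re h \<and> Re h < Re y + 1}"
    have hol: "mellin f holomorphic_on ?S"
      unfolding mellin_def
    proof (rule holomorphic_integral_exp)
      fix t :: real assume "-1 < t"
      show "integrable gauss (\<lambda>z. f z * exp (of_real (t * (2 * ln (cmod z)))))"
      proof (rule integrable_cong_AE_imp)
        show "integrable gauss (\<lambda>z. f z * of_real (norm_weight t z))"
          by (rule integrable_norm_weight[OF f \<open>-1 < t\<close>])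
        show "AE z in gauss. f z * of_real (norm_weight t z) = f z * exp (of_real (t * (2 * ln (cmod z))))"
          using AE_gauss_nonzero
        proof eventually_elim
          case (elim z)
          show ?case using exp_ln_norm_weight[OF elim, of t] by simp
        qed
      qed measurable
    qed measurable
    have "?S = {h. -1 < Re h} \<inter> {h. Re h < Re y + 1}" by auto
    then have "open ?S" by (simp only: open_Int open_halfspace_Re_gt open_halfspace_Re_lt)
    then show ?thesis using hol y by (auto simp: holomorphic_on_open)
  qed
  moreover have "open {y. Re y > -1}" by (rule open_halfspace_Re_gt)
  ultimately show ?thesis by (auto simp: holomorphic_on_open)
qed

text \<open>For \<open>y > -1\<close>, the integral of \<open>r\<^sup>y (1 - r)^(k - 1) / (k - 1)!\<close> over the unit interval is
\<open>1 / ((y + 1)\<cdots>(y + k))\<close>. Thus the division by this product in \<open>\<omega>(n + k)\<close> is an integration over one more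
variable.\<close>

definition beta_density :: "real \<Rightarrow> nat \<Rightarrow> real \<Rightarrow> real" where
  "beta_density s k r = indicator {0<..<1} r * (r powr s * (1 - r) ^ (k - 1) / fact (k - 1))"

lemma beta_density_measurable [measurable]: "beta_density s k \<in> borel_measurable borel"
  unfolding beta_density_def by measurable

lemma beta_density_moment:
  assumes "s \<ge> 0" "a \<ge> 0" "k \<ge> 1"
  shows "integrable lborel (\<lambda>r. beta_density s k r * \<bar>r\<bar> powr a)"
    and "(\<integral>r. beta_density s k r * \<bar>r\<bar> powr a \<partial>lborel) = 1 / pochhammer (s + a + 1) k"
proof -
  have k: "real k > 0" using assms by simp
  have eq: "beta_density s k r * \<bar>r\<bar> powr a = 1 / fact (k - 1) * (indicator {0<..<1} r *\<^sub>R (r powr (s + a + 1 - 1) * (1 - r) powr (real k - 1)))" for r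
  proof (cases "r \<in> {0<..<1}")
    case True
    then have "(1 - r) ^ (k - 1) = (1 - r) powr (real k - 1)"
      using assms by (subst powr_realpow[symmetric]) (auto simp: of_nat_diff)
    then show ?thesis using True by (simp add: beta_density_def powr_add)
  qed (simp add: beta_density_def)
  have B: "((\<lambda>t. t powr (s + a + 1 - 1) * (1 - t) powr (real k - 1)) has_integral Beta (s + a + 1) (real k)) {0<..<1}"
    using has_integral_Beta_real[of "s + a + 1" "real k"] assms k by (simp add: has_integral_Icc_iff_Ioo)
  then have "(\<lambda>t. t powr (s + a + 1 - 1) * (1 - t) powr (real k - 1)) absolutely_integrable_on {0<..<1}"
    by (intro nonnegative_absolutely_integrable_1) (auto simp: integrable_on_def)
  then have i: "set_integrable lebesgue {0<..<1} (\<lambda>t. t powr (s + a + 1 - 1) * (1 - t) powr (real k - 1))" .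
  then have i': "integrable lborel (\<lambda>r. indicator {0<..<1} r *\<^sub>R (r powr (s + a + 1 - 1) * (1 - r) powr (real k - 1)))"
    unfolding set_integrable_def by (subst (asm) integrable_completion) measurable
  then show "integrable lborel (\<lambda>r. beta_density s k r * \<bar>r\<bar> powr a)"
    unfolding eq by (rule integrable_mult_right)
  have "(\<integral>r. indicator {0<..<1} r *\<^sub>R (r powr (s + a + 1 - 1) * (1 - r) powr (real k - 1)) \<partial>lborel)
      = (LINT r:{0<..<1}|lebesgue. r powr (s + a + 1 - 1) * (1 - r) powr (real k - 1))"
    unfolding set_lebesgue_integral_def by (rule integral_completion[symmetric]) measurable
  also have "\<dots> = Beta (s + a + 1) (real k)"
    using set_lebesgue_integral_eq_integral(2)[OF i] integral_unique[OF B] by simp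
  also have "\<dots> = fact (k - 1) / pochhammer (s + a + 1) k"
  proof -
    have "s + a + 1 \<notin> \<int>\<^sub>\<le>\<^sub>0" using assms by (auto elim!: nonpos_Ints_cases)
    then have "pochhammer (s + a + 1) k = Gamma (s + a + 1 + real k) / Gamma (s + a + 1)"
      by (rule pochhammer_Gamma)
    moreover have "Gamma (real k) = fact (k - 1)"
      using Gamma_fact[of "k - 1", where 'a = real] assms by (simp add: of_nat_diff)
    moreover have "Gamma (s + a + 1) > 0" using assms by (intro Gamma_real_pos) auto
    ultimately show ?thesis by (simp add: Beta_def)
  qed
  finally show "(\<integral>r. beta_density s k r * \<bar>r\<bar> powr a \<partial>lborel) = 1 / pochhammer (s + a + 1) k"
    unfolding eq by simp
qed

text \<open>The variable \<open>X = |z| sqrt r\<close> has even moments \<open>M\<^sub>u(s + n + k) / ((s + n + 1)\<cdots>(s + n + k))\<close> and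
corresponding fractional moments. As \<open>r \<le> 1\<close>, it is no larger than \<open>|z|\<close> on the support of \<open>F\<close>.\<close>

lemma beta_weight_moments:
  assumes s: "s \<ge> 0" and u: "poly_bounded u" and k: "k \<ge> 1"
  defines "F \<equiv> \<lambda>q. (u (fst q) * of_real (norm_weight (s + real k) (fst q))) * of_real (beta_density s k (snd q))"
    and "X \<equiv> \<lambda>q. cmod (fst q) * sqrt \<bar>snd q\<bar>"
  shows "F \<in> borel_measurable (gauss \<Otimes>\<^sub>M lborel)" and "X \<in> borel_measurable (gauss \<Otimes>\<^sub>M lborel)"
    and "integrable (gauss \<Otimes>\<^sub>M lborel) (\<lambda>q. F q * exp (of_real ((X q)\<^sup>2 / 2)))"
    and "(\<integral>q. F q * of_real (X q) ^ (2 * n) \<partial>(gauss \<Otimes>\<^sub>M lborel))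
      = mellin u (of_real (s + real n + real k)) / of_real (pochhammer (s + real n + 1) k)"
    and "p > 0 \<Longrightarrow> (\<integral>q. F q * of_real (X q powr p) \<partial>(gauss \<Otimes>\<^sub>M lborel))
      = mellin u (of_real (s + p / 2 + real k)) / of_real (pochhammer (s + p / 2 + 1) k)"
proof -
  have [measurable]: "u \<in> borel_measurable borel" using u by measurable
  have sf: "sigma_finite_measure gauss" "sigma_finite_measure (lborel :: real measure)"
    by (rule gauss.sigma_finite_measure_axioms lborel.sigma_finite_measure_axioms)+
  show Fm [measurable]: "F \<in> borel_measurable (gauss \<Otimes>\<^sub>M lborel)" unfolding F_def by measurable
  show Xm [measurable]: "X \<in> borel_measurable (gauss \<Otimes>\<^sub>M lborel)" unfolding X_def by measurable
  have gen: "(\<integral>q. (u (fst q) * of_real (norm_weight (s + real k + a) (fst q))) * of_real (beta_density s k (snd q) * \<bar>snd q\<bar> powr a) \<partial>(gauss \<Otimes>\<^sub>M lborel))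
      = mellin u (of_real (s + a + real k)) / of_real (pochhammer (s + a + 1) k)" if "a \<ge> 0" for a
  proof -
    have i1: "integrable gauss (\<lambda>z. u z * of_real (norm_weight (s + real k + a) z))"
      using s that by (intro integrable_norm_weight u) auto
    have i2: "integrable lborel (\<lambda>r. complex_of_real (beta_density s k r * \<bar>r\<bar> powr a))"
      using beta_density_moment(1)[OF s that k] by (rule integrable_of_real)
    have br: "(\<integral>r. complex_of_real (beta_density s k r * \<bar>r\<bar> powr a) \<partial>lborel) = of_real (1 / pochhammer (s + a + 1) k)"
      unfolding integral_complex_of_real beta_density_moment(2)[OF s that k] ..
    have e: "s + real k + a = s + a + real k" by simp
    have "(\<integral>q. (u (fst q) * of_real (norm_weight (s + real k + a) (fst q))) * of_real (beta_density s k (snd q) * \<bar>snd q\<bar> powr a) \<partial>(gauss \<Otimes>\<^sub>M lborel))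
      = (\<integral>z. u z * of_real (norm_weight (s + real k + a) z) \<partial>gauss) * of_real (1 / pochhammer (s + a + 1) k)"
      unfolding br[symmetric] by (rule integral_pair_mult(2)[OF sf i1 i2])
    also have "\<dots> = mellin u (of_real (s + a + real k)) / of_real (pochhammer (s + a + 1) k)"
      unfolding e mellin_of_real[OF u] by simp
    finally show ?thesis .
  qed
  have powr_nat: "norm_weight (s + real k) z * cmod z ^ (2 * n) = norm_weight (s + real k + real n) z" for z
    unfolding norm_weight_def by (rule powr_mult_even_power)
  have "F q * of_real (X q) ^ (2 * n) = (u (fst q) * of_real (norm_weight (s + real k + real n) (fst q))) * of_real (beta_density s k (snd q) * \<bar>snd q\<bar> powr real n)" for q
  proof -
    have b: "beta_density s k r * \<bar>r\<bar> ^ n = beta_density s k r * \<bar>r\<bar> powr real n" for r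
      by (cases "r = 0") (simp_all add: beta_density_def powr_realpow)
    have x: "complex_of_real (X q) ^ (2 * n) = of_real (cmod (fst q) ^ (2 * n) * \<bar>snd q\<bar> ^ n)"
      unfolding of_real_power[symmetric] by (simp add: X_def power_mult_distrib power_mult)
    show ?thesis
      unfolding F_def powr_nat[symmetric] b[symmetric] x by (simp add: mult_ac)
  qed
  then show "(\<integral>q. F q * of_real (X q) ^ (2 * n) \<partial>(gauss \<Otimes>\<^sub>M lborel))
      = mellin u (of_real (s + real n + real k)) / of_real (pochhammer (s + real n + 1) k)"
    using gen[of "real n"] by simp
  show "(\<integral>q. F q * of_real (X q powr p) \<partial>(gauss \<Otimes>\<^sub>M lborel))
      = mellin u (of_real (s + p / 2 + real k)) / of_real (pochhammer (s + p / 2 + 1) k)" if "p > 0"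
  proof -
    have "F q * of_real (X q powr p) = (u (fst q) * of_real (norm_weight (s + real k + p / 2) (fst q))) * of_real (beta_density s k (snd q) * \<bar>snd q\<bar> powr (p / 2))" for q
    proof -
      have "X q powr p = cmod (fst q) powr p * \<bar>snd q\<bar> powr (p / 2)"
        by (simp add: X_def powr_mult powr_half_sqrt[symmetric] powr_powr)
      moreover have "norm_weight (s + real k + p / 2) (fst q) = norm_weight (s + real k) (fst q) * cmod (fst q) powr p"
        by (simp add: norm_weight_def powr_add[symmetric] algebra_simps)
      ultimately show ?thesis by (simp add: F_def mult_ac)
    qed
    then show ?thesis using gen[of "p / 2"] that by simp
  qed
  show "integrable (gauss \<Otimes>\<^sub>M lborel) (\<lambda>q. F q * exp (of_real ((X q)\<^sup>2 / 2)))"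
  proof (rule Bochner_Integration.integrable_bound)
    have i1: "integrable gauss (\<lambda>z. (u z * of_real (norm_weight (s + real k) z)) * exp (of_real ((cmod z)\<^sup>2 / 2)))"
      using s by (intro integrable_gauss_poly_bounded[OF u, of "s + real k" "1/2"])
         (measurable, auto simp: norm_mult norm_exp_eq_Re norm_weight_def)
    have i2: "integrable lborel (\<lambda>r. complex_of_real (beta_density s k r * \<bar>r\<bar> powr 0))"
      using beta_density_moment(1)[OF s order_refl k] by (rule integrable_of_real)
    show "integrable (gauss \<Otimes>\<^sub>M lborel) (\<lambda>q. ((u (fst q) * of_real (norm_weight (s + real k) (fst q))) * exp (of_real ((cmod (fst q))\<^sup>2 / 2)))
        * complex_of_real (beta_density s k (snd q) * \<bar>snd q\<bar> powr 0))"
      by (rule integral_pair_mult(1)[OF sf i1 i2])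
    show "AE q in gauss \<Otimes>\<^sub>M lborel. norm (F q * exp (of_real ((X q)\<^sup>2 / 2)))
      \<le> norm (((u (fst q) * of_real (norm_weight (s + real k) (fst q))) * exp (of_real ((cmod (fst q))\<^sup>2 / 2)))
        * complex_of_real (beta_density s k (snd q) * \<bar>snd q\<bar> powr 0))"
    proof (rule AE_I2)
      fix q :: "complex \<times> real"
      obtain z r where q: "q = (z, r)" by (cases q)
      show "norm (F q * exp (of_real ((X q)\<^sup>2 / 2)))
        \<le> norm (((u (fst q) * of_real (norm_weight (s + real k) (fst q))) * exp (of_real ((cmod (fst q))\<^sup>2 / 2)))
        * complex_of_real (beta_density s k (snd q) * \<bar>snd q\<bar> powr 0))"
      proof (cases "r \<in> {0<..<1}")
        case True
        then have "(cmod z)\<^sup>2 * r \<le> (cmod z)\<^sup>2 * 1" by (intro mult_left_mono) auto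
        then have "(X q)\<^sup>2 \<le> (cmod z)\<^sup>2" using True by (simp add: X_def q power_mult_distrib)
        then have "cmod (F q) * exp ((X q)\<^sup>2 / 2) \<le> cmod (F q) * exp ((cmod z)\<^sup>2 / 2)"
          by (intro mult_left_mono) auto
        moreover have "cmod (F q * exp (of_real ((X q)\<^sup>2 / 2))) = cmod (F q) * exp ((X q)\<^sup>2 / 2)"
          by (simp only: norm_mult norm_exp_eq_Re Re_complex_of_real)
        moreover have "norm (((u z * of_real (norm_weight (s + real k) z)) * exp (of_real ((cmod z)\<^sup>2 / 2)))
        * complex_of_real (beta_density s k r * \<bar>r\<bar> powr 0)) = cmod (F q) * exp ((cmod z)\<^sup>2 / 2)"
          using True by (simp only: norm_mult norm_exp_eq_Re Re_complex_of_real F_def q fst_conv snd_conv) simp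
        ultimately show ?thesis by (simp only: q fst_conv snd_conv)
      next
        case False
        then have "beta_density s k r = 0" by (simp add: beta_density_def)
        then show ?thesis by (simp add: F_def q)
      qed
    qed
  qed measurable
qed

lemma norm_weight_mellin_moments:
  assumes s: "s \<ge> 0" and u: "poly_bounded u"
  defines "F \<equiv> \<lambda>z. u z * of_real (norm_weight s z)"
  shows "integrable gauss (\<lambda>z. F z * exp (of_real ((cmod z)\<^sup>2 / 2)))"
    and "(\<integral>z. F z * of_real (cmod z) ^ (2 * n) \<partial>gauss) = mellin u (of_real (s + real n))"
    and "(\<integral>z. F z * of_real (cmod z powr p) \<partial>gauss) = mellin u (of_real (s + p / 2))"
proof -
  have [measurable]: "u \<in> borel_measurable borel" using u by measurable
  show "integrable gauss (\<lambda>z. F z * exp (of_real ((cmod z)\<^sup>2 / 2)))"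
    unfolding F_def using s
    by (intro integrable_gauss_poly_bounded[OF u, of "s" "1/2"])
       (measurable, auto simp: norm_mult norm_exp_eq_Re norm_weight_def)
  have "F z * of_real (cmod z) ^ (2 * n) = u z * of_real (norm_weight (s + real n) z)" for z
  proof -
    have "norm_weight (s + real n) z = norm_weight s z * cmod z ^ (2 * n)"
      by (simp add: norm_weight_def powr_mult_even_power)
    then show ?thesis by (simp add: F_def)
  qed
  then show "(\<integral>z. F z * of_real (cmod z) ^ (2 * n) \<partial>gauss) = mellin u (of_real (s + real n))"
    using mellin_of_real[OF u, of "s + real n"] by simp
  have "F z * of_real (cmod z powr p) = u z * of_real (norm_weight (s + p / 2) z)" for z
  proof -
    have "norm_weight (s + p / 2) z = norm_weight s z * cmod z powr p"
      by (simp add: norm_weight_def powr_add[symmetric] algebra_simps)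
    then show ?thesis by (simp add: F_def)
  qed
  then show "(\<integral>z. F z * of_real (cmod z powr p) \<partial>gauss) = mellin u (of_real (s + p / 2))"
    using mellin_of_real[OF u, of "s + p / 2"] by simp
qed

text \<open>The hypothesis is multiplied out to \<open>A(y) M\<^sub>V(y) = 0\<close> with \<open>A(y) = M\<^sub>u(y + k) - (y + 1)\<cdots>(y + k) M\<^sub>u(y)\<close> at
the points \<open>y = s + n\<close>. The fractional moments of order \<open>p = 2 (y - s)\<close> extend this to \<open>s < y < s + 1\<close>, and
the holomorphic functions on \<open>Re y > -1\<close> have no zero divisors.\<close>

theorem mellin_dichotomy:
  assumes s: "s \<ge> 0" and u: "poly_bounded u" and V: "poly_bounded V" and k: "k \<ge> 1"
    and zero: "\<And>n. (mellin u (of_real (s + real n + real k)) / of_real (pochhammer (s + real n + 1) k)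
        - mellin u (of_real (s + real n))) * mellin V (of_real (s + real n)) = 0"
  shows "(\<forall>y. Re y > -1 \<longrightarrow> mellin u (y + of_nat k) = pochhammer (y + 1) k * mellin u y)
    \<or> (\<forall>y. Re y > -1 \<longrightarrow> mellin V y = 0)"
proof -
  have [measurable]: "u \<in> borel_measurable borel" "V \<in> borel_measurable borel" using u V by measurable
  have sf: "sigma_finite_measure gauss" "sigma_finite_measure (gauss \<Otimes>\<^sub>M (lborel :: real measure))"
    by (intro sigma_finite_pair_measure gauss.sigma_finite_measure_axioms lborel.sigma_finite_measure_axioms)+
  define D where "D = {y::complex. Re y > -1}"
  have D: "open D" "connected D"
    unfolding D_def by (rule open_halfspace_Re_gt, rule convex_connected, rule convex_halfspace_Re_gt)
  define A where "A y = mellin u (y + of_nat k) - pochhammer (y + 1) k * mellin u y" for y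
  have "(\<lambda>y. mellin u (y + of_nat k)) holomorphic_on D"
  proof -
    have "(mellin u \<circ> (\<lambda>y. y + of_nat k)) holomorphic_on D"
      by (rule holomorphic_on_compose_gen[OF _ mellin_holomorphic[OF u]]) (auto simp: D_def intro!: holomorphic_intros)
    then show ?thesis by (simp add: o_def)
  qed
  then have A: "A holomorphic_on D"
    unfolding A_def using mellin_holomorphic[OF u] by (intro holomorphic_intros) (auto simp: D_def)
  have B: "mellin V holomorphic_on D"
    unfolding D_def by (rule mellin_holomorphic[OF V])
  have small: "A (of_real y) * mellin V (of_real y) = 0" if y: "s < y" "y < s + 1" for y
  proof -
    define p where "p = 2 * (y - s)"
    have p: "0 < p" "p < 2" "s + p / 2 = y" using y by (auto simp: p_def field_simps)
    have Vm: "(\<lambda>z. V z * of_real (norm_weight s z)) \<in> borel_measurable gauss" by measurable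
    have um: "(\<lambda>z. u z * of_real (norm_weight s z)) \<in> borel_measurable gauss" by measurable
    have cm: "cmod \<in> borel_measurable gauss" by measurable
    have "(mellin u (of_real (s + p / 2 + real k)) / of_real (pochhammer (s + p / 2 + 1) k)
        - mellin u (of_real (s + p / 2))) * mellin V (of_real (s + p / 2)) = 0"
      using moment_product_zero[OF sf(2) sf(1) sf(1) beta_weight_moments(1,2)[OF s u k] _ um cm norm_ge_zero Vm cm norm_ge_zero
          beta_weight_moments(3)[OF s u k] norm_weight_mellin_moments(1)[OF s u] norm_weight_mellin_moments(1)[OF s V] _ p(1,2)]
      unfolding beta_weight_moments(4)[OF s u k] beta_weight_moments(5)[OF s u k p(1)] norm_weight_mellin_moments(2,3)[OF s u] norm_weight_mellin_moments(2,3)[OF s V]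
      using zero by simp
    moreover have "pochhammer (y + 1) k > 0" using y s by (intro pochhammer_pos) simp
    ultimately have "(mellin u (of_real (y + real k)) - of_real (pochhammer (y + 1) k) * mellin u (of_real y)) * mellin V (of_real y) = 0"
      by (simp add: p(3) field_simps)
    moreover have "of_real (pochhammer (y + 1) k) = pochhammer (complex_of_real y + 1) k"
      by (simp add: pochhammer_of_real[symmetric])
    ultimately show ?thesis by (simp add: A_def)
  qed
  define U where "U = complex_of_real ` {s<..<s+1}"
  define \<xi> where "\<xi> = complex_of_real (s + 1/2)"
  have \<xi>: "\<xi> \<in> D" using s by (simp add: \<xi>_def D_def)
  have "U \<subseteq> D" using s by (auto simp: U_def D_def)
  have "\<xi> islimpt U"
    unfolding islimpt_approachable
  proof (intro allI impI)
    fix e :: real assume "e > 0"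
    \<comment> \<open>A point of the interval at distance less than \<open>e\<close> from its midpoint.\<close>
    define d where "d = min (e / 2) (1/4)"
    have d: "d > 0" "d < e" "d < 1/2" using \<open>e > 0\<close> by (auto simp: d_def)
    have "of_real (s + 1/2 + d) \<in> U"
      unfolding U_def by (rule imageI) (use d in auto)
    moreover have "complex_of_real (s + 1/2 + d) \<noteq> \<xi>" using d unfolding \<xi>_def of_real_eq_iff by simp
    moreover have "dist (complex_of_real (s + 1/2 + d)) \<xi> < e"
      using d unfolding \<xi>_def dist_norm of_real_diff[symmetric] norm_of_real by simp
    ultimately show "\<exists>x'\<in>U. x' \<noteq> \<xi> \<and> dist x' \<xi> < e" by blast
  qed
  have zU: "A z * mellin V z = 0" if "z \<in> U" for z
  proof -
    from that obtain y where "y \<in> {s<..<s + 1}" "z = of_real y" unfolding U_def by blast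
    then have "z = of_real y" "s < y" "y < s + 1" by auto
    then show ?thesis by (simp only: small)
  qed
  have hol: "(\<lambda>y. A y * mellin V y) holomorphic_on D"
    by (rule holomorphic_on_mult[OF A B])
  have AB: "A w * mellin V w = 0" if "w \<in> D" for w
    by (rule analytic_continuation[OF hol D \<open>U \<subseteq> D\<close> \<xi> \<open>\<xi> islimpt U\<close> zU that])
  show ?thesis
  proof (cases "\<forall>y\<in>D. A y = 0")
    case True
    then show ?thesis by (auto simp: A_def D_def)
  next
    case False
    then obtain y0 where y0: "y0 \<in> D" "A y0 \<noteq> 0" by blast
    have "isCont A y0"
      using A D y0 by (meson continuous_on_eq_continuous_at holomorphic_on_imp_continuous_on)
    then obtain e where e: "e > 0" "\<And>y. dist y0 y < e \<Longrightarrow> A y \<noteq> 0"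
      using continuous_at_avoid[of y0 A 0] y0 by metis
    obtain e' where e': "e' > 0" "ball y0 e' \<subseteq> D" using D y0 openE by blast
    define W where "W = ball y0 (min e e')"
    have W: "open W" "W \<noteq> {}" "W \<subseteq> D" using e e' by (auto simp: W_def)
    have zW: "mellin V w = 0" if "w \<in> W" for w
      using AB[of w] e(2)[of w] that W(3) by (auto simp: W_def)
    have "mellin V w = 0" if "w \<in> D" for w
      by (rule analytic_continuation_open[OF W(1) D(1) W(2) D(2) W(3) B holomorphic_on_const zW that])
    then show ?thesis by (simp add: D_def)
  qed
qed

section \<open>Periodic multiplier sequences\<close>

lemma periodic_sums:
  fixes w :: "nat \<Rightarrow> complex"
  assumes per: "\<And>n. w (n + k) = w n" and sums: "(\<lambda>n. w n * x ^ n) sums S"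
  shows "(\<Sum>j<k. w j * x ^ j) = (1 - x ^ k) * S"
proof -
  have "summable (\<lambda>n. w n * x ^ n)" using sums by (rule sums_summable)
  then have "S = (\<Sum>n. w (n + k) * x ^ (n + k)) + (\<Sum>j<k. w j * x ^ j)"
    using suminf_split_initial_segment[of "\<lambda>n. w n * x ^ n" k] sums_unique[OF sums] by simp
  also have "(\<Sum>n. w (n + k) * x ^ (n + k)) = (\<Sum>n. x ^ k * (w n * x ^ n))"
    by (simp add: per power_add mult_ac)
  also have "\<dots> = x ^ k * S"
    using suminf_mult[OF sums_summable[OF sums]] sums_unique[OF sums] by simp
  finally show ?thesis by (simp add: algebra_simps)
qed

text \<open>Subtracting the multiple \<open>w (k - 1) * (1 + x + \<cdots> + x^(k - 1))\<close>, which vanishes at the same points, leaves a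
polynomial of degree less than \<open>k - 1\<close> with \<open>k - 1\<close> zeros.\<close>

lemma root_of_unity_vanishing_imp_constant:
  fixes w :: "nat \<Rightarrow> complex"
  assumes zero: "\<And>x. x ^ k = 1 \<Longrightarrow> x \<noteq> 1 \<Longrightarrow> (\<Sum>j<k. w j * x ^ j) = 0" and k: "k \<ge> 1" and j: "j < k"
  shows "w j = w (k - 1)"
proof (rule ccontr)
  assume neq: "w j \<noteq> w (k - 1)"
  \<comment> \<open>The coefficient of degree \<open>k - 1\<close> cancels, so the sum stops at \<open>k - 2\<close>.\<close>
  define Q where "Q = (\<Sum>i<k-1. monom (w i - w (k - 1)) i)"
  have coeffQ: "coeff Q i = (if i < k - 1 then w i - w (k - 1) else 0)" for i
  proof -
    have "coeff Q i = (\<Sum>l<k-1. if l = i then w l - w (k - 1) else 0)"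
      unfolding Q_def coeff_sum coeff_monom ..
    then show ?thesis by simp
  qed
  have "j \<noteq> k - 1" using neq by auto
  then have jk: "j < k - 1" using j by simp
  have "Q \<noteq> 0"
  proof
    assume "Q = 0"
    then show False using coeffQ[of j] jk neq by simp
  qed
  have "degree Q < k - 1"
    using jk by (intro degree_lessI) (auto simp: coeffQ)
  have root: "poly Q x = 0" if x: "x ^ k = 1" "x \<noteq> 1" for x
  proof -
    have geo: "(\<Sum>i<k. x ^ i) = 0"
      using x geometric_sum[of x k] by simp
    have "poly Q x = (\<Sum>i<k-1. (w i - w (k - 1)) * x ^ i)"
      by (simp add: Q_def poly_sum poly_monom)
    also have "\<dots> = (\<Sum>i<k. (w i - w (k - 1)) * x ^ i)"
    proof -
      have "{..<k} = insert (k - 1) {..<k-1}" using k by auto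
      then show ?thesis by simp
    qed
    also have "\<dots> = (\<Sum>i<k. w i * x ^ i) - w (k - 1) * (\<Sum>i<k. x ^ i)"
      by (simp add: sum_subtractf sum_distrib_left left_diff_distrib)
    finally show ?thesis using zero[OF x] geo by simp
  qed
  have fin: "finite {x::complex. x ^ k = 1}"
    using card_complex_roots_unity[of k] k by (intro card_ge_0_finite) simp
  have "card ({x::complex. x ^ k = 1} - {1}) \<le> card {x. poly Q x = 0}"
    using root poly_roots_finite[OF \<open>Q \<noteq> 0\<close>] by (intro card_mono) auto
  also have "\<dots> \<le> degree Q"
    by (rule card_poly_roots_bound[OF \<open>Q \<noteq> 0\<close>])
  finally have "k - 1 \<le> degree Q"
    using card_complex_roots_unity[of k] k fin by (simp add: card_Diff_singleton)
  then show False using \<open>degree Q < k - 1\<close> by simp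
qed

lemma mellin_of_nat:
  assumes u: "poly_bounded u"
  shows "mellin u (of_nat n) = (\<integral>z. u z * of_real ((cmod z)\<^sup>2) ^ n \<partial>gauss)"
proof -
  have [measurable]: "u \<in> borel_measurable borel" using u by measurable
  have "mellin u (of_nat n) = (\<integral>z. u z * of_real (norm_weight (real n) z) \<partial>gauss)"
    using mellin_of_real[OF u, of "real n"] by simp
  also have "\<dots> = (\<integral>z. u z * of_real ((cmod z)\<^sup>2) ^ n \<partial>gauss)"
  proof (rule integral_cong_AE)
    show "AE z in gauss. u z * of_real (norm_weight (real n) z) = u z * of_real ((cmod z)\<^sup>2) ^ n"
      using AE_gauss_nonzero
    proof eventually_elim
      case (elim z)
      then have "norm_weight (real n) z = cmod z ^ (2 * n)"
        using powr_realpow[of "cmod z" "2 * n"] by (simp add: norm_weight_def)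
      then show ?case by (simp add: power_mult)
    qed
  qed measurable
  finally show ?thesis .
qed

text \<open>With \<open>d = max 0 (Re x) < 1\<close>, the generating function is bounded along the radius to the root of unity
\<open>x \<noteq> 1\<close> by the integral of \<open>|u| exp(d |z|\<^sup>2)\<close>. Once \<open>M\<^sub>u(n) = c n!\<close>, all Gaussian moments of \<open>u - c\<close>
vanish: the others are zero by rotation invariance.\<close>

theorem periodic_imp_constant:
  assumes u: "poly_bounded u" and rot: "rotation_invariant u" and k: "k \<ge> 1"
    and per: "\<And>n. mellin u (of_nat (n + k)) = pochhammer (of_nat n + 1) k * mellin u (of_nat n)"
  shows "\<exists>c. AE z in gauss. u z = c"
proof -
  have [measurable]: "u \<in> borel_measurable borel" using u by measurable
  define w where "w n = mellin u (of_nat n) / fact n" for n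
  have wper: "w (n + k) = w n" for n
  proof -
    have "(fact (n + k) :: complex) = fact n * pochhammer (of_nat n + 1) k"
      using pochhammer_product'[of "1::complex" n k] by (simp add: pochhammer_fact add.commute)
    moreover have "fact (n + k) \<noteq> (0::complex)" by simp
    ultimately show ?thesis unfolding w_def per by (auto simp: field_simps)
  qed
  have expint: "integrable gauss (\<lambda>z. u z * exp (of_real (r * (cmod z)\<^sup>2)))" if "r < 1" for r
    by (rule integrable_gauss_poly_bounded_exp[OF u that]) (measurable, simp add: norm_mult norm_exp_eq_Re del: of_real_mult)
  have wsums: "(\<lambda>n. w n * x ^ n) sums (\<integral>z. u z * exp (x * of_real ((cmod z)\<^sup>2)) \<partial>gauss)" if x: "cmod x < 1" for x
  proof -
    have "integrable gauss (\<lambda>z. u z * exp (of_real (cmod x * \<bar>(cmod z)\<^sup>2\<bar>)))" using expint[OF x] by simp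
    then have "(\<lambda>n. x ^ n / fact n * (\<integral>z. u z * of_real ((cmod z)\<^sup>2) ^ n \<partial>gauss)) sums (\<integral>z. u z * exp (x * of_real ((cmod z)\<^sup>2)) \<partial>gauss)"
      by (intro sums_integral_exp(2)[where r = "cmod x"]) auto
    then show ?thesis unfolding w_def mellin_of_nat[OF u] by (simp add: mult_ac)
  qed
  have vanish: "(\<Sum>j<k. w j * x ^ j) = 0" if x: "x ^ k = 1" "x \<noteq> 1" for x
  proof -
    have nx: "cmod x = 1"
      using x k by (metis norm_power norm_one power_eq_1_iff norm_ge_zero not_one_le_zero)
    have "Re x < 1"
    proof (rule ccontr)
      assume "\<not> Re x < 1"
      then have "Re x = 1" using complex_Re_le_cmod[of x] nx by simp
      moreover from this have "Im x = 0" using nx by (simp add: cmod_def)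
      ultimately show False using x by (simp add: complex_eq_iff)
    qed
    define d where "d = max 0 (Re x)"
    have d: "d < 1" using \<open>Re x < 1\<close> by (simp add: d_def)
    define B where "B = (\<integral>z. norm (u z * exp (of_real (d * (cmod z)\<^sup>2))) \<partial>gauss)"
    define r where "r i = real i / real (Suc i)" for i
    have r: "0 \<le> r i" "r i < 1" for i by (auto simp: r_def field_simps)
    have rlim: "r \<longlonglongrightarrow> 1" unfolding r_def by (rule LIMSEQ_n_over_Suc_n)
    define xi where "xi i = of_real (r i) * x" for i
    have xilim: "xi \<longlonglongrightarrow> x"
      unfolding xi_def using tendsto_mult[OF tendsto_of_real[OF rlim] tendsto_const, of x] by simp
    have le: "cmod (\<Sum>j<k. w j * xi i ^ j) \<le> (1 - r i ^ k) * B" for i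
    proof -
      have nxi: "cmod (xi i) < 1" using r[of i] nx by (simp add: xi_def norm_mult)
      have "(\<Sum>j<k. w j * xi i ^ j) = (1 - xi i ^ k) * (\<integral>z. u z * exp (xi i * of_real ((cmod z)\<^sup>2)) \<partial>gauss)"
        by (rule periodic_sums[OF wper wsums[OF nxi]])
      also have "1 - xi i ^ k = of_real (1 - r i ^ k)" by (simp add: xi_def power_mult_distrib x)
      finally have "cmod (\<Sum>j<k. w j * xi i ^ j) = (1 - r i ^ k) * cmod (\<integral>z. u z * exp (xi i * of_real ((cmod z)\<^sup>2)) \<partial>gauss)"
        using power_le_one[of "r i" k] r[of i] by (simp add: norm_mult del: of_real_diff of_real_power)
      also have "cmod (\<integral>z. u z * exp (xi i * of_real ((cmod z)\<^sup>2)) \<partial>gauss) \<le> B"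
      proof -
        have "cmod (\<integral>z. u z * exp (xi i * of_real ((cmod z)\<^sup>2)) \<partial>gauss) \<le> (\<integral>z. cmod (u z * exp (xi i * of_real ((cmod z)\<^sup>2))) \<partial>gauss)"
          by (rule integral_norm_bound)
        also have "\<dots> \<le> B"
          unfolding B_def
        proof (rule integral_mono')
          show "integrable gauss (\<lambda>z. norm (u z * exp (of_real (d * (cmod z)\<^sup>2))))"
            by (rule integrable_norm[OF expint[OF d]])
          fix z
          have "r i * Re x \<le> d"
          proof (cases "Re x \<ge> 0")
            case True
            then show ?thesis using r[of i] mult_left_le_one_le[of "Re x" "r i"] by (simp add: d_def)
          next
            case False
            then have "r i * Re x \<le> 0" using r[of i] by (simp add: mult_nonneg_nonpos)
            then show ?thesis by (simp add: d_def)
          qed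
          then have "Re (xi i * of_real ((cmod z)\<^sup>2)) \<le> d * (cmod z)\<^sup>2"
            by (simp add: xi_def mult_right_mono del: of_real_power)
          then show "cmod (u z * exp (xi i * of_real ((cmod z)\<^sup>2))) \<le> norm (u z * exp (of_real (d * (cmod z)\<^sup>2)))"
            by (simp only: norm_mult norm_exp_eq_Re Re_complex_of_real) (intro mult_left_mono, auto)
        qed simp
        finally show ?thesis .
      qed
      finally show ?thesis using power_le_one[of "r i" k] r[of i] by (simp add: mult_left_mono)
    qed
    have "(\<lambda>i. (1 - r i ^ k) * B) \<longlonglongrightarrow> (1 - 1 ^ k) * B"
      by (intro tendsto_intros rlim)
    moreover have "(\<lambda>i. cmod (\<Sum>j<k. w j * xi i ^ j)) \<longlonglongrightarrow> cmod (\<Sum>j<k. w j * x ^ j)"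
      by (intro tendsto_intros xilim)
    ultimately have "cmod (\<Sum>j<k. w j * x ^ j) \<le> (1 - 1 ^ k) * B"
      using le by (intro LIMSEQ_le) auto
    then show ?thesis by simp
  qed
  define c where "c = w (k - 1)"
  have wc: "w n = c" for n
  proof (induction n rule: less_induct)
    case (less n)
    show ?case
    proof (cases "n < k")
      case True
      then show ?thesis
        unfolding c_def using root_of_unity_vanishing_imp_constant[of k w n] vanish k by blast
    next
      case False
      then show ?thesis using less[of "n - k"] wper[of "n - k"] k by simp
    qed
  qed
  have "AE z in gauss. u z - c = 0"
  proof (rule gauss_moments_zero_imp_AE_zero)
    show pb: "poly_bounded (\<lambda>z. u z - c)" using u by auto
    fix a b
    show "(\<integral>z. (u z - c) * z ^ a * cnj z ^ b \<partial>gauss) = 0"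
    proof (cases "a = b")
      case False
      have "rotation_invariant (\<lambda>z. u z - c)"
        using rot by (auto simp: rotation_invariant_def)
      then show ?thesis using False by (rule rotation_invariant_orthogonal)
    next
      case True
      have sq: "z ^ a * cnj z ^ a = of_real ((cmod z)\<^sup>2) ^ a" for z
        by (simp add: mult_cnj_power power_mult)
      have "(\<integral>z. (u z - c) * z ^ a * cnj z ^ b \<partial>gauss) = (\<integral>z. u z * (z ^ a * cnj z ^ a) - c * (z ^ a * cnj z ^ a) \<partial>gauss)"
        using True by (simp add: algebra_simps)
      also have "\<dots> = (\<integral>z. u z * (z ^ a * cnj z ^ a) \<partial>gauss) - (\<integral>z. c * (z ^ a * cnj z ^ a) \<partial>gauss)"
        using u by (intro Bochner_Integration.integral_diff poly_bounded_integrable_gauss poly_bounded_mult poly_bounded_power poly_bounded_cnj) auto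
      also have "(\<integral>z. u z * (z ^ a * cnj z ^ a) \<partial>gauss) = fact a * c"
        using wc[of a] unfolding sq mellin_of_nat[OF u, symmetric] w_def by (simp add: field_simps)
      also have "(\<integral>z. c * (z ^ a * cnj z ^ a) \<partial>gauss) = c * complex_of_real (fact a)"
        unfolding mult_cnj_power integral_mult_right_zero integral_complex_of_real gauss_even_moment(2) ..
      finally show ?thesis by simp
    qed
  qed
  then show ?thesis by (intro exI[of _ c]) simp
qed

section \<open>Borel versions of symbols and the theorem\<close>

text \<open>A Borel version is cut off to 0 where it violates the bound, which happens only on a null set.\<close>

lemma S_poly_borel_version:
  assumes "u \<in> S_poly"
  shows "\<exists>u'. poly_bounded u' \<and> (AE z in lebesgue. u z = u' z)"
proof -
  obtain C m where m [measurable]: "u \<in> borel_measurable lebesgue" and C: "C > 0"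
    and bnd: "AE z in lebesgue. cmod (u z) \<le> C * (1 + cmod z) powr m"
    using assms unfolding S_poly_def by blast
  have "(\<lambda>z. Re (u z)) \<in> borel_measurable (completion lborel)" "(\<lambda>z. Im (u z)) \<in> borel_measurable (completion lborel)"
    using m by measurable
  then obtain a b where ab [measurable]: "a \<in> borel_measurable lborel" "b \<in> borel_measurable lborel"
    and ae: "AE z in lborel. Re (u z) = a z" "AE z in lborel. Im (u z) = b z"
    using completion_ex_borel_measurable_real by metis
  obtain N :: nat where N: "m \<le> real N" using real_arch_simple by blast
  define u0 where "u0 z = Complex (a z) (b z)" for z
  have [measurable]: "u0 \<in> borel_measurable borel"
    unfolding u0_def using ab by (simp add: borel_measurable_complex_iff)
  define u' where "u' z = (if cmod (u0 z) \<le> C * (1 + cmod z) ^ N then u0 z else 0)" for z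
  have "poly_bounded u'"
  proof (rule poly_boundedI)
    show "u' \<in> borel_measurable borel" unfolding u'_def by measurable
    show "cmod (u' z) \<le> C * (1 + cmod z) ^ N" for z using C by (auto simp: u'_def)
  qed
  moreover have "AE z in lebesgue. u z = u' z"
    using bnd AE_completion[OF ae(1)] AE_completion[OF ae(2)]
  proof eventually_elim
    case (elim z)
    have "u z = u0 z" using elim by (simp add: u0_def complex_eq_iff)
    moreover have "(1 + cmod z) powr m \<le> (1 + cmod z) powr real N"
      by (intro powr_mono N) auto
    then have "C * (1 + cmod z) powr m \<le> C * (1 + cmod z) ^ N"
      using C powr_realpow[of "1 + cmod z" N] by (simp add: add_pos_nonneg)
    ultimately show ?case using elim by (simp add: u'_def)
  qed
  ultimately show ?thesis by blast
qed

text \<open>The defining property of the projection involves \<open>F\<close> only under integrals.\<close>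

lemma fock_projection_cong_AE:
  assumes m: "F \<in> borel_measurable lebesgue" "F' \<in> borel_measurable lebesgue" and ae: "AE z in lebesgue. F z = F' z"
  shows "fock_projection s F = fock_projection s F'"
proof -
  have "weighted_inner s (\<lambda>z. F z - g z) h = weighted_inner s (\<lambda>z. F' z - g z) h"
    if "g \<in> fock_sobolev s" "h \<in> fock_sobolev s" for g h
    unfolding weighted_inner_def
  proof (rule integral_cong_AE)
    have "g holomorphic_on UNIV" "h holomorphic_on UNIV" using that by (simp_all add: fock_sobolev_def)
    then have gh: "g \<in> borel_measurable lborel" "h \<in> borel_measurable lborel" by (simp_all add: entire_measurable)
    have [measurable]: "g \<in> borel_measurable lebesgue" by (rule measurable_completion[OF gh(1)])
    have [measurable]: "h \<in> borel_measurable lebesgue" by (rule measurable_completion[OF gh(2)])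
    note [measurable] = m
    show "(\<lambda>z. (F z - g z) * cnj (h z)) \<in> borel_measurable (weighted_gaussian s)"
      "(\<lambda>z. (F' z - g z) * cnj (h z)) \<in> borel_measurable (weighted_gaussian s)"
      unfolding weighted_gaussian_def measurable_density_eq1 by measurable
    have d: "(\<lambda>z. ennreal (1 / pi * cmod z powr (2 * s) * exp (- (cmod z)\<^sup>2))) \<in> borel_measurable lebesgue"
      by (rule measurable_completion) measurable
    show "AE z in weighted_gaussian s. (F z - g z) * cnj (h z) = (F' z - g z) * cnj (h z)"
      unfolding weighted_gaussian_def AE_density[OF d]
      using ae by eventually_elim simp
  qed
  then have "(\<lambda>g. g \<in> fock_sobolev s \<and> (\<forall>h\<in>fock_sobolev s. weighted_inner s (\<lambda>z. F z - g z) h = 0))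
    = (\<lambda>g. g \<in> fock_sobolev s \<and> (\<forall>h\<in>fock_sobolev s. weighted_inner s (\<lambda>z. F' z - g z) h = 0))"
    by (intro ext) auto
  then show ?thesis unfolding fock_projection_def by simp
qed

lemma toeplitz_cong_AE:
  assumes "u \<in> borel_measurable lebesgue" "poly_bounded u'" "AE z in lebesgue. u z = u' z" "f \<in> borel_measurable borel"
  shows "toeplitz s u f = toeplitz s u' f"
  unfolding toeplitz_def
proof (rule fock_projection_cong_AE)
  have f: "f \<in> borel_measurable lebesgue" "u' \<in> borel_measurable lebesgue"
    using assms by (auto intro!: measurable_completion poly_bounded_measurable)
  show "(\<lambda>z. u z * f z) \<in> borel_measurable lebesgue" using assms(1) f(1) by (rule borel_measurable_times)
  show "(\<lambda>z. u' z * f z) \<in> borel_measurable lebesgue" using f(2,1) by (rule borel_measurable_times)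
  show "AE z in lebesgue. u z * f z = u' z * f z" using assms(3) by eventually_elim simp
qed

lemma toeplitz_monomial_measurable:
  assumes "s \<ge> 0" "poly_bounded u"
  shows "toeplitz s u (\<lambda>z. z ^ n) \<in> borel_measurable borel"
proof (rule entire_measurable, rule entire_series_holomorphic(1))
  have "poly_bounded (\<lambda>z. u z * z ^ n)" using assms by auto
  then show "(\<lambda>k. fock_coeff s (\<lambda>z. u z * z ^ n) k * z ^ k) sums toeplitz s u (\<lambda>z. z ^ n) z" for z
    unfolding toeplitz_def
    by (intro fock_projection_series assms poly_bounded_square_integrable poly_bounded_measurable) (use assms in auto)
qed

lemma radial_imp_rotation_invariant:
  assumes "radial u" "AE z in lebesgue. u z = u' z" "poly_bounded u'"
  shows "rotation_invariant u'"
  unfolding rotation_invariant_def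
proof (intro conjI allI impI)
  show "u' \<in> borel_measurable borel" using assms by measurable
  obtain \<phi> where "AE z in lebesgue. u z = \<phi> (cmod z)" using assms unfolding radial_def by blast
  then have "AE z in lebesgue. u' z = \<phi> (cmod z)" using assms(2) by eventually_elim simp
  then have ae: "AE z in gauss. u' z = \<phi> (cmod z)" by (simp only: AE_lebesgue_iff_gauss)
  fix \<xi> :: complex assume \<xi>: "cmod \<xi> = 1"
  have "AE z in gauss. u' (\<xi> * z) = \<phi> (cmod (\<xi> * z))"
    by (rule AE_gauss_rotate[OF \<xi> ae])
  then show "AE z in gauss. u' (\<xi> * z) = u' z"
    using ae by eventually_elim (simp add: norm_mult \<xi>)
qed

lemma mellin_shift_of_nat:
  assumes "poly_bounded V"
  shows "mellin V (of_real (s + real n)) = (\<integral>z. V z * of_real (norm_weight s z) * of_real (cmod z ^ (2 * n)) \<partial>gauss)"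
proof -
  have "V z * of_real (norm_weight s z) * of_real (cmod z ^ (2 * n)) = V z * of_real (norm_weight (s + real n) z)" for z
  proof -
    have "norm_weight (s + real n) z = norm_weight s z * cmod z ^ (2 * n)"
      by (simp add: norm_weight_def powr_mult_even_power)
    then show ?thesis by simp
  qed
  then show ?thesis by (simp only: mellin_of_real[OF assms])
qed

text \<open>A pair \<open>a < b = a + k\<close> is treated with \<open>V = v (cnj z)\<^sup>k\<close>, a pair \<open>a = b + k > b\<close> with \<open>V = v z\<^sup>k\<close>. In both
cases the alternative that \<open>u\<close> is periodic is excluded, and \<open>M\<^sub>V = 0\<close> at \<open>min a b\<close> is the vanishing of
the moment of type \<open>(a, b)\<close>. The value of \<open>M\<^sub>V\<close> there, without the shift by \<open>s\<close>, is available because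
\<open>M\<^sub>V\<close> vanishes on the whole half-plane.\<close>

theorem radial_if_commuting_poly_bounded:
  assumes s: "s \<ge> 0" and u: "poly_bounded u" and v: "poly_bounded v" and rot: "rotation_invariant u"
    and nonconst: "\<not> (\<exists>c. AE z in gauss. u z = c)"
    and comm: "\<And>n. toeplitz_commutator s u v (\<lambda>z. z ^ n) = (\<lambda>z. 0)"
  shows "radial v"
proof -
  have G: "Gamma (s + real n + 1) > 0" for n by (rule fock_Gamma_pos[OF s])
  have w: "fock_coeff s (\<lambda>z. u z * z ^ n) n = mellin u (of_real (s + real n)) / of_real (Gamma (s + real n + 1))" for n
  proof -
    have "of_real (norm_weight s z) * (u z * z ^ n * cnj (z ^ n)) = u z * of_real (norm_weight s z) * of_real (cmod z ^ (2 * n))" for z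
      unfolding mult_cnj_power[symmetric] by (simp add: mult_ac)
    then show ?thesis by (simp only: fock_coeff_def mellin_shift_of_nat[OF u])
  qed
  have diff: "fock_coeff s (\<lambda>z. u z * z ^ (n + k)) (n + k) - fock_coeff s (\<lambda>z. u z * z ^ n) n
      = (mellin u (of_real (s + real n + real k)) / of_real (pochhammer (s + real n + 1) k) - mellin u (of_real (s + real n))) / of_real (Gamma (s + real n + 1))" for n k
  proof -
    have "s + real n + 1 \<notin> \<int>\<^sub>\<le>\<^sub>0" using s by (auto elim!: nonpos_Ints_cases)
    then have "pochhammer (s + real n + 1) k = Gamma (s + real n + 1 + real k) / Gamma (s + real n + 1)"
      by (rule pochhammer_Gamma)
    then have e: "Gamma (s + real (n + k) + 1) = pochhammer (s + real n + 1) k * Gamma (s + real n + 1)"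
      using G[of n] by (simp add: add_ac)
    show ?thesis unfolding w e by (simp add: diff_divide_distrib add.assoc)
  qed
  have dich: "mellin V y = 0"
    if V: "poly_bounded V" and k: "k \<ge> 1" and y: "Re y > -1"
      and zero: "\<And>n. (fock_coeff s (\<lambda>z. u z * z ^ (n + k)) (n + k) - fock_coeff s (\<lambda>z. u z * z ^ n) n) * mellin V (of_real (s + real n)) = 0" for V k y
  proof -
    have "(mellin u (of_real (s + real n + real k)) / of_real (pochhammer (s + real n + 1) k)
        - mellin u (of_real (s + real n))) * mellin V (of_real (s + real n)) = 0" for n
      using zero[of n] G[of n] unfolding diff by simp
    from mellin_dichotomy[OF s u V k this] show ?thesis
    proof
      assume *: "\<forall>y. -1 < Re y \<longrightarrow> mellin u (y + of_nat k) = pochhammer (y + 1) k * mellin u y"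
      have "\<exists>c. AE z in gauss. u z = c"
        by (rule periodic_imp_constant[OF u rot k]) (use * in simp)
      then show ?thesis using nonconst by blast
    qed (use y in blast)
  qed
  have coeff_v: "fock_coeff s (\<lambda>z. v z * z ^ n) m = (\<integral>z. v z * of_real (norm_weight s z) * (z ^ n * cnj z ^ m) \<partial>gauss) / of_real (Gamma (s + real m + 1))" for n m
    unfolding fock_coeff_def by (simp add: mult_ac)
  have mono: "z ^ (n + k) * cnj z ^ n = z ^ k * of_real (cmod z ^ (2 * n))"
    "z ^ n * cnj z ^ (n + k) = cnj z ^ k * of_real (cmod z ^ (2 * n))" for z n k
    unfolding mult_cnj_power[symmetric] by (simp_all add: power_add mult_ac)
  have mellin_nat0: "mellin V (of_nat n) = (\<integral>z. V z * of_real (cmod z ^ (2 * n)) \<partial>gauss)" if "poly_bounded V" for V n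
    using mellin_of_nat[OF that, of n] by (simp add: power_mult)
  show ?thesis
  proof (rule radial_if_off_diagonal_moments_zero[OF v])
    fix a b :: nat assume "a \<noteq> b"
    have "\<exists>k\<ge>1. b = a + k" if "a < b"
      using that by (intro exI[of _ "b - a"]) simp
    moreover have "\<exists>k\<ge>1. a = b + k" if "b < a"
      using that by (intro exI[of _ "a - b"]) simp
    ultimately consider k where "k \<ge> 1" "b = a + k" | k where "k \<ge> 1" "a = b + k"
      using \<open>a \<noteq> b\<close> by (meson linorder_neqE_nat)
    then show "(\<integral>z. v z * z ^ a * cnj z ^ b \<partial>gauss) = 0"
    proof cases
      case 1
      have V: "poly_bounded (\<lambda>z. v z * cnj z ^ k)" using v by auto
      have "(fock_coeff s (\<lambda>z. u z * z ^ (n + k)) (n + k) - fock_coeff s (\<lambda>z. u z * z ^ n) n) * mellin (\<lambda>z. v z * cnj z ^ k) (of_real (s + real n)) = 0" for n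
        using toeplitz_commutator_coefficients[OF s u v rot comm, of "n + k" n] G[of "n + k"]
        unfolding coeff_v[of n "n + k"] mono mellin_shift_of_nat[OF V] by (simp add: mult_ac)
      then have "mellin (\<lambda>z. v z * cnj z ^ k) (of_nat a) = 0"
        using 1 by (intro dich[OF V, of k]) auto
      then show ?thesis
        unfolding mellin_nat0[OF V] 1 mult.assoc[of "v _"] mono by (simp add: mult_ac)
    next
      case 2
      have V: "poly_bounded (\<lambda>z. v z * z ^ k)" using v by auto
      have "(fock_coeff s (\<lambda>z. u z * z ^ (n + k)) (n + k) - fock_coeff s (\<lambda>z. u z * z ^ n) n) * mellin (\<lambda>z. v z * z ^ k) (of_real (s + real n)) = 0" for n
        using toeplitz_commutator_coefficients[OF s u v rot comm, of n "n + k"] G[of n]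
        unfolding coeff_v[of "n + k" n] mono mellin_shift_of_nat[OF V] by (auto simp: mult_ac)
      then have "mellin (\<lambda>z. v z * z ^ k) (of_nat b) = 0"
        using 2 by (intro dich[OF V, of k]) auto
      then show ?thesis
        unfolding mellin_nat0[OF V] 2 mult.assoc[of "v _"] mono by (simp add: mult_ac)
    qed
  qed
qed

theorem theorem1p1:
  fixes s :: real and u v :: "complex \<Rightarrow> complex"
  assumes "s \<ge> 0"
    and "u \<in> S_poly" and "v \<in> S_poly"
    and "nonconstant u" and "radial u"
    and "\<And>p :: complex poly. toeplitz_commutator s u v (poly p) = (\<lambda>z. 0)"
  shows "radial v"
proof -
  obtain u' where u': "poly_bounded u'" "AE z in lebesgue. u z = u' z"
    using S_poly_borel_version[OF assms(2)] by blast
  obtain v' where v': "poly_bounded v'" "AE z in lebesgue. v z = v' z"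
    using S_poly_borel_version[OF assms(3)] by blast
  have m: "u \<in> borel_measurable lebesgue" "v \<in> borel_measurable lebesgue"
    using assms(2,3) by (auto simp: S_poly_def)
  have "radial v'"
  proof (rule radial_if_commuting_poly_bounded[OF assms(1) u'(1) v'(1)])
    show "rotation_invariant u'" by (rule radial_imp_rotation_invariant[OF assms(5) u'(2,1)])
    show "\<not> (\<exists>c. AE z in gauss. u' z = c)"
    proof
      assume "\<exists>c. AE z in gauss. u' z = c"
      then obtain c where "AE z in lebesgue. u' z = c" by (auto simp: AE_lebesgue_iff_gauss)
      then have "AE z in lebesgue. u z = c" using u'(2) by eventually_elim simp
      then show False using assms(4) unfolding nonconstant_def by blast
    qed
    fix n
    have zn: "poly (monom 1 n) = (\<lambda>z::complex. z ^ n)" by (simp add: poly_monom fun_eq_iff)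
    have zm: "(\<lambda>z::complex. z ^ n) \<in> borel_measurable borel" by measurable
    have e: "toeplitz s u (\<lambda>z. z ^ n) = toeplitz s u' (\<lambda>z. z ^ n)" "toeplitz s v (\<lambda>z. z ^ n) = toeplitz s v' (\<lambda>z. z ^ n)"
      by (rule toeplitz_cong_AE[OF m(1) u' zm], rule toeplitz_cong_AE[OF m(2) v' zm])
    have "toeplitz s u (toeplitz s v' (\<lambda>z. z ^ n)) = toeplitz s u' (toeplitz s v' (\<lambda>z. z ^ n))"
      by (rule toeplitz_cong_AE[OF m(1) u' toeplitz_monomial_measurable[OF assms(1) v'(1)]])
    moreover have "toeplitz s v (toeplitz s u' (\<lambda>z. z ^ n)) = toeplitz s v' (toeplitz s u' (\<lambda>z. z ^ n))"
      by (rule toeplitz_cong_AE[OF m(2) v' toeplitz_monomial_measurable[OF assms(1) u'(1)]])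
    ultimately show "toeplitz_commutator s u' v' (\<lambda>z. z ^ n) = (\<lambda>z. 0)"
      using assms(6)[of "monom 1 n"] by (simp add: toeplitz_commutator_def zn e fun_eq_iff)
  qed
  then obtain \<phi> where "AE z in lebesgue. v' z = \<phi> (cmod z)" unfolding radial_def by blast
  then have "AE z in lebesgue. v z = \<phi> (cmod z)" using v'(2) by eventually_elim simp
  then show ?thesis unfolding radial_def by blast
qed

end
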